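(* Let $K$ be an algebraically closed field of characteristic $p>0$ and let $X$ be a singular surface in $\mathbb{A}^3_K$ defined by a purely inseparable equation $G(x,y,z)=x^p+F(y,z)=0$, where $F\in K[y,z]$ is a polynomial of order $\geq p$ at $0$ which is not a $p$-th power. Let $\tau:\widetilde{\mathbb{A}^3}\to\mathbb{A}^3$ be the blowup with center the origin and let $\pi:\widetilde{\mathbb{A}^2}\to\mathbb{A}^2$ be the induced blowup of $\mathbb{A}^2=0\times\mathbb{A}^2$ at the origin $a=0$, with exceptional divisor $E$. Let $f$ be the residue class of $F$ modulo $p$-th powers and assume that $f$ is not a quasi-monomial at $a$. Fix a local flag at $a$, and equip points on blowups with the induced flags. (i) There exists a local invariant, namely the adjusted height vector $i_a(f)=(\mathrm{intricacy}_a(f),\mathrm{slope}_a(f))$ (ordered lexicographically), such that for any closed point $a'\in E$ one has $$i_{a'}(f')<i_a(f),$$ where $f'$ denotes the equivalence class modulo $p$-th powers of the (strict) transform $F'$ of $F$ at $a'$. (ii) Finitely many point blowups transform $f$ in any point of the exceptional divisor into a monomial or make the order of $G$ drop below $p$.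
   Context: Classes modulo $p$-th powers. Let $R=K[y,z]$ be the coordinate ring of $\mathbb{A}^2_K$ and $R^p$ its subring of $p$-th powers; similarly for (charts of) blowups of $\mathbb{A}^2$. Let $a$ be a closed point, $\widehat R_a$ the completed local ring at $a$. Local coordinates at $a$ are a regular parameter system $(y,z)$ of $\widehat R_a$; they identify $\widehat R_a$ with $K[[y,z]]$. A nonzero class $f$ modulo $p$-th powers has a unique expansion $F=\sum c_{\alpha\beta}y^\alpha z^\beta\in K[[y,z]]$ with only exponents $(\alpha,\beta)\in\mathbb{N}^2\setminus p\mathbb{N}^2$ (delete all $p$-th power monomials). Flags. A local flag $\mathcal F$ at $a$ is a regular element (regular parameter) $h\in\widehat R_a$. Coordinates $(y,z)$ are subordinate to $\mathcal F$ if $z$ and $h$ generate the same ideal; $\mathcal C$ denotes the set of subordinate coordinates at $a$. Under the blowup $\pi$ of $a$ with exceptional divisor $E$, the induced flag $\mathcal F'$ at a closed point $a'\in E$ is the strict transform $\mathcal F^s$ of $\mathcal F$ if $a'\in E\cap\mathcal F^s$, and $E$ otherwise. Measures of an expansion. The Newton polygon of $F\neq0$ is $N(F)=\mathrm{conv}(\mathrm{supp}(F)+\mathbb{R}_+^2)$; $A$ denotes its set of vertices $(\alpha,\beta)$ ($\alpha$ the $y$-exponent, $\beta$ the $z$-exponent). Put $\mathrm{ord}_y(F)=\min_A\alpha$, $\deg_y(F)=\max_A\alpha$, $\mathrm{ord}_z(F)=\min_A\beta$, $\deg_z(F)=\max_A\beta$, $\mathrm{height}(F)=\deg_y(F)-\mathrm{ord}_y(F)$,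 $\mathrm{width}(F)=\deg_z(F)-\mathrm{ord}_z(F)$. If $N(F)$ is a quadrant, $\mathrm{slope}(F)=\infty$; otherwise $\mathrm{slope}(F)=\frac{\alpha_1}{\alpha_1-\alpha_2}(\beta_2-\beta_1)$, where $(\alpha_1,\beta_1),(\alpha_2,\beta_2)\in A$ are the vertices with highest and second highest first component. $F$ is adjacent if $\mathrm{ord}_y(F)=0$, close if $\mathrm{ord}_y(F)=1$, distant if $\mathrm{ord}_y(F)\ge2$. Fix constants $0<\varepsilon<\delta<1$; $\mathrm{bonus}(F)$ is $1+\delta$, $\varepsilon$, $0$ if $F$ is adjacent, close, distant, respectively. Invariant. $\mathrm{height}_a(f)=\min\{\mathrm{height}(F):(y,z)\in\mathcal C\}$, where $F$ is the expansion of $f$ in $(y,z)$. $\mathrm{bonus}(F)$ has the same value $\mathrm{bonus}_a(f)$ for all $(y,z)\in\mathcal C$ with $\mathrm{height}(F)=\mathrm{height}_a(f)$ ("coordinates realizing the height"). Put $\mathrm{intricacy}_a(f)=\mathrm{height}_a(f)-\mathrm{bonus}_a(f)$ and $\mathrm{slope}_a(f)=\max\{\mathrm{slope}(F):(y,z)\in\mathcal C,\ \mathrm{height}(F)=\mathrm{height}_a(f)\}$. The adjusted height vector is $i_a(f)=(\mathrm{intricacy}_a(f),\mathrm{slope}_a(f))$, ordered lexicographically with the first component most significant; it depends on the chosen flag. Monomial and quasi-monomial. $f$ is monomial at $a$ if in some (not necessarily subordinate) local coordinates its expansion is $y^\alpha z^\beta$ times a unit. A series $F$ is a quasi-monomial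 if $\mathrm{width}(F)=1$ and $\mathrm{ord}_y(F)=0$; $f$ is called a quasi-monomial at $a$ if its expansion in some subordinate coordinates realizing the height is a quasi-monomial. Transforms. Near $a'\in E$ the blowup is given, in coordinates subordinate to $\mathcal F$ at $a$ and to $\mathcal F'$ at $a'$, by $(y,z)\mapsto(yz+tz,z)$ with $t\in K$ or by $(y,z)\mapsto(y,yz)$. The strict transform $F'$ is accordingly $z^{-p}F(yz+tz,z)$ or $y^{-p}F(y,yz)$, and $f'$ is its class modulo $p$-th powers. Under blowup, $G$ is replaced by its strict transform, which at points of order $p$ has the form $x^p+F'$.
   Formalization: Part (i) additionally assumes that f is not already a monomial times a unit in coordinates subordinate to the flag; for every such f, (i) fails (e.g. p=2, F=y²z, flag z: at t=0 F'=y²z and the vector is unchanged). Part (ii) is unrestricted. *)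

theory Defs
  imports "HOL-Analysis.Analysis" "HOL-Computational_Algebra.Computational_Algebra"
begin

section \<open>The ring of power series in two variables\<close>

text \<open>
  The completed local ring at a closed point is \<open>K[[y,z]]\<close>, represented as \<open>K[[y]][[z]]\<close>: the
  outer series variable is \<open>z\<close> and the inner one is \<open>y\<close>. Likewise \<open>K[y,z]\<close> is \<open>K[y][z]\<close>.
\<close>

abbreviation y_var :: "'k::field fps fps" where
  "y_var \<equiv> fps_const fps_X"

abbreviation z_var :: "'k::field fps fps" where
  "z_var \<equiv> fps_X"

abbreviation scalar :: "'k::field \<Rightarrow> 'k fps fps" where
  "scalar c \<equiv> fps_const (fps_const c)"

text \<open>\<open>mcoeff F \<alpha> \<beta>\<close> is the coefficient of \<open>y\<^sup>\<alpha> z\<^sup>\<beta>\<close>.\<close>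

definition mcoeff :: "'k::field fps fps \<Rightarrow> nat \<Rightarrow> nat \<Rightarrow> 'k" where
  "mcoeff F \<alpha> \<beta> = fps_nth (fps_nth F \<beta>) \<alpha>"

definition series_of_poly :: "'k::field poly poly \<Rightarrow> 'k fps fps" where
  "series_of_poly F = fps_of_poly (map_poly fps_of_poly F)"

definition supp :: "'k::field fps fps \<Rightarrow> (nat \<times> nat) set" where
  "supp F = {(\<alpha>, \<beta>). mcoeff F \<alpha> \<beta> \<noteq> 0}"

definition series_order :: "'k::field fps fps \<Rightarrow> enat" where
  "series_order F = (INF (\<alpha>, \<beta>)\<in>supp F. enat (\<alpha> + \<beta>))"

text \<open>
  Substitution \<open>G(Y,Z)\<close> for \<open>Y\<close>, \<open>Z\<close> in the maximal ideal. In this case \<open>Y\<^sup>i Z\<^sup>j\<close> has order at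
  least \<open>i + j\<close>, so only the terms with \<open>i + j \<le> \<alpha> + \<beta>\<close> contribute to the monomial
  \<open>y\<^sup>\<alpha> z\<^sup>\<beta>\<close>. The value is meaningless for other \<open>Y\<close>, \<open>Z\<close>.
\<close>

definition subst2 :: "'k::field fps fps \<Rightarrow> 'k fps fps \<Rightarrow> 'k fps fps \<Rightarrow> 'k fps fps" where
  "subst2 G Y Z = Abs_fps (\<lambda>\<beta>. Abs_fps (\<lambda>\<alpha>.
     \<Sum>(i, j)\<in>{(i, j). i + j \<le> \<alpha> + \<beta>}. mcoeff G i j * mcoeff (Y ^ i * Z ^ j) \<alpha> \<beta>))"


section \<open>Local coordinates and expansions modulo p-th powers\<close>

definition max_ideal :: "'k::field fps fps set" where
  "max_ideal = {G. \<not> G dvd 1}"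

text \<open>Regular parameter systems: pairs generating the maximal ideal.\<close>

definition local_coords :: "'k::field fps fps \<Rightarrow> 'k fps fps \<Rightarrow> bool" where
  "local_coords Y Z \<longleftrightarrow> {A * Y + B * Z | A B. True} = max_ideal"

definition local_flag :: "'k::field fps fps \<Rightarrow> bool" where
  "local_flag h \<longleftrightarrow> (\<exists>g. local_coords g h)"

definition subordinate_coords :: "'k::field fps fps \<Rightarrow> ('k fps fps \<times> 'k fps fps) set" where
  "subordinate_coords h = {(Y, Z). local_coords Y Z \<and> Z dvd h \<and> h dvd Z}"

definition in_coords :: "'k::field fps fps \<Rightarrow> 'k fps fps \<Rightarrow> 'k fps fps \<Rightarrow> 'k fps fps" where
  "in_coords F Y Z = (THE F'. subst2 F' Y Z = F)"

definition delete_ppowers :: "nat \<Rightarrow> 'k::field fps fps \<Rightarrow> 'k fps fps" where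
  "delete_ppowers p F = Abs_fps (\<lambda>\<beta>. Abs_fps (\<lambda>\<alpha>.
     if p dvd \<alpha> \<and> p dvd \<beta> then 0 else mcoeff F \<alpha> \<beta>))"

text \<open>
  A class modulo \<open>p\<close>-th powers is given by any representative \<open>F\<close>. Over a perfect field of
  characteristic \<open>p\<close> the \<open>p\<close>-th powers in \<open>K[[y,z]]\<close> are the series in \<open>y\<^sup>p, z\<^sup>p\<close>, so the
  expansion below depends only on the class of \<open>F\<close>.
\<close>

definition expansion :: "nat \<Rightarrow> 'k::field fps fps \<Rightarrow> 'k fps fps \<times> 'k fps fps \<Rightarrow> 'k fps fps" where
  "expansion p F = (\<lambda>(Y, Z). delete_ppowers p (in_coords F Y Z))"


section \<open>Measures of an expansion\<close>

definition newton_polygon :: "'k::field fps fps \<Rightarrow> (real \<times> real) set" where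
  "newton_polygon F =
     convex hull {(real \<alpha> + s, real \<beta> + t) | \<alpha> \<beta> s t. (\<alpha>, \<beta>) \<in> supp F \<and> 0 \<le> s \<and> 0 \<le> t}"

text \<open>All vertices of the Newton polygon lie in the support, hence are integral.\<close>

definition vertices :: "'k::field fps fps \<Rightarrow> (nat \<times> nat) set" where
  "vertices F = {(\<alpha>, \<beta>). (real \<alpha>, real \<beta>) extreme_point_of newton_polygon F}"

definition ord_y :: "'k::field fps fps \<Rightarrow> nat" where
  "ord_y F = Min (fst ` vertices F)"

definition deg_y :: "'k::field fps fps \<Rightarrow> nat" where
  "deg_y F = Max (fst ` vertices F)"

definition ord_z :: "'k::field fps fps \<Rightarrow> nat" where
  "ord_z F = Min (snd ` vertices F)"

definition deg_z :: "'k::field fps fps \<Rightarrow> nat" where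
  "deg_z F = Max (snd ` vertices F)"

definition height :: "'k::field fps fps \<Rightarrow> nat" where
  "height F = deg_y F - ord_y F"

definition width :: "'k::field fps fps \<Rightarrow> nat" where
  "width F = deg_z F - ord_z F"

definition is_quadrant :: "(real \<times> real) set \<Rightarrow> bool" where
  "is_quadrant N \<longleftrightarrow> (\<exists>a b. N = {a..} \<times> {b..})"

definition slope :: "'k::field fps fps \<Rightarrow> ereal" where
  "slope F =
     (if is_quadrant (newton_polygon F) then \<infinity>
      else
        let \<alpha>1 = Max (fst ` vertices F);
            \<alpha>2 = Max (fst ` vertices F - {\<alpha>1});
            \<beta>1 = (THE \<beta>. (\<alpha>1, \<beta>) \<in> vertices F);
            \<beta>2 = (THE \<beta>. (\<alpha>2, \<beta>) \<in> vertices F)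
        in ereal (real \<alpha>1 / (real \<alpha>1 - real \<alpha>2) * (real \<beta>2 - real \<beta>1)))"

text \<open>The three cases are called adjacent, close and distant.\<close>

definition bonus :: "real \<Rightarrow> real \<Rightarrow> 'k::field fps fps \<Rightarrow> real" where
  "bonus \<epsilon> \<delta> F = (if ord_y F = 0 then 1 + \<delta> else if ord_y F = 1 then \<epsilon> else 0)"


section \<open>The adjusted height vector\<close>

definition height_at :: "nat \<Rightarrow> 'k::field fps fps \<Rightarrow> 'k fps fps \<Rightarrow> nat" where
  "height_at p h F = (LEAST n. \<exists>c\<in>subordinate_coords h. n = height (expansion p F c))"

definition realizing_coords ::
    "nat \<Rightarrow> 'k::field fps fps \<Rightarrow> 'k fps fps \<Rightarrow> ('k fps fps \<times> 'k fps fps) set" where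
  "realizing_coords p h F =
     {c \<in> subordinate_coords h. height (expansion p F c) = height_at p h F}"

definition bonus_at ::
    "real \<Rightarrow> real \<Rightarrow> nat \<Rightarrow> 'k::field fps fps \<Rightarrow> 'k fps fps \<Rightarrow> real" where
  "bonus_at \<epsilon> \<delta> p h F = (THE b. \<forall>c\<in>realizing_coords p h F. bonus \<epsilon> \<delta> (expansion p F c) = b)"

definition intricacy_at ::
    "real \<Rightarrow> real \<Rightarrow> nat \<Rightarrow> 'k::field fps fps \<Rightarrow> 'k fps fps \<Rightarrow> real" where
  "intricacy_at \<epsilon> \<delta> p h F = real (height_at p h F) - bonus_at \<epsilon> \<delta> p h F"

definition slope_at :: "nat \<Rightarrow> 'k::field fps fps \<Rightarrow> 'k fps fps \<Rightarrow> ereal" where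
  "slope_at p h F = (GREATEST s. \<exists>c\<in>realizing_coords p h F. s = slope (expansion p F c))"

definition adjusted_height_vector ::
    "real \<Rightarrow> real \<Rightarrow> nat \<Rightarrow> 'k::field fps fps \<Rightarrow> 'k fps fps \<Rightarrow> real \<times> ereal" where
  "adjusted_height_vector \<epsilon> \<delta> p h F = (intricacy_at \<epsilon> \<delta> p h F, slope_at p h F)"

text \<open>
  The lexicographic order is spelled out because the product order on pairs in scope is
  componentwise.
\<close>

definition lex_less :: "real \<times> ereal \<Rightarrow> real \<times> ereal \<Rightarrow> bool" where
  "lex_less v w \<longleftrightarrow> fst v < fst w \<or> fst v = fst w \<and> snd v < snd w"


section \<open>Monomials and quasi-monomials\<close>

definition monomial_series :: "'k::field fps fps \<Rightarrow> bool" where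
  "monomial_series F \<longleftrightarrow> (\<exists>\<alpha> \<beta> u. u dvd 1 \<and> F = y_var ^ \<alpha> * z_var ^ \<beta> * u)"

definition monomial_at :: "nat \<Rightarrow> 'k::field fps fps \<Rightarrow> bool" where
  "monomial_at p F \<longleftrightarrow> (\<exists>Y Z. local_coords Y Z \<and> monomial_series (expansion p F (Y, Z)))"

text \<open>
  The case excluded when comparing adjusted height vectors. Here the height is \<open>0\<close> and the slope
  is \<open>\<infinity>\<close>, and in subordinate coordinates the point \<open>t = 0\<close> of the exceptional divisor sends
  \<open>y\<^sup>\<alpha> z\<^sup>\<beta>\<close> to \<open>y\<^sup>\<alpha> z\<^bsup>\<alpha> + \<beta> - p\<^esup>\<close> with the same height, bonus and slope (for instance
  \<open>y\<^sup>2 z\<close> to itself for \<open>p = 2\<close>), so that the vector does not drop.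
\<close>

definition subordinate_monomial_at :: "nat \<Rightarrow> 'k::field fps fps \<Rightarrow> 'k fps fps \<Rightarrow> bool" where
  "subordinate_monomial_at p h F \<longleftrightarrow>
     (\<exists>c\<in>subordinate_coords h. monomial_series (expansion p F c))"

definition quasi_monomial_series :: "'k::field fps fps \<Rightarrow> bool" where
  "quasi_monomial_series F \<longleftrightarrow> width F = 1 \<and> ord_y F = 0"

definition quasi_monomial_at :: "nat \<Rightarrow> 'k::field fps fps \<Rightarrow> 'k fps fps \<Rightarrow> bool" where
  "quasi_monomial_at p h F \<longleftrightarrow>
     (\<exists>c\<in>realizing_coords p h F. quasi_monomial_series (expansion p F c))"


section \<open>Point blowups\<close>

text \<open>
  The closed points of the exceptional divisor \<open>E\<close>: \<open>Affine t\<close> is the origin of the chart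
  \<open>(y,z) \<mapsto> (yz + tz, z)\<close>, and \<open>Infinite\<close> is the origin of the chart \<open>(y,z) \<mapsto> (y, yz)\<close>.
\<close>

datatype 'k exc_point = Affine 'k | Infinite

fun pullback :: "'k::field exc_point \<Rightarrow> 'k fps fps \<Rightarrow> 'k fps fps" where
  "pullback (Affine t) G = subst2 G (y_var * z_var + scalar t * z_var) z_var"
| "pullback Infinite G = subst2 G y_var (y_var * z_var)"

text \<open>The local equation of \<open>E\<close>.\<close>

fun exc_eq :: "'k::field exc_point \<Rightarrow> 'k fps fps" where
  "exc_eq (Affine t) = z_var"
| "exc_eq Infinite = y_var"

text \<open>
  \<open>strict_transform m a' G\<close> is the pullback of \<open>G\<close> divided by the \<open>m\<close>-th power of the equation
  of \<open>E\<close>, for \<open>G\<close> of order at least \<open>m\<close>. With \<open>m = p\<close> it gives \<open>F'\<close>, and with \<open>m = 1\<close> the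
  strict transform of a flag. Computing in other local coordinates multiplies the equation of
  \<open>E\<close> by a unit, hence \<open>F'\<close> by the \<open>p\<close>-th power of a unit; this changes neither the Newton
  polygons of its expansions nor whether it is a monomial.
\<close>

definition strict_transform :: "nat \<Rightarrow> 'k::field exc_point \<Rightarrow> 'k fps fps \<Rightarrow> 'k fps fps" where
  "strict_transform m a' G = (THE G'. exc_eq a' ^ m * G' = pullback a' G)"

definition induced_flag :: "'k::field exc_point \<Rightarrow> 'k fps fps \<Rightarrow> 'k fps fps" where
  "induced_flag a' h =
     (let hs = strict_transform 1 a' h in if hs \<in> max_ideal then hs else exc_eq a')"


section \<open>Resolution by finitely many point blowups\<close>

text \<open>The equation \<open>G = x\<^sup>p + F\<close> as a polynomial in \<open>x\<close> over \<open>K[[y,z]]\<close>.\<close>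

definition hypersurface_eq :: "nat \<Rightarrow> 'k::field fps fps \<Rightarrow> 'k fps fps poly" where
  "hypersurface_eq p F = monom 1 p + [:F:]"

text \<open>The order of \<open>G\<close> at the point \<open>x = c\<close>, \<open>y = z = 0\<close>.\<close>

definition order_at :: "'k::field \<Rightarrow> 'k fps fps poly \<Rightarrow> enat" where
  "order_at c G = (INF i. enat i + series_order (coeff (pcompose G [:scalar c, 1:]) i))"

text \<open>
  All points of the surface over the given point of the plane are taken into account: the
  constant term of \<open>F\<close> need not vanish.
\<close>

definition order_drops :: "nat \<Rightarrow> 'k::field fps fps \<Rightarrow> bool" where
  "order_drops p F \<longleftrightarrow> (\<forall>c. order_at c (hypersurface_eq p F) < enat p)"

definition terminal :: "nat \<Rightarrow> 'k::field fps fps \<Rightarrow> bool" where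
  "terminal p F \<longleftrightarrow> monomial_at p F \<or> order_drops p F"

text \<open>
  At a point over which \<open>G = x\<^sup>p + F\<close> has order \<open>p\<close>, this order is attained at \<open>x = c\<close> with
  \<open>c\<^sup>p = -F(0)\<close>; the translation \<open>x \<mapsto> x + c\<close> moves that point to the origin and removes
  the constant term of \<open>F\<close>.
\<close>

definition recenter :: "'k::field fps fps \<Rightarrow> 'k fps fps" where
  "recenter F = F - scalar (mcoeff F 0 0)"

text \<open>
  \<open>finitely_resolved p F\<close>: after the blowup of the given point and finitely many further blowups
  of points lying over it, all closed points of the exceptional divisor are terminal. Only
  nonterminal points are blown up. As the predicate is inductive and each blowup leaves only
  finitely many nonterminal points, the total number of blowups is finite.
\<close>

inductive finitely_resolved :: "nat \<Rightarrow> 'k::field fps fps \<Rightarrow> bool" for p :: nat where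
  blowup: "\<lbrakk>finite {a'. \<not> terminal p (strict_transform p a' F)};
    \<And>a'. \<not> terminal p (strict_transform p a' F) \<Longrightarrow>
      finitely_resolved p (recenter (strict_transform p a' F))\<rbrakk>
    \<Longrightarrow> finitely_resolved p F"

end

theory Submission
  imports Defs
begin

text \<open>
  Why the theorem holds. Let \<open>F\<close> be the expansion of the class in coordinates \<open>(y,z)\<close>, with \<open>z\<close>
  cutting out the flag, and let \<open>(D,d)\<close> be the lowest vertex of its Newton polygon. Rescaling \<open>y\<close>
  and \<open>z\<close> by units does not change the Newton polygon, so only the translations
  \<open>y \<mapsto> y + g(z)\<close> matter (\<open>subordinate_change_factors\<close>). A translation moves exponents upwards
  and therefore fixes \<open>(D,d)\<close>. Hence the height is \<open>D - e\<close>, where \<open>e\<close> is the largest order in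
  \<open>y\<close> that a translate of \<open>F\<close> can have (\<open>frame_invariants\<close>). The slope is \<open>D\<close> times the
  smallest ratio \<open>(b - d) / (D - a)\<close> over the terms \<open>y\<^sup>a z\<^sup>b\<close> with \<open>a < D\<close>
  (\<open>slope_eqI\<close>). Its maximum exists: translations that produce larger and larger slopes agree to
  higher and higher order, so if the slopes were unbounded, a limit translation would produce a monomial
  (\<open>steep_bounded\<close>).

  A blowup acts on exponents by an affine map, preceded by the translation \<open>y \<mapsto> y + t z\<close> that
  moves the point \<open>t\<close> of the exceptional divisor to the origin. Choosing other coordinates before the
  blowup changes the transform by a change of coordinates and the \<open>p\<close>-th power of a unit
  (\<open>blowup_frame\<close>). Let \<open>n\<close> be the order of \<open>F\<close>. Then part (i), proved in
  \<open>blowup_descent\<close>, has three cases.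

  \<^item> At the point at infinity the new height is at most \<open>D + d - n\<close>. This is less than the old
    one, and less by two if \<open>e = 0\<close> and \<open>F\<close> is not a quasi-monomial; this makes up for a
    lost bonus.
  \<^item> At a point \<open>t\<close> that is the tangent direction of coordinates realizing the height, the new
    \<open>e\<close> equals the old one, because the coordinates at the new point are those at the old point with
    this tangent. The vertex \<open>(D,d)\<close> either is lost, and the height drops, or survives, and the slope
    drops by \<open>D\<close>.
  \<^item> At any other point \<open>t\<close> the new \<open>e\<close> is smaller than the old one, and the new corner has
    \<open>y\<close>-exponent at most \<open>D - e + 1\<close>. Indeed, the order at \<open>t\<close> of the dehomogenized initial
    form is at most \<open>D - e\<close>, and it increases by at most one when \<open>p\<close>-th powers are deleted,
    since the derivative detects what remains (\<open>translated_initial_form\<close>). The bonus compensates for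
    the increase.

  For part (ii), the intricacy takes values in a set of order type \<open>\<omega>\<close> (\<open>rank\<close>), and the slope drops
  by at least one whenever the intricacy stays the same, so that chains of points that are not
  quasi-monomials are finite. A quasi-monomial has the Newton polygon of \<open>z\<^sup>d (y\<^sup>D + z)\<close>. Its
  blowup is a monomial except at infinity, where the polygon is that of
  \<open>y\<^sup>a z\<^sup>d (y\<^bsup>D-1\<^esup> + z)\<close>; repeating this, the height decreases to one
  (\<open>staircase_point_blowup\<close>). From then on the intricacy is at most one, so that the only
  quasi-monomials that can reappear have \<open>D = 2\<close>. Two blowups turn these into monomials
  (\<open>low_quasi_monomial_resolved\<close>), so the process ends. Finally, each blowup leaves only finitely many
  points that are not monomial, because the initial form or its derivative has only finitely many zeros
  (\<open>finite_nonterminal\<close>).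
\<close>

section \<open>Coefficients and the order of a series\<close>

(* Powers of y_var must keep their form, on which the coefficient rules match. *)
declare fps_const_power [simp del]

lemma mcoeff_eqI: "(\<And>a b. mcoeff F a b = mcoeff G a b) \<Longrightarrow> F = G"
  by (rule fps_ext, rule fps_ext) (simp add: mcoeff_def)

lemma mcoeff_0 [simp]: "mcoeff 0 a b = 0"
  by (simp add: mcoeff_def)

lemma mcoeff_add [simp]: "mcoeff (F + G) a b = mcoeff F a b + mcoeff G a b"
  by (simp add: mcoeff_def)

lemma mcoeff_diff [simp]: "mcoeff (F - G) a b = mcoeff F a b - mcoeff G a b"
  by (simp add: mcoeff_def)

lemma mcoeff_sum: "mcoeff (sum f A) a b = (\<Sum>x\<in>A. mcoeff (f x) a b)"
  by (simp add: mcoeff_def fps_sum_nth)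

lemma mcoeff_scalar_mult [simp]: "mcoeff (scalar c * F) a b = c * mcoeff F a b"
  by (simp add: mcoeff_def)

lemma mcoeff_scalar: "mcoeff (scalar c) a b = (if a = 0 \<and> b = 0 then c else 0)"
  by (simp add: mcoeff_def)

lemma mcoeff_1: "mcoeff 1 a b = (if a = 0 \<and> b = 0 then 1 else 0)"
  by (simp add: mcoeff_def)

lemma mcoeff_mult:
  "mcoeff (F * G) a b = (\<Sum>j\<le>b. \<Sum>i\<le>a. mcoeff F i j * mcoeff G (a - i) (b - j))"
  by (simp add: mcoeff_def fps_mult_nth fps_sum_nth atLeast0AtMost)

lemma mcoeff_mult_00 [simp]: "mcoeff (F * G) 0 0 = mcoeff F 0 0 * mcoeff G 0 0"
  by (simp add: mcoeff_mult)

lemma mcoeff_power_00 [simp]: "mcoeff (F ^ n) 0 0 = mcoeff F 0 0 ^ n"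
  by (induction n) (simp_all add: mcoeff_1)

lemma mcoeff_y_power_mult:
  "mcoeff (y_var ^ i * F) a b = (if i \<le> a then mcoeff F (a - i) b else 0)"
  by (simp add: mcoeff_def fps_const_power fps_X_power_mult_nth)

lemma mcoeff_z_power_mult:
  "mcoeff (z_var ^ j * F) a b = (if j \<le> b then mcoeff F a (b - j) else 0)"
  by (simp add: mcoeff_def fps_X_power_mult_nth)

lemma mcoeff_y_mult: "mcoeff (y_var * F) a b = (if 1 \<le> a then mcoeff F (a - 1) b else 0)"
  using mcoeff_y_power_mult[of 1 F a b] by simp

lemma mcoeff_z_mult: "mcoeff (z_var * F) a b = (if 1 \<le> b then mcoeff F a (b - 1) else 0)"
  using mcoeff_z_power_mult[of 1 F a b] by simp

lemma mcoeff_monomial: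
  "mcoeff (y_var ^ i * z_var ^ j :: 'k::field fps fps) a b = (if a = i \<and> b = j then 1 else 0)"
proof -
  have "mcoeff (z_var ^ j * 1 :: 'k fps fps) a b = (if a = 0 \<and> b = j then 1 else 0)" for a b :: nat
    unfolding mcoeff_z_power_mult mcoeff_1 by auto
  then show ?thesis by (auto simp: mcoeff_y_power_mult)
qed

lemma mcoeff_y_var: "mcoeff y_var a b = (if a = 1 \<and> b = 0 then 1 else 0)"
  using mcoeff_monomial[of 1 0 a b] by simp

lemma mcoeff_z_var: "mcoeff z_var a b = (if a = 0 \<and> b = 1 then 1 else 0)"
  using mcoeff_monomial[of 0 1 a b] by simp

text \<open>
  The ideals \<open>ord_ge n\<close> are the powers of the maximal ideal. An identity of power series is
  proved below by proving it modulo each of them.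
\<close>

definition ord_ge :: "nat \<Rightarrow> 'k::field fps fps \<Rightarrow> bool" where
  "ord_ge n F \<longleftrightarrow> (\<forall>a b. a + b < n \<longrightarrow> mcoeff F a b = 0)"

lemma ord_geD: "ord_ge n F \<Longrightarrow> a + b < n \<Longrightarrow> mcoeff F a b = 0"
  by (simp add: ord_ge_def)

lemma ord_ge_0 [simp]: "ord_ge 0 F" and ord_ge_zero [simp]: "ord_ge n 0"
  by (simp_all add: ord_ge_def)

lemma ord_ge_1_iff:
  "ord_ge 1 F \<longleftrightarrow> mcoeff F 0 0 = 0" "ord_ge (Suc 0) F \<longleftrightarrow> mcoeff F 0 0 = 0"
  by (auto simp: ord_ge_def)

lemma ord_ge_mono: "ord_ge n F \<Longrightarrow> m \<le> n \<Longrightarrow> ord_ge m F"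
  by (auto simp: ord_ge_def)

lemma ord_ge_add: "ord_ge n F \<Longrightarrow> ord_ge n G \<Longrightarrow> ord_ge n (F + G)"
  and ord_ge_diff: "ord_ge n F \<Longrightarrow> ord_ge n G \<Longrightarrow> ord_ge n (F - G)"
  by (auto simp: ord_ge_def)

lemma ord_ge_mult:
  assumes "ord_ge m F" "ord_ge n G"
  shows "ord_ge (m + n) (F * G)"
  unfolding ord_ge_def mcoeff_mult
proof (intro allI impI sum.neutral ballI)
  fix a b i j :: nat
  assume *: "a + b < m + n" "j \<in> {..b}" "i \<in> {..a}"
  then have "i + j < m \<or> (a - i) + (b - j) < n" by auto
  then show "mcoeff F i j * mcoeff G (a - i) (b - j) = 0"
    using assms by (auto simp: ord_ge_def)
qed

lemma ord_ge_mult_left: "ord_ge n G \<Longrightarrow> ord_ge n (F * G)"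
  using ord_ge_mult[of 0 F n G] by simp

lemma ord_ge_power: "ord_ge 1 F \<Longrightarrow> ord_ge n (F ^ n)"
proof (induction n)
  case (Suc n)
  then show ?case using ord_ge_mult[of 1 F n "F ^ n"] by simp
qed simp

lemma ord_ge_power_mult_power:
  assumes "ord_ge 1 Y" "ord_ge 1 Z"
  shows "ord_ge (i + j) (Y ^ i * Z ^ j)"
  using ord_ge_mult[OF ord_ge_power[OF assms(1)] ord_ge_power[OF assms(2)]] .

lemma ord_ge_all_eqI:
  assumes "\<And>n. ord_ge n (F - G)"
  shows "F = G"
proof (rule mcoeff_eqI)
  fix a b show "mcoeff F a b = mcoeff G a b"
    using assms[of "Suc (a + b)"] by (auto simp: ord_ge_def)
qed

lemma ord_ge_iff_series_order: "enat n \<le> series_order F \<longleftrightarrow> ord_ge n F"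
proof -
  have "enat n \<le> series_order F \<longleftrightarrow> (\<forall>(a, b)\<in>supp F. enat n \<le> enat (a + b))"
    unfolding series_order_def le_INF_iff by (auto simp: split_beta)
  then show ?thesis by (auto simp: ord_ge_def supp_def not_less[symmetric])
qed

lemma unit_iff: "F dvd 1 \<longleftrightarrow> mcoeff F 0 0 \<noteq> 0"
proof
  assume "F dvd 1"
  then obtain G where "1 = F * G" by (auto simp: dvd_def)
  then have "mcoeff F 0 0 * mcoeff G 0 0 = 1"
    by (metis mcoeff_1 mcoeff_mult_00)
  then show "mcoeff F 0 0 \<noteq> 0" by auto
next
  assume "mcoeff F 0 0 \<noteq> 0"
  then have "fps_nth F 0 * inverse (fps_nth F 0) = 1"
    by (simp add: mcoeff_def inverse_mult_eq_1')
  then have "F * fps_right_inverse F (inverse (fps_nth F 0)) = 1"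
    by (rule fps_right_inverse)
  then show "F dvd 1" by (metis dvd_triv_left)
qed

lemma max_ideal_iff: "F \<in> max_ideal \<longleftrightarrow> ord_ge 1 F"
  unfolding max_ideal_def ord_ge_1_iff(1) mem_Collect_eq unit_iff by blast

section \<open>Substitution\<close>

definition trunc_eval :: "nat \<Rightarrow> 'k::field fps fps \<Rightarrow> 'k fps fps \<Rightarrow> 'k fps fps \<Rightarrow> 'k fps fps" where
  "trunc_eval n G Y Z = (\<Sum>(i, j)\<in>{(i, j). i + j < n}. scalar (mcoeff G i j) * (Y ^ i * Z ^ j))"

lemma finite_triangle: "finite {(i, j). i + j < (n::nat)}" "finite {(i, j). i + j \<le> (n::nat)}"
  by (rule finite_subset[of _ "{..n} \<times> {..n}"]; auto)+

lemma mcoeff_subst2: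
  "mcoeff (subst2 G Y Z) a b =
     (\<Sum>(i, j)\<in>{(i, j). i + j \<le> a + b}. mcoeff G i j * mcoeff (Y ^ i * Z ^ j) a b)"
  by (simp add: subst2_def mcoeff_def)

text \<open>
  Since \<open>Y\<^sup>i Z\<^sup>j\<close> has order at least \<open>i + j\<close>, a substitution is the evaluation of a
  polynomial up to terms of order \<open>n\<close>. This reduces the algebra of substitutions to finite sums.
\<close>

lemma subst2_trunc_eval:
  assumes "ord_ge 1 Y" "ord_ge 1 Z"
  shows "ord_ge n (subst2 G Y Z - trunc_eval n G Y Z)"
  unfolding ord_ge_def
proof (intro allI impI)
  fix a b :: nat
  assume ab: "a + b < n"
  have "mcoeff (trunc_eval n G Y Z) a b =
      (\<Sum>(i, j)\<in>{(i, j). i + j < n}. mcoeff G i j * mcoeff (Y ^ i * Z ^ j) a b)"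
    unfolding trunc_eval_def mcoeff_sum by (rule sum.cong) auto
  also have "\<dots> = mcoeff (subst2 G Y Z) a b"
    unfolding mcoeff_subst2
  proof (rule sum.mono_neutral_right, rule finite_triangle)
    show "{(i, j). i + j \<le> a + b} \<subseteq> {(i, j). i + j < n}" using ab by auto
    show "\<forall>x\<in>{(i, j). i + j < n} - {(i, j). i + j \<le> a + b}.
        (case x of (i, j) \<Rightarrow> mcoeff G i j * mcoeff (Y ^ i * Z ^ j) a b) = 0"
    proof
      fix x assume x: "x \<in> {(i, j). i + j < n} - {(i, j). i + j \<le> a + b}"
      obtain i j where ij: "x = (i, j)" by (cases x)
      with x have "\<not> i + j \<le> a + b" by simp
      then have "a + b < i + j" by simp
      with ij show "(case x of (i, j) \<Rightarrow> mcoeff G i j * mcoeff (Y ^ i * Z ^ j) a b) = 0"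
        by (simp add: ord_geD[OF ord_ge_power_mult_power[OF assms]])
    qed
  qed
  finally show "mcoeff (subst2 G Y Z - trunc_eval n G Y Z) a b = 0" by simp
qed

lemma trunc_eval_variables: "ord_ge n (G - trunc_eval n G y_var z_var)"
  unfolding ord_ge_def
proof (intro allI impI)
  fix a b :: nat
  assume ab: "a + b < n"
  have "mcoeff (trunc_eval n G y_var z_var) a b =
      (\<Sum>x\<in>{(i, j). i + j < n}. if x = (a, b) then mcoeff G a b else 0)"
    unfolding trunc_eval_def mcoeff_sum
    by (rule sum.cong) (auto simp: mcoeff_monomial split: if_splits)
  also have "\<dots> = mcoeff G a b"
    using ab by (simp add: finite_triangle)
  finally show "mcoeff (G - trunc_eval n G y_var z_var) a b = 0" by simp
qed

lemma subst2_add: "subst2 (F + G) Y Z = subst2 F Y Z + subst2 G Y Z"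
  by (rule mcoeff_eqI) (simp add: mcoeff_subst2 split_beta algebra_simps sum.distrib)

lemma subst2_scalar_mult: "subst2 (scalar c * G) Y Z = scalar c * subst2 G Y Z"
  by (rule mcoeff_eqI) (simp add: mcoeff_subst2 split_beta sum_distrib_left mult.assoc)

lemma subst2_0 [simp]: "subst2 0 Y Z = 0"
  by (rule mcoeff_eqI) (simp add: mcoeff_subst2 split_beta)

lemma subst2_uminus: "subst2 (- G) Y Z = - subst2 G Y Z"
  by (metis add_eq_0_iff subst2_0 subst2_add)

lemma subst2_diff: "subst2 (F - G) Y Z = subst2 F Y Z - subst2 G Y Z"
  using subst2_add[of F "- G"] by (simp add: subst2_uminus)

lemma subst2_sum: "subst2 (sum f A) Y Z = (\<Sum>x\<in>A. subst2 (f x) Y Z)"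
  by (induction A rule: infinite_finite_induct) (auto simp: subst2_add)

lemma ord_ge_subst2:
  assumes "ord_ge 1 Y" "ord_ge 1 Z" "ord_ge n G"
  shows "ord_ge n (subst2 G Y Z)"
  unfolding ord_ge_def mcoeff_subst2
proof (safe intro!: sum.neutral)
  fix a b i j :: nat
  assume "a + b < n" "i + j \<le> a + b"
  then show "mcoeff G i j * mcoeff (Y ^ i * Z ^ j) a b = 0"
    using ord_geD[OF assms(3), of i j] by simp
qed

lemma trunc_eval_y_mult: "trunc_eval (Suc n) (y_var * G) Y Z = Y * trunc_eval n G Y Z"
proof -
  have "trunc_eval (Suc n) (y_var * G) Y Z =
      (\<Sum>(i, j)\<in>(\<lambda>(i, j). (Suc i, j)) ` {(i, j). i + j < n}.
         scalar (mcoeff (y_var * G) i j) * (Y ^ i * Z ^ j))"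
    unfolding trunc_eval_def
  proof (rule sum.mono_neutral_right, rule finite_triangle)
    show "(\<lambda>(i, j). (Suc i, j)) ` {(i, j). i + j < n} \<subseteq> {(i, j). i + j < Suc n}" by auto
    show "\<forall>x\<in>{(i, j). i + j < Suc n} - (\<lambda>(i, j). (Suc i, j)) ` {(i, j). i + j < n}.
        (case x of (i, j) \<Rightarrow> scalar (mcoeff (y_var * G) i j) * (Y ^ i * Z ^ j)) = 0"
    proof safe
      fix i j assume *: "i + j < Suc n" "(i, j) \<notin> (\<lambda>(i, j). (Suc i, j)) ` {(i, j). i + j < n}"
      have "i = 0"
      proof (rule ccontr)
        assume "i \<noteq> 0"
        then have "(i, j) = (\<lambda>(i, j). (Suc i, j)) (i - 1, j)" "(i - 1, j) \<in> {(i, j). i + j < n}"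
          using * by auto
        then show False using *(2) by blast
      qed
      then show "scalar (mcoeff (y_var * G) i j) * (Y ^ i * Z ^ j) = 0"
        by (simp add: mcoeff_y_mult)
    qed
  qed
  also have "\<dots> = Y * trunc_eval n G Y Z"
    unfolding trunc_eval_def sum_distrib_left
    by (subst sum.reindex) (auto simp: inj_on_def mcoeff_y_mult mult.left_commute mult.assoc intro!: sum.cong)
  finally show ?thesis .
qed

lemma trunc_eval_z_mult: "trunc_eval (Suc n) (z_var * G) Y Z = Z * trunc_eval n G Y Z"
proof -
  have "trunc_eval (Suc n) (z_var * G) Y Z =
      (\<Sum>(i, j)\<in>(\<lambda>(i, j). (i, Suc j)) ` {(i, j). i + j < n}.
         scalar (mcoeff (z_var * G) i j) * (Y ^ i * Z ^ j))"
    unfolding trunc_eval_def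
  proof (rule sum.mono_neutral_right, rule finite_triangle)
    show "(\<lambda>(i, j). (i, Suc j)) ` {(i, j). i + j < n} \<subseteq> {(i, j). i + j < Suc n}" by auto
    show "\<forall>x\<in>{(i, j). i + j < Suc n} - (\<lambda>(i, j). (i, Suc j)) ` {(i, j). i + j < n}.
        (case x of (i, j) \<Rightarrow> scalar (mcoeff (z_var * G) i j) * (Y ^ i * Z ^ j)) = 0"
    proof safe
      fix i j assume *: "i + j < Suc n" "(i, j) \<notin> (\<lambda>(i, j). (i, Suc j)) ` {(i, j). i + j < n}"
      have "j = 0"
      proof (rule ccontr)
        assume "j \<noteq> 0"
        then have "(i, j) = (\<lambda>(i, j). (i, Suc j)) (i, j - 1)" "(i, j - 1) \<in> {(i, j). i + j < n}"
          using * by auto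
        then show False using *(2) by blast
      qed
      then show "scalar (mcoeff (z_var * G) i j) * (Y ^ i * Z ^ j) = 0"
        by (simp add: mcoeff_z_mult)
    qed
  qed
  also have "\<dots> = Z * trunc_eval n G Y Z"
    unfolding trunc_eval_def sum_distrib_left
    by (subst sum.reindex) (auto simp: inj_on_def mcoeff_z_mult mult.left_commute mult.assoc intro!: sum.cong)
  finally show ?thesis .
qed

lemma subst2_variable_mult:
  assumes "ord_ge 1 Y" "ord_ge 1 Z"
  shows "subst2 (y_var * G) Y Z = Y * subst2 G Y Z" "subst2 (z_var * G) Y Z = Z * subst2 G Y Z"
proof -
  have "ord_ge n ((subst2 (y_var * G) Y Z - trunc_eval (Suc n) (y_var * G) Y Z)
      - Y * (subst2 G Y Z - trunc_eval n G Y Z))" for n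
    by (intro ord_ge_diff ord_ge_mult_left ord_ge_mono[OF subst2_trunc_eval] subst2_trunc_eval assms)
      simp
  then show "subst2 (y_var * G) Y Z = Y * subst2 G Y Z"
    by (intro ord_ge_all_eqI) (simp add: trunc_eval_y_mult right_diff_distrib)
  have "ord_ge n ((subst2 (z_var * G) Y Z - trunc_eval (Suc n) (z_var * G) Y Z)
      - Z * (subst2 G Y Z - trunc_eval n G Y Z))" for n
    by (intro ord_ge_diff ord_ge_mult_left ord_ge_mono[OF subst2_trunc_eval] subst2_trunc_eval assms)
      simp
  then show "subst2 (z_var * G) Y Z = Z * subst2 G Y Z"
    by (intro ord_ge_all_eqI) (simp add: trunc_eval_z_mult right_diff_distrib)
qed

lemma subst2_monomial_mult:
  assumes "ord_ge 1 Y" "ord_ge 1 Z"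
  shows "subst2 (y_var ^ i * z_var ^ j * G) Y Z = Y ^ i * Z ^ j * subst2 G Y Z"
proof -
  have 1: "subst2 (z_var ^ j * G) Y Z = Z ^ j * subst2 G Y Z" for G
    by (induction j arbitrary: G) (simp_all add: subst2_variable_mult[OF assms] mult.assoc)
  have "subst2 (y_var ^ i * H) Y Z = Y ^ i * subst2 H Y Z" for H
    by (induction i arbitrary: H) (simp_all add: subst2_variable_mult[OF assms] mult.assoc)
  from this[of "z_var ^ j * G"] show ?thesis by (simp add: 1 mult.assoc)
qed

text \<open>
  For a monomial \<open>F\<close> this is \<open>subst2_monomial_mult\<close>, and for a polynomial \<open>F\<close> it follows by
  linearity. The terms of \<open>F\<close> of degree at least \<open>n\<close> change both sides only in order at least
  \<open>n\<close>.
\<close>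

lemma subst2_mult:
  assumes YZ: "ord_ge 1 Y" "ord_ge 1 Z"
  shows "subst2 (F * G) Y Z = subst2 F Y Z * subst2 G Y Z"
proof (rule ord_ge_all_eqI)
  fix n
  define T where "T = trunc_eval n F y_var z_var"
  have "subst2 (T * G) Y Z = trunc_eval n F Y Z * subst2 G Y Z"
    unfolding T_def trunc_eval_def sum_distrib_right subst2_sum
    by (rule sum.cong)
      (auto simp: mult.assoc subst2_scalar_mult subst2_monomial_mult[OF YZ, unfolded mult.assoc])
  then have "subst2 (F * G) Y Z - subst2 F Y Z * subst2 G Y Z =
      subst2 ((F - T) * G) Y Z - (subst2 F Y Z - trunc_eval n F Y Z) * subst2 G Y Z"
    by (simp add: left_diff_distrib subst2_diff)
  also have "ord_ge n \<dots>"
    using trunc_eval_variables[of n F] subst2_trunc_eval[OF YZ, of n F]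
    by (intro ord_ge_diff ord_ge_subst2 YZ)
      (auto simp: T_def mult.commute[of _ G] mult.commute[of _ "subst2 G Y Z"] intro: ord_ge_mult_left)
  finally show "ord_ge n (subst2 (F * G) Y Z - subst2 F Y Z * subst2 G Y Z)" .
qed

lemma subst2_scalar [simp]: "subst2 (scalar c) Y Z = scalar c"
proof (rule mcoeff_eqI)
  fix a b
  have "mcoeff (subst2 (scalar c) Y Z) a b =
      (\<Sum>x\<in>{(i, j). i + j \<le> a + b}. if x = (0, 0) then mcoeff (scalar c) a b else 0)"
    unfolding mcoeff_subst2 by (rule sum.cong) (auto simp: mcoeff_scalar mcoeff_1 split: if_splits)
  then show "mcoeff (subst2 (scalar c) Y Z) a b = mcoeff (scalar c) a b"
    by (simp add: finite_triangle)
qed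

lemma subst2_1 [simp]: "subst2 1 Y Z = 1"
  using subst2_scalar[of 1] by simp

lemma subst2_y_var: "ord_ge 1 Y \<Longrightarrow> ord_ge 1 Z \<Longrightarrow> subst2 y_var Y Z = Y"
  using subst2_variable_mult(1)[of Y Z 1] by simp

lemma subst2_z_var: "ord_ge 1 Y \<Longrightarrow> ord_ge 1 Z \<Longrightarrow> subst2 z_var Y Z = Z"
  using subst2_variable_mult(2)[of Y Z 1] by simp

lemma subst2_power:
  "ord_ge 1 Y \<Longrightarrow> ord_ge 1 Z \<Longrightarrow> subst2 (F ^ n) Y Z = subst2 F Y Z ^ n"
  by (induction n) (simp_all add: subst2_mult)

lemma mcoeff_subst2_00 [simp]: "mcoeff (subst2 G Y Z) 0 0 = mcoeff G 0 0"
proof -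
  have "{(i, j). i + j \<le> (0::nat) + 0} = {(0, 0)}" by auto
  then show ?thesis unfolding mcoeff_subst2 by (simp add: mcoeff_1)
qed

lemma ord_ge_vars [simp]: "ord_ge 1 y_var" "ord_ge 1 z_var" "ord_ge (Suc 0) y_var" "ord_ge (Suc 0) z_var"
  by (simp_all add: ord_ge_1_iff mcoeff_y_var mcoeff_z_var)

text \<open>
  The substitution of \<open>Y\<close>, \<open>Z\<close> is a ring homomorphism, so both sides agree when \<open>G\<close> is
  replaced by a truncation; the remainder has high order.
\<close>

lemma subst2_trans:
  assumes AB: "ord_ge 1 A" "ord_ge 1 B" and YZ: "ord_ge 1 Y" "ord_ge 1 Z"
  shows "subst2 (subst2 G A B) Y Z = subst2 G (subst2 A Y Z) (subst2 B Y Z)"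
proof (rule ord_ge_all_eqI)
  fix n
  define A' B' where "A' = subst2 A Y Z" and "B' = subst2 B Y Z"
  have A'B': "ord_ge 1 A'" "ord_ge 1 B'"
    unfolding A'_def B'_def by (intro ord_ge_subst2 assms)+
  have "subst2 (trunc_eval n G A B) Y Z = trunc_eval n G A' B'"
    unfolding trunc_eval_def subst2_sum A'_def B'_def
    by (rule sum.cong) (auto simp: subst2_scalar_mult subst2_mult[OF YZ] subst2_power[OF YZ])
  then have "subst2 (subst2 G A B) Y Z - subst2 G A' B' =
      subst2 (subst2 G A B - trunc_eval n G A B) Y Z - (subst2 G A' B' - trunc_eval n G A' B')"
    by (simp add: subst2_diff)
  also have "ord_ge n \<dots>"
    by (intro ord_ge_diff ord_ge_subst2 subst2_trunc_eval assms A'B')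
  finally show "ord_ge n (subst2 (subst2 G A B) Y Z - subst2 G (subst2 A Y Z) (subst2 B Y Z))"
    by (simp add: A'_def B'_def)
qed

lemma subst2_id [simp]: "subst2 G y_var z_var = G"
proof (rule ord_ge_all_eqI)
  fix n
  have "subst2 G y_var z_var - G =
      (subst2 G y_var z_var - trunc_eval n G y_var z_var) - (G - trunc_eval n G y_var z_var)"
    by simp
  also have "ord_ge n \<dots>"
    by (intro ord_ge_diff subst2_trunc_eval trunc_eval_variables) auto
  finally show "ord_ge n (subst2 G y_var z_var - G)" .
qed

section \<open>Local coordinates\<close>

text \<open>
  The Jacobian determinant at the origin.
\<close>

definition jac :: "'k::field fps fps \<Rightarrow> 'k fps fps \<Rightarrow> 'k" where
  "jac Y Z = mcoeff Y 1 0 * mcoeff Z 0 1 - mcoeff Y 0 1 * mcoeff Z 1 0"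

lemma mcoeff_mult_10: "mcoeff (F * G) 1 0 = mcoeff F 0 0 * mcoeff G 1 0 + mcoeff F 1 0 * mcoeff G 0 0"
  and mcoeff_mult_01: "mcoeff (F * G) 0 1 = mcoeff F 0 0 * mcoeff G 0 1 + mcoeff F 0 1 * mcoeff G 0 0"
  by (simp_all add: mcoeff_mult atMost_Suc)

lemma ord_ge_2_iff:
  "ord_ge 2 F \<longleftrightarrow> mcoeff F 0 0 = 0 \<and> mcoeff F 1 0 = 0 \<and> mcoeff F 0 1 = 0"
proof -
  have "a + b < 2 \<longleftrightarrow> a = 0 \<and> b = 0 \<or> a = 1 \<and> b = 0 \<or> a = 0 \<and> b = 1" for a b :: nat by auto
  then show ?thesis unfolding ord_ge_def by auto
qed

lemma mcoeff_subst2_linear: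
  "mcoeff (subst2 G Y Z) 1 0 = mcoeff G 1 0 * mcoeff Y 1 0 + mcoeff G 0 1 * mcoeff Z 1 0"
  "mcoeff (subst2 G Y Z) 0 1 = mcoeff G 1 0 * mcoeff Y 0 1 + mcoeff G 0 1 * mcoeff Z 0 1"
proof -
  have eq: "{(i, j). i + j \<le> Suc 0} = {(0, 0), (1, 0), (0, 1 :: nat)}" by (auto simp: le_Suc_eq)
  show "mcoeff (subst2 G Y Z) 1 0 = mcoeff G 1 0 * mcoeff Y 1 0 + mcoeff G 0 1 * mcoeff Z 1 0"
    "mcoeff (subst2 G Y Z) 0 1 = mcoeff G 1 0 * mcoeff Y 0 1 + mcoeff G 0 1 * mcoeff Z 0 1"
    by (simp_all add: mcoeff_subst2 eq mcoeff_1)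
qed

lemma jac_subst2: "jac (subst2 A Y Z) (subst2 B Y Z) = jac A B * jac Y Z"
  unfolding jac_def mcoeff_subst2_linear by algebra

lemma variables_decomposition:
  obtains A B where "F = scalar (mcoeff F 0 0) + y_var * A + z_var * B"
proof
  show "F = scalar (mcoeff F 0 0) + y_var * fps_const (fps_shift 1 (fps_nth F 0)) + z_var * fps_shift 1 F"
  proof (rule mcoeff_eqI)
    fix a b
    show "mcoeff F a b = mcoeff (scalar (mcoeff F 0 0) +
        y_var * fps_const (fps_shift 1 (fps_nth F 0)) + z_var * fps_shift 1 F) a b"
      by (cases b) (auto simp: mcoeff_scalar mcoeff_y_mult mcoeff_z_mult, auto simp: mcoeff_def)
  qed
qed

lemma ord_ge_near_identity:
  assumes Y: "ord_ge 2 (Y - y_var)" and Z: "ord_ge 2 (Z - z_var)"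
  shows "ord_ge (Suc (i + j)) (Y ^ i * Z ^ j - y_var ^ i * z_var ^ j)"
proof -
  have power: "ord_ge (Suc n) (X ^ n - v ^ n)" if Xv: "ord_ge 2 (X - v)" "ord_ge 1 v" for X v :: "'a fps fps" and n
  proof (induction n)
    case (Suc n)
    have "ord_ge 1 ((X - v) + v)" using Xv by (intro ord_ge_add) (auto intro: ord_ge_mono)
    then have X: "ord_ge 1 X" by simp
    have "X ^ Suc n - v ^ Suc n = X * (X ^ n - v ^ n) + (X - v) * v ^ n"
      by (simp add: algebra_simps)
    also have "ord_ge (Suc (Suc n)) \<dots>"
      using ord_ge_mult[OF X Suc.IH] ord_ge_mult[OF Xv(1) ord_ge_power[OF Xv(2), of n]]
      by (intro ord_ge_add) auto
    finally show ?case .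
  qed simp
  have "ord_ge 1 ((Z - z_var) + z_var)" using Z by (intro ord_ge_add) (auto intro: ord_ge_mono)
  then have Z1: "ord_ge 1 Z" by simp
  have "Y ^ i * Z ^ j - y_var ^ i * z_var ^ j =
      (Y ^ i - y_var ^ i) * Z ^ j + y_var ^ i * (Z ^ j - z_var ^ j)"
    by (simp add: algebra_simps)
  also have "ord_ge (Suc (i + j)) \<dots>"
    using ord_ge_mult[OF power[OF Y, of i] ord_ge_power[OF Z1, of j]]
      ord_ge_mult[OF ord_ge_power[of y_var i] power[OF Z, of j]]
    by (intro ord_ge_add) auto
  finally show ?thesis .
qed

text \<open>
  The lowest homogeneous form of \<open>G\<close> is not affected by terms of order at least two in
  \<open>Y - y\<close> and \<open>Z - z\<close>.
\<close>

lemma subst2_near_identity_raises_order: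
  assumes Y: "ord_ge 2 (Y - y_var)" and Z: "ord_ge 2 (Z - z_var)" and G: "ord_ge n G"
  shows "ord_ge (Suc n) (G - subst2 G Y Z)"
  unfolding ord_ge_def
proof (intro allI impI)
  fix a b :: nat
  assume ab: "a + b < Suc n"
  have "mcoeff (subst2 G Y Z) a b = mcoeff (subst2 G y_var z_var) a b"
    unfolding mcoeff_subst2
  proof (rule sum.cong, simp, clarify)
    fix i j :: nat
    assume ij: "i + j \<le> a + b"
    show "mcoeff G i j * mcoeff (Y ^ i * Z ^ j) a b =
        mcoeff G i j * mcoeff (y_var ^ i * z_var ^ j) a b"
    proof (cases "i + j < n")
      case True
      then show ?thesis using G by (simp add: ord_ge_def)
    next
      case False
      then have "mcoeff (Y ^ i * Z ^ j - y_var ^ i * z_var ^ j) a b = 0"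
        using ab by (intro ord_geD[OF ord_ge_near_identity[OF Y Z, of i j]]) auto
      then show ?thesis by simp
    qed
  qed
  then show "mcoeff (G - subst2 G Y Z) a b = 0" by simp
qed

text \<open>
  Let \<open>T\<close> be the identity minus the substitution. It raises the order, so the geometric series
  \<open>\<Sum>k. T\<^sup>k\<close> converges and inverts the substitution.
\<close>

lemma bij_subst2_near_identity:
  assumes Y: "ord_ge 2 (Y - y_var)" and Z: "ord_ge 2 (Z - z_var)"
  shows "bij (\<lambda>G. subst2 G Y Z)"
proof (rule bijI)
  note raise = subst2_near_identity_raises_order[OF Y Z]
  show "inj (\<lambda>G. subst2 G Y Z)"
  proof (rule injI)
    fix G H assume "subst2 G Y Z = subst2 H Y Z"
    then have 0: "subst2 (G - H) Y Z = 0" by (simp add: subst2_diff)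
    have "ord_ge n (G - H)" for n
    proof (induction n)
      case (Suc n)
      then show ?case using raise[of n "G - H"] 0 by simp
    qed simp
    then show "G = H" by (rule ord_ge_all_eqI)
  qed
  show "surj (\<lambda>G. subst2 G Y Z)"
    unfolding surj_def
  proof
    fix H
    define T where "T = (\<lambda>G. G - subst2 G Y Z)"
    define S where "S n = (\<Sum>k<n. (T ^^ k) H)" for n
    define G where "G = Abs_fps (\<lambda>b. Abs_fps (\<lambda>a. mcoeff (S (Suc (a + b))) a b))"
    have T_iter: "ord_ge k ((T ^^ k) H)" for k
      by (induction k) (auto simp: T_def raise)
    have S_diff: "ord_ge n (S m - S n)" if "n \<le> m" for n m
      using that
    proof (induction rule: dec_induct)
      case (step m)
      have "ord_ge n ((S m - S n) + (T ^^ m) H)"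
        using step ord_ge_mono[OF T_iter[of m], of n] by (intro ord_ge_add) auto
      then show ?case by (simp add: S_def algebra_simps)
    qed simp
    have G_S: "ord_ge n (G - S n)" for n
      unfolding ord_ge_def
    proof (intro allI impI)
      fix a b :: nat assume "a + b < n"
      then have "mcoeff (S n - S (Suc (a + b))) a b = 0"
        by (intro ord_geD[OF S_diff]) auto
      then show "mcoeff (G - S n) a b = 0" by (simp add: G_def mcoeff_def)
    qed
    have T_S: "S n - subst2 (S n) Y Z = S (Suc n) - H" for n
    proof -
      have "S n - subst2 (S n) Y Z = (\<Sum>k<n. (T ^^ Suc k) H)"
        by (simp add: S_def subst2_sum T_def sum_subtractf)
      also have "\<dots> = S (Suc n) - H"
        unfolding S_def sum.lessThan_Suc_shift by simp
      finally show ?thesis .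
    qed
    have YZ: "ord_ge 1 Y" "ord_ge 1 Z"
      using ord_ge_add[OF ord_ge_mono[OF Y, of 1] ord_ge_vars(1)]
        ord_ge_add[OF ord_ge_mono[OF Z, of 1] ord_ge_vars(2)] by simp_all
    have "subst2 G Y Z = H"
    proof (rule ord_ge_all_eqI)
      fix n
      have "subst2 G Y Z - H = subst2 (G - S n) Y Z - (S (Suc n) - S n)"
        using T_S[of n] by (simp add: subst2_diff algebra_simps)
      also have "ord_ge n \<dots>"
        by (intro ord_ge_diff ord_ge_subst2 YZ G_S S_diff) simp
      finally show "ord_ge n (subst2 G Y Z - H)" .
    qed
    then show "\<exists>G. H = subst2 G Y Z" by metis
  qed
qed

lemma surj_compose_surj: "surj (f \<circ> g) \<Longrightarrow> surj f"
  unfolding surj_def comp_def by blast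

text \<open>
  The linear substitution by the inverse of the Jacobian matrix reduces this to
  \<open>bij_subst2_near_identity\<close>: applied first it gives surjectivity, applied last it gives
  injectivity.
\<close>

lemma bij_subst2:
  assumes YZ: "ord_ge 1 Y" "ord_ge 1 Z" and J: "jac Y Z \<noteq> 0"
  shows "bij (\<lambda>G. subst2 G Y Z)"
proof -
  define D where "D = jac Y Z"
  define P where "P = scalar (mcoeff Z 0 1 / D) * y_var + scalar (- mcoeff Y 0 1 / D) * z_var"
  define Q where "Q = scalar (- mcoeff Z 1 0 / D) * y_var + scalar (mcoeff Y 1 0 / D) * z_var"
  have PQ: "ord_ge 1 P" "ord_ge 1 Q"
    unfolding P_def Q_def by (intro ord_ge_add ord_ge_mult_left ord_ge_vars)+
  have D: "D \<noteq> 0" "mcoeff Y 1 0 * mcoeff Z 0 1 - mcoeff Y 0 1 * mcoeff Z 1 0 = D"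
    using J by (simp_all add: D_def jac_def)
  have lin: "mcoeff P 1 0 = mcoeff Z 0 1 / D" "mcoeff P 0 1 = - mcoeff Y 0 1 / D"
    "mcoeff Q 1 0 = - mcoeff Z 1 0 / D" "mcoeff Q 0 1 = mcoeff Y 1 0 / D"
    unfolding P_def Q_def mcoeff_add mcoeff_scalar_mult mcoeff_y_var mcoeff_z_var by simp_all
  have YZ0: "mcoeff Y 0 0 = 0" "mcoeff Z 0 0 = 0" "mcoeff P 0 0 = 0" "mcoeff Q 0 0 = 0"
    using YZ PQ by (simp_all add: ord_ge_1_iff)
  have inv: "a * (d / D) + b * (- c / D) - 1 = 0" "d / D * a + (- b / D) * c - 1 = 0"
    "a * (- b / D) + b * (a / D) - 0 = 0" "- c / D * a + a / D * c - 0 = 0"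
    "c * (d / D) + d * (- c / D) - 0 = 0" "d / D * b + (- b / D) * d - 0 = 0"
    "c * (- b / D) + d * (a / D) - 1 = 0" "- c / D * b + a / D * d - 1 = 0"
    if "a * d - b * c = D" for a b c d
    using that D(1) by (simp_all add: field_simps)
  note inv = inv[OF D(2)]
  have 1: "ord_ge 2 (subst2 P Y Z - y_var)" "ord_ge 2 (subst2 Q Y Z - z_var)"
    "ord_ge 2 (subst2 Y P Q - y_var)" "ord_ge 2 (subst2 Z P Q - z_var)"
    unfolding ord_ge_2_iff mcoeff_diff mcoeff_subst2_linear lin mcoeff_subst2_00 YZ0 mcoeff_y_var mcoeff_z_var
    using inv by simp_all
  have "surj ((\<lambda>G. subst2 G Y Z) \<circ> (\<lambda>G. subst2 G P Q))"
    using bij_subst2_near_identity[OF 1(1,2)] by (simp add: bij_def o_def subst2_trans[OF PQ YZ])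
  moreover have "inj ((\<lambda>G. subst2 G P Q) \<circ> (\<lambda>G. subst2 G Y Z))"
    using bij_subst2_near_identity[OF 1(3,4)] by (simp add: bij_def o_def subst2_trans[OF YZ PQ])
  ultimately show ?thesis
    unfolding bij_def by (meson inj_on_imageI2 surj_compose_surj)
qed

text \<open>
  Comparing linear terms in \<open>y = A Y + B Z\<close> and \<open>z = C Y + D Z\<close> inverts the Jacobian matrix.
  Conversely, a nonzero Jacobian makes every series of positive order a series in \<open>Y\<close> and \<open>Z\<close> without
  constant term.
\<close>

lemma local_coords_iff: "local_coords Y Z \<longleftrightarrow> ord_ge 1 Y \<and> ord_ge 1 Z \<and> jac Y Z \<noteq> 0"
proof
  assume lc: "local_coords Y Z"
  have mem: "A * Y + B * Z \<in> max_ideal" for A B using lc by (auto simp: local_coords_def)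
  have YZ: "ord_ge 1 Y" "ord_ge 1 Z"
    using mem[of 1 0] mem[of 0 1] by (simp_all add: max_ideal_iff)
  have "y_var \<in> {A * Y + B * Z | A B. True}" "z_var \<in> {A * Y + B * Z | A B. True}"
    using lc by (simp_all add: local_coords_def max_ideal_iff)
  then obtain A B C D where y: "y_var = A * Y + B * Z" and z: "z_var = C * Y + D * Z" by blast
  have "mcoeff Y 0 0 = 0" "mcoeff Z 0 0 = 0" using YZ by (simp_all add: ord_ge_1_iff)
  then have lin: "mcoeff (A * Y + B * Z) 1 0 = mcoeff A 0 0 * mcoeff Y 1 0 + mcoeff B 0 0 * mcoeff Z 1 0"
    "mcoeff (A * Y + B * Z) 0 1 = mcoeff A 0 0 * mcoeff Y 0 1 + mcoeff B 0 0 * mcoeff Z 0 1" for A B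
    by (simp_all only: mcoeff_add mcoeff_mult_10 mcoeff_mult_01, simp_all)
  have "mcoeff A 0 0 * mcoeff Y 1 0 + mcoeff B 0 0 * mcoeff Z 1 0 = 1"
    "mcoeff A 0 0 * mcoeff Y 0 1 + mcoeff B 0 0 * mcoeff Z 0 1 = 0"
    "mcoeff C 0 0 * mcoeff Y 1 0 + mcoeff D 0 0 * mcoeff Z 1 0 = 0"
    "mcoeff C 0 0 * mcoeff Y 0 1 + mcoeff D 0 0 * mcoeff Z 0 1 = 1"
    unfolding lin[symmetric] y[symmetric] z[symmetric] by (simp_all add: mcoeff_y_var mcoeff_z_var)
  then have "(mcoeff A 0 0 * mcoeff D 0 0 - mcoeff B 0 0 * mcoeff C 0 0) * jac Y Z = 1"
    unfolding jac_def by algebra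
  then show "ord_ge 1 Y \<and> ord_ge 1 Z \<and> jac Y Z \<noteq> 0" using YZ by auto
next
  assume *: "ord_ge 1 Y \<and> ord_ge 1 Z \<and> jac Y Z \<noteq> 0"
  then have YZ: "ord_ge 1 Y" "ord_ge 1 Z" and bij: "bij (\<lambda>G. subst2 G Y Z)"
    using bij_subst2 by auto
  have "F \<in> {A * Y + B * Z | A B. True}" if F: "ord_ge 1 F" for F
  proof -
    obtain G where G: "F = subst2 G Y Z" using bij_is_surj[OF bij] by (metis surjD)
    then have "mcoeff G 0 0 = 0" using F by (simp add: ord_ge_1_iff)
    then obtain A B where "G = y_var * A + z_var * B"
      using variables_decomposition[of G] by (metis add_0 fps_const_0_eq_0)
    then have "F = subst2 A Y Z * Y + subst2 B Y Z * Z"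
      by (simp add: G subst2_add subst2_variable_mult[OF YZ] mult.commute[of _ Y] mult.commute[of _ Z])
    then show ?thesis by blast
  qed
  moreover have "ord_ge 1 (A * Y + B * Z)" for A B
    using YZ by (intro ord_ge_add ord_ge_mult_left)
  ultimately show "local_coords Y Z"
    unfolding local_coords_def set_eq_iff max_ideal_iff by blast
qed

lemma local_coordsD:
  assumes "local_coords Y Z"
  shows "ord_ge 1 Y" "ord_ge 1 Z" "jac Y Z \<noteq> 0"
  using assms by (simp_all add: local_coords_iff)

lemma local_coords_variables: "local_coords y_var z_var"
  by (simp add: local_coords_iff jac_def mcoeff_y_var mcoeff_z_var)

lemma bij_subst2_local_coords: "local_coords Y Z \<Longrightarrow> bij (\<lambda>G. subst2 G Y Z)"
  by (simp add: local_coords_iff bij_subst2)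

lemma subst2_inj: "local_coords Y Z \<Longrightarrow> subst2 F Y Z = subst2 G Y Z \<Longrightarrow> F = G"
  using bij_subst2_local_coords[THEN bij_is_inj] by (metis injD)

lemma in_coords_eq_iff:
  assumes "local_coords Y Z"
  shows "in_coords F Y Z = G \<longleftrightarrow> F = subst2 G Y Z"
proof -
  have "\<exists>!G. subst2 G Y Z = F" using bij_subst2_local_coords[OF assms] unfolding bij_iff by metis
  then have "subst2 (in_coords F Y Z) Y Z = F" unfolding in_coords_def by (rule theI')
  then show ?thesis using subst2_inj[OF assms] by metis
qed

lemma subst2_in_coords: "local_coords Y Z \<Longrightarrow> subst2 (in_coords F Y Z) Y Z = F"
  using in_coords_eq_iff[of Y Z F "in_coords F Y Z"] by simp

lemma in_coords_subst2: "local_coords Y Z \<Longrightarrow> in_coords (subst2 G Y Z) Y Z = G"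
  by (simp add: in_coords_eq_iff)

lemma mcoeff_in_coords_00: "local_coords Y Z \<Longrightarrow> mcoeff (in_coords F Y Z) 0 0 = mcoeff F 0 0"
  using mcoeff_subst2_00[of "in_coords F Y Z" Y Z] by (simp add: subst2_in_coords)

lemma local_coords_subst2:
  assumes "local_coords A B" "local_coords Y Z"
  shows "local_coords (subst2 A Y Z) (subst2 B Y Z)"
  using assms by (simp add: local_coords_iff jac_subst2 ord_ge_subst2)

lemma local_coords_in_coords:
  assumes AB: "local_coords A B" and YZ: "local_coords Y Z"
  shows "local_coords (in_coords A Y Z) (in_coords B Y Z)"
proof -
  have "jac A B = jac (in_coords A Y Z) (in_coords B Y Z) * jac Y Z"
    using jac_subst2[of "in_coords A Y Z" Y Z "in_coords B Y Z"] by (simp add: subst2_in_coords YZ)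
  then show ?thesis using AB YZ by (auto simp: local_coords_iff ord_ge_1_iff mcoeff_in_coords_00)
qed

lemma in_coords_subst2_change:
  assumes AB: "local_coords A B" and YZ: "local_coords Y Z"
  shows "in_coords (subst2 G A B) Y Z = subst2 G (in_coords A Y Z) (in_coords B Y Z)"
  using local_coordsD[OF local_coords_in_coords[OF AB YZ]] local_coordsD[OF YZ]
  by (simp add: in_coords_eq_iff[OF YZ] subst2_trans subst2_in_coords[OF YZ])

section \<open>Series modulo p-th powers\<close>

text \<open>
  Only the terms of degree at most \<open>n\<close> matter, and the Frobenius map is additive on their sum.
\<close>

lemma fps_power_CHAR_nth:
  fixes f :: "'a::comm_ring_1 fps"
  assumes "prime p" "CHAR('a) = p"
  shows "fps_nth (f ^ p) n = (if p dvd n then fps_nth f (n div p) ^ p else 0)"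
proof -
  have p: "p > 0" using assms by (simp add: prime_gt_0_nat)
  define g where "g = (\<Sum>i\<le>n. fps_const (fps_nth f i) * fps_X ^ i)"
  define h where "h = fps_shift (Suc n) f"
  have "f = g + fps_X ^ Suc n * h"
  proof (rule fps_ext)
    fix k
    have "fps_nth g k = (\<Sum>i\<le>n. if i = k then fps_nth f k else 0)"
      unfolding g_def fps_sum_nth by (rule sum.cong) (auto simp: fps_X_power_nth)
    then show "fps_nth f k = fps_nth (g + fps_X ^ Suc n * h) k"
      by (auto simp: h_def fps_X_power_mult_nth simp del: power_Suc)
  qed
  then have "f ^ p = g ^ p + (fps_X ^ Suc n * h) ^ p"
    using freshmans_dream[where x = g and y = "fps_X ^ Suc n * h"] assms by simp
  also have "g ^ p = (\<Sum>i\<le>n. (fps_const (fps_nth f i) * fps_X ^ i) ^ p)"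
    unfolding g_def using freshmans_dream_sum[where ?'a = "'a fps"] assms by simp
  also have "\<dots> = (\<Sum>i\<le>n. fps_const (fps_nth f i ^ p) * fps_X ^ (i * p))"
    by (simp add: power_mult_distrib power_mult fps_const_power)
  finally have "fps_nth (f ^ p) n =
      (\<Sum>i\<le>n. fps_nth f i ^ p * fps_nth (fps_X ^ (i * p)) n) + fps_nth ((fps_X ^ Suc n * h) ^ p) n"
    by (simp add: fps_sum_nth)
  also have "fps_nth ((fps_X ^ Suc n * h) ^ p) n = fps_nth (fps_X ^ (Suc n * p) * h ^ p) n"
    by (metis power_mult power_mult_distrib)
  also have "\<dots> = 0"
    using p by (subst fps_X_power_mult_nth) (auto simp: less_Suc_eq_le intro!: le_less_trans[of n "n * p"])
  also have "(\<Sum>i\<le>n. fps_nth f i ^ p * fps_nth (fps_X ^ (i * p)) n) =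
      (\<Sum>i\<le>n. if i = n div p \<and> p dvd n then fps_nth f (n div p) ^ p else 0)"
    using p by (intro sum.cong) (auto simp: fps_X_power_nth)
  also have "\<dots> = (if p dvd n then fps_nth f (n div p) ^ p else 0)"
    by (auto simp: div_le_dividend)
  finally show ?thesis by simp
qed

text \<open>
  The type argument ties the characteristic to the field of coefficients.
\<close>

locale char_p =
  fixes p :: nat and K :: "'k::alg_closed_field itself"
  assumes CHAR_eq: "CHAR('k) = p" and p_pos: "p > 0"
begin

lemma prime_p: "prime p"
  using prime_CHAR_semidom[where ?'a = 'k] CHAR_eq p_pos by simp

lemma mcoeff_power_p:
  fixes F :: "'k fps fps"
  shows "mcoeff (F ^ p) a b = (if p dvd a \<and> p dvd b then mcoeff F (a div p) (b div p) ^ p else 0)"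
  unfolding mcoeff_def using prime_p CHAR_eq by (auto simp: fps_power_CHAR_nth prime_gt_0_nat zero_power)

abbreviation red :: "'k fps fps \<Rightarrow> 'k fps fps" where
  "red \<equiv> delete_ppowers p"

lemma mcoeff_red: "mcoeff (red F) a b = (if p dvd a \<and> p dvd b then 0 else mcoeff F a b)"
  by (simp add: delete_ppowers_def mcoeff_def)

lemma red_add: "red (F + G) = red F + red G"
  and red_diff: "red (F - G) = red F - red G"
  and red_red [simp]: "red (red F) = red F"
  and red_0 [simp]: "red 0 = 0"
  and red_power_p [simp]: "red (H ^ p) = 0"
  by (rule mcoeff_eqI, simp add: mcoeff_red mcoeff_power_p)+

text \<open>
  The coefficients have \<open>p\<close>-th roots because the field is algebraically closed.
\<close>

lemma red_eq_0_imp_power_p: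
  assumes "red F = 0"
  obtains H where "F = H ^ p"
proof -
  have "\<exists>r. r ^ p = c" for c :: 'k using nth_root_exists[of p] p_pos by blast
  then obtain r :: "'k \<Rightarrow> 'k" where r: "\<And>c. r c ^ p = c" by metis
  define H where "H = Abs_fps (\<lambda>b. Abs_fps (\<lambda>a. r (mcoeff F (a * p) (b * p))))"
  have "F = H ^ p"
  proof (rule mcoeff_eqI)
    fix a b
    have "mcoeff (red F) a b = 0" using assms by simp
    then have "mcoeff F a b = 0" if "\<not> (p dvd a \<and> p dvd b)"
      using that by (auto simp: mcoeff_red)
    moreover have "mcoeff H a b = r (mcoeff F (a * p) (b * p))" for a b
      by (simp add: H_def mcoeff_def)
    ultimately show "mcoeff F a b = mcoeff (H ^ p) a b"
      by (auto simp: mcoeff_power_p r)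
  qed
  then show ?thesis by (rule that)
qed

lemma red_decomposition:
  obtains H where "F = red F + H ^ p"
  using red_eq_0_imp_power_p[of "F - red F"] by (metis add.commute diff_add_cancel diff_self red_diff red_red)

lemma red_power_p_mult: "red (H ^ p * F) = H ^ p * red F"
proof -
  obtain Q where Q: "F = red F + Q ^ p" by (rule red_decomposition)
  have "red (H ^ p * red F) = H ^ p * red F"
  proof (rule mcoeff_eqI)
    fix a b
    have "mcoeff (H ^ p * red F) a b = 0" if ab: "p dvd a" "p dvd b"
      unfolding mcoeff_mult
    proof (intro sum.neutral ballI)
      fix i j assume "j \<in> {..b}" "i \<in> {..a}"
      then show "mcoeff (H ^ p) i j * mcoeff (red F) (a - i) (b - j) = 0"
        using ab by (auto simp: mcoeff_power_p mcoeff_red)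
    qed
    then show "mcoeff (red (H ^ p * red F)) a b = mcoeff (H ^ p * red F) a b"
      by (simp add: mcoeff_red)
  qed
  moreover have "H ^ p * F = H ^ p * red F + (H * Q) ^ p"
    by (subst Q) (simp add: distrib_left power_mult_distrib)
  ultimately show ?thesis by (simp add: red_add)
qed

text \<open>
  Ring homomorphisms preserve \<open>p\<close>-th powers, so a substitution acts on classes modulo
  \<open>p\<close>-th powers.
\<close>

lemma red_subst2:
  assumes "ord_ge 1 Y" "ord_ge 1 Z"
  shows "red (subst2 G Y Z) = red (subst2 (red G) Y Z)"
proof -
  obtain H where "G = red G + H ^ p" by (rule red_decomposition)
  then have "subst2 G Y Z = subst2 (red G) Y Z + subst2 H Y Z ^ p"
    by (metis subst2_add subst2_power assms)
  then show ?thesis by (simp add: red_add)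
qed

lemma ord_ge_red: "ord_ge n F \<Longrightarrow> ord_ge n (red F)"
  by (simp add: ord_ge_def mcoeff_red)

end

section \<open>Invariance of the Newton polygon under units\<close>

text \<open>
  The Newton polygon depends only on the upward closure of the support. In contrast to the
  support, this closure does not change when the series or the coordinates are multiplied by units.
\<close>

definition upset :: "'k::field fps fps \<Rightarrow> (nat \<times> nat) set" where
  "upset F = {(a, b). \<exists>i j. mcoeff F i j \<noteq> 0 \<and> i \<le> a \<and> j \<le> b}"

lemma upset_eq_empty_iff: "upset F = {} \<longleftrightarrow> F = 0"
proof
  assume *: "upset F = {}"
  have "mcoeff F a b = 0" for a b
  proof (rule ccontr)
    assume "mcoeff F a b \<noteq> 0"
    then have "(a, b) \<in> upset F" unfolding upset_def by blast
    with * show False by simp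
  qed
  then show "F = 0" by (intro mcoeff_eqI) simp
qed (simp add: upset_def)

lemma upset_mono: "(a, b) \<in> upset F \<Longrightarrow> a \<le> a' \<Longrightarrow> b \<le> b' \<Longrightarrow> (a', b') \<in> upset F"
  unfolding upset_def using le_trans by blast

lemma newton_polygon_upset:
  "newton_polygon F = convex hull {(real a + s, real b + t) | a b s t. (a, b) \<in> upset F \<and> 0 \<le> s \<and> 0 \<le> t}"
proof -
  have "{(real a + s, real b + t) | a b s t. (a, b) \<in> supp F \<and> 0 \<le> s \<and> 0 \<le> t} =
      {(real a + s, real b + t) | a b s t. (a, b) \<in> upset F \<and> 0 \<le> s \<and> 0 \<le> t}" (is "?L = ?R")
  proof (intro equalityI subsetI)
    fix x assume "x \<in> ?L"
    then show "x \<in> ?R" unfolding upset_def supp_def by blast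
  next
    fix x assume "x \<in> ?R"
    then obtain a b i j s t where *: "x = (real a + s, real b + t)" "0 \<le> s" "0 \<le> t"
      "mcoeff F i j \<noteq> 0" "i \<le> a" "j \<le> b" by (auto simp: upset_def)
    then have "x = (real i + (real a - real i + s), real j + (real b - real j + t))"
      "0 \<le> real a - real i + s" "0 \<le> real b - real j + t" "(i, j) \<in> supp F"
      by (auto simp: supp_def)
    then show "x \<in> ?L" by blast
  qed
  then show ?thesis unfolding newton_polygon_def by simp
qed

lemma newton_polygon_cong: "upset F = upset G \<Longrightarrow> newton_polygon F = newton_polygon G"
  by (simp add: newton_polygon_upset)

lemma upset_minimal:
  assumes "(a, b) \<in> upset F"
  obtains i j where "i \<le> a" "j \<le> b" "mcoeff F i j \<noteq> 0"
    "\<And>i' j'. i' \<le> i \<Longrightarrow> j' \<le> j \<Longrightarrow> mcoeff F i' j' \<noteq> 0 \<Longrightarrow> i' = i \<and> j' = j"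
proof -
  define P where "P x \<longleftrightarrow> mcoeff F (fst x) (snd x) \<noteq> 0 \<and> fst x \<le> a \<and> snd x \<le> b" for x
  have "\<exists>x. P x" using assms by (auto simp: upset_def P_def)
  then obtain x where x: "P x" and min: "\<And>y. P y \<Longrightarrow> fst x + snd x \<le> fst y + snd y"
    using ex_has_least_nat[of P _ "\<lambda>x. fst x + snd x"] by blast
  show ?thesis
  proof (rule that[of "fst x" "snd x"])
    fix i' j' assume *: "i' \<le> fst x" "j' \<le> snd x" "mcoeff F i' j' \<noteq> 0"
    then have "P (i', j')" using x by (auto simp: P_def)
    from min[OF this] show "i' = fst x \<and> j' = snd x" using * by simp
  qed (use x in \<open>auto simp: P_def\<close>)
qed

lemma upset_mult_subset: "upset (w * F) \<subseteq> upset F"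
proof safe
  fix a b assume "(a, b) \<in> upset (w * F)"
  then obtain i j where ij: "mcoeff (w * F) i j \<noteq> 0" "i \<le> a" "j \<le> b" by (auto simp: upset_def)
  from ij(1) obtain i' j' where "i' \<le> i" "j' \<le> j" "mcoeff F (i - i') (j - j') \<noteq> 0"
    unfolding mcoeff_mult
    by (elim sum.not_neutral_contains_not_neutral) auto
  moreover from this have "i - i' \<le> a" "j - j' \<le> b" using ij by auto
  ultimately show "(a, b) \<in> upset F" unfolding upset_def by blast
qed

lemma upset_unit_mult:
  assumes "w dvd 1"
  shows "upset (w * F) = upset F"
proof
  obtain v where "1 = w * v" using assms by (auto simp: dvd_def)
  then have "F = v * (w * F)" by (metis mult.assoc mult.commute mult_1)
  then show "upset F \<subseteq> upset (w * F)" by (metis upset_mult_subset)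
qed (rule upset_mult_subset)

context char_p begin

text \<open>
  In the coefficient at a minimal exponent \<open>(i,j)\<close> of the class only the monomial
  \<open>y\<^sup>i z\<^sup>j\<close> itself takes part. It is multiplied by \<open>u(0)\<^sup>i v(0)\<^sup>j\<close>, and it is not
  deleted because \<open>i\<close> and \<open>j\<close> are not both divisible by \<open>p\<close>.
\<close>

lemma upset_red_scaling:
  assumes u: "u dvd 1" and v: "v dvd 1"
  shows "upset (red (subst2 G (y_var * u) (z_var * v))) = upset (red G)"
proof -
  define G' where "G' = subst2 (red G) (y_var * u) (z_var * v)"
  have ord: "ord_ge 1 (y_var * u)" "ord_ge 1 (z_var * v)"
    by (simp_all add: mult.commute[of _ u] mult.commute[of _ v] ord_ge_mult_left)
  have red: "red (subst2 G (y_var * u) (z_var * v)) = red G'"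
    unfolding G'_def by (rule red_subst2[OF ord])
  have monomial: "mcoeff ((y_var * u) ^ i * (z_var * v) ^ j) a b =
      (if i \<le> a \<and> j \<le> b then mcoeff (u ^ i * v ^ j) (a - i) (b - j) else 0)" for i j a b
  proof -
    have "(y_var * u) ^ i * (z_var * v) ^ j = y_var ^ i * (z_var ^ j * (u ^ i * v ^ j))"
      by (simp add: power_mult_distrib algebra_simps)
    then show ?thesis by (simp only: mcoeff_y_power_mult mcoeff_z_power_mult) auto
  qed
  show ?thesis unfolding red
  proof (intro equalityI subrelI)
    fix a b assume "(a, b) \<in> upset (red G')"
    then obtain i j where ij: "mcoeff G' i j \<noteq> 0" "i \<le> a" "j \<le> b"
      by (auto simp: upset_def mcoeff_red split: if_splits)
    from ij(1) obtain x where "(case x of (i', j') \<Rightarrow>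
        mcoeff (red G) i' j' * mcoeff ((y_var * u) ^ i' * (z_var * v) ^ j') i j) \<noteq> 0"
      unfolding G'_def mcoeff_subst2 by (rule sum.not_neutral_contains_not_neutral)
    then obtain i' j' where *:
      "mcoeff (red G) i' j' * mcoeff ((y_var * u) ^ i' * (z_var * v) ^ j') i j \<noteq> 0"
      by (cases x) auto
    then have "i' \<le> i" "j' \<le> j" unfolding monomial by (auto split: if_splits)
    then have "mcoeff (red G) i' j' \<noteq> 0" "i' \<le> a" "j' \<le> b" using * ij by auto
    then show "(a, b) \<in> upset (red G)" unfolding upset_def by blast
  next
    fix a b assume "(a, b) \<in> upset (red G)"
    then obtain i j where ij: "i \<le> a" "j \<le> b" "mcoeff (red G) i j \<noteq> 0"
      and min: "\<And>i' j'. i' \<le> i \<Longrightarrow> j' \<le> j \<Longrightarrow> mcoeff (red G) i' j' \<noteq> 0 \<Longrightarrow> i' = i \<and> j' = j"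
      by (rule upset_minimal) blast
    have "mcoeff G' i j = (\<Sum>x\<in>{(i', j'). i' + j' \<le> i + j}.
        if x = (i, j) then mcoeff (red G) i j * mcoeff (u ^ i * v ^ j) 0 0 else 0)"
      unfolding G'_def mcoeff_subst2
    proof (rule sum.cong, simp, clarify)
      fix i' j'
      show "mcoeff (red G) i' j' * mcoeff ((y_var * u) ^ i' * (z_var * v) ^ j') i j =
          (if (i', j') = (i, j) then mcoeff (red G) i j * mcoeff (u ^ i * v ^ j) 0 0 else 0)"
        using min[of i' j'] unfolding monomial by auto
    qed
    also have "\<dots> = mcoeff (red G) i j * mcoeff (u ^ i * v ^ j) 0 0"
      by (simp add: finite_triangle)
    also have "\<dots> \<noteq> 0" using ij u v by (simp add: unit_iff)
    finally have "mcoeff (red G') i j \<noteq> 0" using ij(3) by (auto simp: mcoeff_red split: if_splits)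
    then show "(a, b) \<in> upset (red G')" using ij by (auto simp: upset_def)
  qed
qed

end

section \<open>Coordinates subordinate to the flag z\<close>

text \<open>
  A series in \<open>z\<close> alone.
\<close>

definition emb :: "'k::field fps \<Rightarrow> 'k fps fps" where
  "emb g = Abs_fps (\<lambda>b. fps_const (fps_nth g b))"

lemma mcoeff_emb: "mcoeff (emb g) a b = (if a = 0 then fps_nth g b else 0)"
  by (simp add: emb_def mcoeff_def)

lemma emb_add: "emb (f + g) = emb f + emb g"
  and emb_0 [simp]: "emb 0 = 0"
  by (rule mcoeff_eqI, simp add: mcoeff_emb)+

lemma ord_ge_emb: "fps_nth g 0 = 0 \<Longrightarrow> ord_ge 1 (emb g)" "fps_nth g 0 = 0 \<Longrightarrow> ord_ge (Suc 0) (emb g)"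
  by (simp_all add: ord_ge_1_iff mcoeff_emb)

lemma subst2_emb_cong: "subst2 (emb g) Y Z = subst2 (emb g) Y' Z"
proof (rule mcoeff_eqI)
  fix a b
  show "mcoeff (subst2 (emb g) Y Z) a b = mcoeff (subst2 (emb g) Y' Z) a b"
    unfolding mcoeff_subst2 by (rule sum.cong) (auto simp: mcoeff_emb)
qed

lemma subst2_emb_z [simp]: "subst2 (emb g) Y z_var = emb g"
  using subst2_emb_cong[of g Y z_var y_var] by simp

text \<open>
  The restriction to the curve \<open>y = 0\<close>.
\<close>

definition at_y_0 :: "'k::field fps fps \<Rightarrow> 'k fps" where
  "at_y_0 F = Abs_fps (\<lambda>b. mcoeff F 0 b)"

lemma at_y_0_nth [simp]: "fps_nth (at_y_0 F) b = mcoeff F 0 b"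
  by (simp add: at_y_0_def)

lemma at_y_0_mult: "at_y_0 (F * G) = at_y_0 F * at_y_0 G"
  by (rule fps_ext) (simp add: mcoeff_mult fps_mult_nth atLeast0AtMost)

lemma at_y_0_power: "at_y_0 (F ^ n) = at_y_0 F ^ n"
proof (induction n)
  case 0
  show ?case by (rule fps_ext) (simp add: mcoeff_1)
qed (simp add: at_y_0_mult)

lemma at_y_0_subst2_emb: "at_y_0 (subst2 (emb g) Y Z) = g oo at_y_0 Z"
proof (rule fps_ext)
  fix b
  have "fps_nth (at_y_0 (subst2 (emb g) Y Z)) b =
      (\<Sum>(i, j)\<in>Pair 0 ` {0..b}. mcoeff (emb g) i j * mcoeff (Y ^ i * Z ^ j) 0 b)"
    unfolding at_y_0_nth mcoeff_subst2
  proof (rule sum.mono_neutral_right, rule finite_triangle)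
    show "\<forall>x\<in>{(i, j). i + j \<le> 0 + b} - Pair 0 ` {0..b}.
        (case x of (i, j) \<Rightarrow> mcoeff (emb g) i j * mcoeff (Y ^ i * Z ^ j) 0 b) = 0"
      by (auto simp: mcoeff_emb)
  qed auto
  also have "\<dots> = (\<Sum>j\<in>{0..b}. fps_nth g j * fps_nth (at_y_0 Z ^ j) b)"
    by (subst sum.reindex) (auto simp: inj_on_def mcoeff_emb at_y_0_power[symmetric])
  finally show "fps_nth (at_y_0 (subst2 (emb g) Y Z)) b = fps_nth (g oo at_y_0 Z) b"
    by (simp add: fps_compose_nth)
qed

definition shift :: "'k::field fps \<Rightarrow> 'k fps fps \<Rightarrow> 'k fps fps" where
  "shift g G = subst2 G (y_var + emb g) z_var"

lemma ord_ge_shift_var: "fps_nth g 0 = 0 \<Longrightarrow> ord_ge 1 (y_var + emb g)"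
  by (intro ord_ge_add ord_ge_emb) auto

lemma shift_0 [simp]: "shift 0 G = G"
  by (simp add: shift_def)

lemma shift_shift:
  assumes "fps_nth f 0 = 0" "fps_nth g 0 = 0"
  shows "shift f (shift g G) = shift (f + g) G"
  using ord_ge_shift_var[OF assms(1)] ord_ge_shift_var[OF assms(2)]
  by (simp add: shift_def subst2_trans subst2_add subst2_y_var subst2_z_var emb_add add.assoc)

text \<open>
  Every change of subordinate coordinates is a translation of \<open>y\<close>, up to units. The translation
  \<open>g\<close> is chosen such that \<open>Y - g(Z)\<close> vanishes on the curve \<open>y = 0\<close> and hence is divisible by
  \<open>y\<close>. The equation \<open>g(Z(0,z)) = Y(0,z)\<close> can be solved because \<open>Z(0,z)\<close> has order one.
\<close>

lemma subordinate_change_factors: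
  assumes lc: "local_coords Y (z_var * v)" and v: "v dvd 1"
  obtains g w where "fps_nth g 0 = 0" "w dvd 1"
    "\<And>G. subst2 G Y (z_var * v) = subst2 (shift g G) (y_var * w) (z_var * v)"
proof -
  define Z where "Z = z_var * v"
  define a where "a = at_y_0 Z"
  note YZ = local_coordsD[OF lc, folded Z_def]
  have Z_coeff: "mcoeff Z 0 1 = mcoeff v 0 0" "mcoeff Z 1 0 = 0"
    by (simp_all add: Z_def mcoeff_z_mult)
  have v0: "mcoeff v 0 0 \<noteq> 0" using v by (simp add: unit_iff)
  have a: "fps_nth a 0 = 0" "fps_nth a 1 \<noteq> 0"
    using v0 Z_coeff YZ(2) by (simp_all add: a_def ord_ge_1_iff)
  define g where "g = at_y_0 Y oo fps_inv a"
  define W where "W = Y - subst2 (emb g) Y Z"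
  define w where "w = Abs_fps (\<lambda>b. fps_shift 1 (fps_nth W b))"
  have inv0: "fps_nth (fps_inv a) 0 = 0" by (simp add: fps_inv_def)
  have g0: "fps_nth g 0 = 0" using YZ(1) by (simp add: g_def ord_ge_1_iff)
  have "g oo a = at_y_0 Y"
    unfolding g_def using fps_compose_assoc[OF a(1) inv0, of "at_y_0 Y"] fps_inv[OF a] by simp
  then have "at_y_0 (subst2 (emb g) Y Z) = at_y_0 Y"
    by (simp add: at_y_0_subst2_emb a_def)
  then have W0: "mcoeff W 0 b = 0" for b
    unfolding W_def by (metis at_y_0_nth mcoeff_diff right_minus_eq)
  have W: "W = y_var * w"
  proof (rule mcoeff_eqI)
    fix i j show "mcoeff W i j = mcoeff (y_var * w) i j"
      using W0[of j] by (cases i) (simp_all add: mcoeff_y_mult, simp add: w_def mcoeff_def)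
  qed
  have "mcoeff W 1 0 = mcoeff Y 1 0"
    unfolding W_def mcoeff_diff mcoeff_subst2_linear by (simp add: mcoeff_emb Z_coeff[simplified])
  moreover have "mcoeff Y 1 0 \<noteq> 0" using YZ(3) Z_coeff by (auto simp: jac_def)
  ultimately have w: "w dvd 1" unfolding unit_iff W by (simp add: mcoeff_y_mult)
  have "subst2 (shift g G) (y_var * w) Z = subst2 G Y Z" for G
  proof -
    have yw: "ord_ge 1 (y_var * w)"
      using ord_ge_mult_left[OF ord_ge_vars(1), of w] by (simp only: mult.commute)
    have "subst2 (y_var + emb g) (y_var * w) Z = W + subst2 (emb g) Y Z"
      using subst2_emb_cong[of g "y_var * w" Z Y] by (simp only: subst2_add subst2_y_var[OF yw YZ(2)] W)
    also have "\<dots> = Y" by (simp add: W_def)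
    finally show ?thesis
      unfolding shift_def subst2_trans[OF ord_ge_shift_var[OF g0] ord_ge_vars(2) yw YZ(2)]
        subst2_z_var[OF yw YZ(2)] by simp
  qed
  then show ?thesis using that[OF g0 w] unfolding Z_def by metis
qed

section \<open>The lowest and the leftmost vertex\<close>

text \<open>
  The measures are read off from two vertices: \<open>(ycorner, zmin)\<close> is the lowest one, and
  \<open>(ymin, ztop)\<close> is the leftmost one.
\<close>

definition zmin :: "'k::field fps fps \<Rightarrow> nat" where
  "zmin F = (LEAST b. \<exists>a. (a, b) \<in> upset F)"

definition ycorner :: "'k::field fps fps \<Rightarrow> nat" where
  "ycorner F = (LEAST a. (a, zmin F) \<in> upset F)"

definition ymin :: "'k::field fps fps \<Rightarrow> nat" where
  "ymin F = (LEAST a. \<exists>b. (a, b) \<in> upset F)"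

definition ztop :: "'k::field fps fps \<Rightarrow> nat" where
  "ztop F = (LEAST b. (ymin F, b) \<in> upset F)"

lemma mcoeff_in_upset: "mcoeff F a b \<noteq> 0 \<Longrightarrow> (a, b) \<in> upset F"
  by (auto simp: upset_def)

lemma zmin_le: "mcoeff F a b \<noteq> 0 \<Longrightarrow> zmin F \<le> b"
  unfolding zmin_def by (rule Least_le) (auto dest: mcoeff_in_upset)

lemma ymin_le: "mcoeff F a b \<noteq> 0 \<Longrightarrow> ymin F \<le> a"
  unfolding ymin_def by (rule Least_le) (auto dest: mcoeff_in_upset)

lemma ycorner_le: "mcoeff F a (zmin F) \<noteq> 0 \<Longrightarrow> ycorner F \<le> a"
  unfolding ycorner_def by (rule Least_le) (auto dest: mcoeff_in_upset)

lemma ztop_le: "mcoeff F (ymin F) b \<noteq> 0 \<Longrightarrow> ztop F \<le> b"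
  unfolding ztop_def by (rule Least_le) (auto dest: mcoeff_in_upset)

lemma mcoeff_corner:
  assumes "F \<noteq> 0"
  shows "mcoeff F (ycorner F) (zmin F) \<noteq> 0"
proof -
  obtain a b where "(a, b) \<in> upset F" using assms upset_eq_empty_iff[of F] by auto
  then have "\<exists>b a. (a, b) \<in> upset F" by blast
  then have "\<exists>a. (a, zmin F) \<in> upset F" unfolding zmin_def by (rule LeastI_ex)
  then have "(ycorner F, zmin F) \<in> upset F" unfolding ycorner_def by (rule LeastI_ex)
  then obtain i j where ij: "mcoeff F i j \<noteq> 0" "i \<le> ycorner F" "j \<le> zmin F" by (auto simp: upset_def)
  then have "j = zmin F" using zmin_le[OF ij(1)] by simp
  then show ?thesis using ij ycorner_le[of F i] by auto
qed

lemma mcoeff_top: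
  assumes "F \<noteq> 0"
  shows "mcoeff F (ymin F) (ztop F) \<noteq> 0"
proof -
  obtain a b where "(a, b) \<in> upset F" using assms upset_eq_empty_iff[of F] by auto
  then have "\<exists>a b. (a, b) \<in> upset F" by blast
  then have "\<exists>b. (ymin F, b) \<in> upset F" unfolding ymin_def by (rule LeastI_ex)
  then have "(ymin F, ztop F) \<in> upset F" unfolding ztop_def by (rule LeastI_ex)
  then obtain i j where ij: "mcoeff F i j \<noteq> 0" "i \<le> ymin F" "j \<le> ztop F" by (auto simp: upset_def)
  then have "i = ymin F" using ymin_le[OF ij(1)] by simp
  then show ?thesis using ij ztop_le[of F j] by auto
qed

lemma ymin_le_ycorner: "F \<noteq> 0 \<Longrightarrow> ymin F \<le> ycorner F"
  using mcoeff_corner ymin_le by blast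

lemma zmin_eqI:
  assumes "mcoeff F a b \<noteq> 0" "\<And>i j. mcoeff F i j \<noteq> 0 \<Longrightarrow> b \<le> j"
  shows "zmin F = b"
proof -
  have "F \<noteq> 0" using assms by auto
  then show ?thesis using assms zmin_le[OF assms(1)] mcoeff_corner by (metis le_antisym)
qed

lemma ymin_eqI:
  assumes "mcoeff F a b \<noteq> 0" "\<And>i j. mcoeff F i j \<noteq> 0 \<Longrightarrow> a \<le> i"
  shows "ymin F = a"
proof -
  have "F \<noteq> 0" using assms by auto
  then show ?thesis using assms ymin_le[OF assms(1)] mcoeff_top by (metis le_antisym)
qed

lemma ycorner_eqI:
  assumes "mcoeff F a b \<noteq> 0" "\<And>i j. mcoeff F i j \<noteq> 0 \<Longrightarrow> b \<le> j"
    "\<And>i. mcoeff F i b \<noteq> 0 \<Longrightarrow> a \<le> i"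
  shows "ycorner F = a"
proof -
  have "zmin F = b" using assms by (intro zmin_eqI)
  moreover have "F \<noteq> 0" using assms by auto
  ultimately show ?thesis using assms(1,3) ycorner_le mcoeff_corner by (metis le_antisym)
qed

lemma upset_measures_cong:
  assumes "upset F = upset G"
  shows "zmin F = zmin G" "ycorner F = ycorner G" "ymin F = ymin G" "ztop F = ztop G"
  by (simp_all add: zmin_def ycorner_def ymin_def ztop_def assms)

section \<open>Vertices of the Newton polygon\<close>

lemma newton_polygon_halfplane:
  assumes "0 \<le> r" "0 \<le> s" "\<And>i j. mcoeff F i j \<noteq> 0 \<Longrightarrow> c \<le> r * real i + s * real j"
    and "x \<in> newton_polygon F"
  shows "c \<le> r * fst x + s * snd x"
proof -
  have "convex {x. c \<le> r * fst x + s * snd x}"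
    using convex_halfspace_ge[of c "(r, s)"] by (simp add: inner_prod_def)
  moreover have "{(real \<alpha> + s, real \<beta> + t) | \<alpha> \<beta> s t. (\<alpha>, \<beta>) \<in> supp F \<and> 0 \<le> s \<and> 0 \<le> t}
      \<subseteq> {x. c \<le> r * fst x + s * snd x}"
  proof clarsimp
    fix i j and u v :: real assume "(i, j) \<in> supp F" and uv: "0 \<le> u" "0 \<le> v"
    then have "c \<le> r * real i + s * real j" using assms(3) by (simp add: supp_def)
    moreover have "0 \<le> r * u" "0 \<le> s * v" using uv assms by auto
    ultimately show "c \<le> r * (real i + u) + s * (real j + v)" by (simp add: distrib_left)
  qed
  ultimately have "newton_polygon F \<subseteq> {x. c \<le> r * fst x + s * snd x}"
    unfolding newton_polygon_def by (simp add: hull_minimal)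
  then show ?thesis using assms(4) by auto
qed

lemma newton_polygon_supp: "mcoeff F a b \<noteq> 0 \<Longrightarrow> (real a, real b) \<in> newton_polygon F"
  unfolding newton_polygon_def
  by (rule hull_inc) (force simp: supp_def)

lemma newton_polygon_upward:
  assumes "(x, y) \<in> newton_polygon F" "0 \<le> s" "0 \<le> t"
  shows "(x + s, y + t) \<in> newton_polygon F"
proof -
  define S where "S = {(real \<alpha> + s, real \<beta> + t) | \<alpha> \<beta> s t. (\<alpha>, \<beta>) \<in> supp F \<and> 0 \<le> s \<and> 0 \<le> t}"
  have "(\<lambda>p. (s, t) + p) ` S \<subseteq> S"
  proof
    fix q assume "q \<in> (\<lambda>p. (s, t) + p) ` S"
    then obtain i j u v where *: "q = (s, t) + (real i + u, real j + v)" "(i, j) \<in> supp F" "0 \<le> u" "0 \<le> v"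
      by (auto simp: S_def)
    then have "q = (real i + (s + u), real j + (t + v))" by (simp add: algebra_simps)
    then show "q \<in> S" unfolding S_def using * assms by (fastforce intro: add_nonneg_nonneg)
  qed
  then have "convex hull ((\<lambda>p. (s, t) + p) ` S) \<subseteq> convex hull S" by (rule hull_mono)
  moreover have "(s, t) + (x, y) \<in> (\<lambda>p. (s, t) + p) ` (convex hull S)"
    using assms(1) unfolding newton_polygon_def S_def by (rule imageI)
  ultimately show ?thesis
    unfolding convex_hull_translation by (auto simp: newton_polygon_def S_def add.commute)
qed

lemma convex_newton_polygon: "convex (newton_polygon F)"
  by (simp add: newton_polygon_def)

lemma not_extreme_midpoint:
  fixes x y :: "'a::euclidean_space"
  assumes "x \<in> S" "y \<in> S" "x \<noteq> y" "z = (1/2) *\<^sub>R (x + y)"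
  shows "\<not> z extreme_point_of S"
proof -
  have "z \<in> open_segment x y"
    unfolding in_segment using assms by (auto intro!: exI[of _ "1/2"] simp: scaleR_add_right)
  then show ?thesis using assms by (auto simp: extreme_point_of_def)
qed

text \<open>
  If \<open>q\<close> is to the left of and below \<open>p\<close>, then \<open>p\<close> is the midpoint of \<open>q\<close> and its reflection
  in \<open>p\<close>, which lies in the polygon because the polygon is closed upwards.
\<close>

lemma extreme_dominated:
  assumes p: "p extreme_point_of newton_polygon F" and q: "q \<in> newton_polygon F"
    and le: "fst q \<le> fst p" "snd q \<le> snd p"
  shows "p = q"
proof (rule ccontr)
  assume "p \<noteq> q"
  have pN: "p \<in> newton_polygon F" using p by (simp add: extreme_point_of_def)
  define r where "r = (fst p + (fst p - fst q), snd p + (snd p - snd q))"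
  have "r \<in> newton_polygon F"
    unfolding r_def using pN le by (intro newton_polygon_upward) auto
  moreover have "p = (1/2) *\<^sub>R (q + r)" by (simp add: r_def prod_eq_iff)
  moreover have "q \<noteq> r" using \<open>p \<noteq> q\<close> by (auto simp: r_def prod_eq_iff)
  ultimately show False using p q not_extreme_midpoint by blast
qed

lemma vertex_in_supp:
  assumes "p extreme_point_of newton_polygon F"
  obtains a b where "p = (real a, real b)" "mcoeff F a b \<noteq> 0"
proof -
  have "p \<in> {(real \<alpha> + s, real \<beta> + t) | \<alpha> \<beta> s t. (\<alpha>, \<beta>) \<in> supp F \<and> 0 \<le> s \<and> 0 \<le> t}"
    using assms unfolding newton_polygon_def by (rule extreme_point_of_convex_hull)
  then obtain i j s t where *: "p = (real i + s, real j + t)" "mcoeff F i j \<noteq> 0" "0 \<le> s" "0 \<le> t"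
    by (auto simp: supp_def)
  then have "p = (real i, real j)"
    using extreme_dominated[OF assms newton_polygon_supp[of F i j]] by simp
  then show ?thesis using that * by blast
qed

lemma vertices_supp: "(a, b) \<in> vertices F \<Longrightarrow> mcoeff F a b \<noteq> 0"
  unfolding vertices_def by (auto elim: vertex_in_supp)

lemma vertices_dominated:
  assumes "(a, b) \<in> vertices F" "mcoeff F i j \<noteq> 0" "i \<le> a" "j \<le> b"
  shows "i = a \<and> j = b"
  using extreme_dominated[of "(real a, real b)" F "(real i, real j)"] newton_polygon_supp[OF assms(2)] assms
  by (auto simp: vertices_def)

text \<open>
  The open half-plane above the supporting line, together with the one point of the support on this
  line, is convex and contains the polygon.
\<close>

lemma verticesI:
  assumes "0 < r" "0 < s" and ab: "mcoeff F a b \<noteq> 0"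
    and min: "\<And>i j. mcoeff F i j \<noteq> 0 \<Longrightarrow> (i, j) \<noteq> (a, b) \<Longrightarrow> r * real a + s * real b < r * real i + s * real j"
  shows "(a, b) \<in> vertices F"
proof -
  define f where "f x = r * fst x + s * snd x" for x :: "real \<times> real"
  define q where "q = (real a, real b)"
  have f_lin: "f (u *\<^sub>R x + v *\<^sub>R y) = u * f x + v * f y" for u v x y
    by (simp add: f_def algebra_simps)
  define C where "C = {x. f q \<le> f x \<and> (f x = f q \<longrightarrow> x = q)}"
  have "convex C"
    unfolding convex_alt
  proof safe
    fix x y and u :: real assume x: "x \<in> C" and y: "y \<in> C" and u: "0 \<le> u" "u \<le> 1"
    have ge: "f q \<le> f x" "f q \<le> f y" using x y by (simp_all add: C_def)
    have eq: "f ((1 - u) *\<^sub>R x + u *\<^sub>R y) - f q = (1 - u) * (f x - f q) + u * (f y - f q)"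
      unfolding f_lin by (simp add: algebra_simps)
    have nn: "0 \<le> (1 - u) * (f x - f q)" "0 \<le> u * (f y - f q)" using ge u by simp_all
    have "(1 - u) *\<^sub>R x + u *\<^sub>R y = q" if "f ((1 - u) *\<^sub>R x + u *\<^sub>R y) = f q"
    proof -
      have "(1 - u) * (f x - f q) = 0" "u * (f y - f q) = 0" using eq nn that by linarith+
      then have "u = 1 \<or> x = q" "u = 0 \<or> y = q" using x y by (auto simp: C_def)
      then show ?thesis using u by (auto simp: algebra_simps simp flip: scaleR_add_left)
    qed
    then show "(1 - u) *\<^sub>R x + u *\<^sub>R y \<in> C" using eq nn unfolding C_def by auto
  qed
  moreover have "{(real \<alpha> + s, real \<beta> + t) | \<alpha> \<beta> s t. (\<alpha>, \<beta>) \<in> supp F \<and> 0 \<le> s \<and> 0 \<le> t} \<subseteq> C"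
  proof
    fix x assume "x \<in> {(real \<alpha> + s, real \<beta> + t) | \<alpha> \<beta> s t. (\<alpha>, \<beta>) \<in> supp F \<and> 0 \<le> s \<and> 0 \<le> t}"
    then obtain i j u v where *: "x = (real i + u, real j + v)" "mcoeff F i j \<noteq> 0" "0 \<le> u" "0 \<le> v"
      by (auto simp: supp_def)
    have fx: "f x = r * real i + s * real j + r * u + s * v" by (simp add: * f_def algebra_simps)
    have uv: "0 \<le> r * u" "0 \<le> s * v" using * assms by auto
    show "x \<in> C"
    proof (cases "(i, j) = (a, b)")
      case True
      then have "f x = f q + r * u + s * v" by (simp add: fx) (simp add: f_def q_def)
      moreover have "r * u = 0 \<and> s * v = 0 \<Longrightarrow> x = q" using * True assms by (simp add: q_def)
      moreover have "r * u = 0 \<and> s * v = 0" if "r * u + s * v = 0" using uv that by linarith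
      ultimately show ?thesis using uv by (auto simp: C_def simp del: mult_eq_0_iff)
    next
      case False
      then have "f q < f x" using min[OF *(2)] uv fx by (simp add: f_def q_def)
      then show ?thesis by (simp add: C_def)
    qed
  qed
  ultimately have NC: "newton_polygon F \<subseteq> C" unfolding newton_polygon_def by (simp add: hull_minimal)
  have "q extreme_point_of newton_polygon F"
    unfolding extreme_point_of_def
  proof (intro conjI ballI notI)
    show "q \<in> newton_polygon F" using newton_polygon_supp[OF ab] by (simp add: q_def)
    fix x y assume x: "x \<in> newton_polygon F" and y: "y \<in> newton_polygon F" and "q \<in> open_segment x y"
    then obtain u where xy: "x \<noteq> y" and u: "0 < u" "u < 1" "q = (1 - u) *\<^sub>R x + u *\<^sub>R y"
      by (auto simp: in_segment)
    have ge: "f q \<le> f x" "f q \<le> f y" using x y NC by (auto simp: C_def)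
    have "f q = (1 - u) * f x + u * f y" using u(3) f_lin by simp
    then have "(1 - u) * (f x - f q) + u * (f y - f q) = 0" by (simp add: algebra_simps)
    moreover have "0 \<le> (1 - u) * (f x - f q)" "0 \<le> u * (f y - f q)" using ge u by simp_all
    ultimately have "(1 - u) * (f x - f q) = 0" "u * (f y - f q) = 0" by linarith+
    then have "f x = f q" "f y = f q" using u by auto
    then have "x = q" "y = q" using x y NC by (auto simp: C_def)
    then show False using xy by simp
  qed
  then show ?thesis by (simp add: vertices_def q_def)
qed

lemma corner_vertex:
  assumes "F \<noteq> 0"
  shows "(ycorner F, zmin F) \<in> vertices F"
\<comment> \<open>The first weight is so small that rows are compared first.\<close>
proof (rule verticesI[of "1 / (real (ycorner F) + 1)" 1])
  fix i j assume ij: "mcoeff F i j \<noteq> 0" "(i, j) \<noteq> (ycorner F, zmin F)"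
  show "1 / (real (ycorner F) + 1) * real (ycorner F) + 1 * real (zmin F)
      < 1 / (real (ycorner F) + 1) * real i + 1 * real j"
  proof (cases "j = zmin F")
    case True
    then have "ycorner F < i" using ycorner_le[of F i] ij by auto
    then show ?thesis using True by (simp add: divide_strict_right_mono)
  next
    case False
    then have "zmin F + 1 \<le> j" using zmin_le[OF ij(1)] by simp
    then have "real (zmin F) + 1 \<le> real j" by linarith
    moreover have "real (ycorner F) / (real (ycorner F) + 1) < 1" by simp
    moreover have "0 \<le> real i / (real (ycorner F) + 1)" by simp
    ultimately show ?thesis unfolding times_divide_eq_left mult_1 by linarith
  qed
qed (use mcoeff_corner[OF assms] in auto)

lemma top_vertex:
  assumes "F \<noteq> 0"
  shows "(ymin F, ztop F) \<in> vertices F"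
proof (rule verticesI[of 1 "1 / (real (ztop F) + 1)"])
  fix i j assume ij: "mcoeff F i j \<noteq> 0" "(i, j) \<noteq> (ymin F, ztop F)"
  show "1 * real (ymin F) + 1 / (real (ztop F) + 1) * real (ztop F)
      < 1 * real i + 1 / (real (ztop F) + 1) * real j"
  proof (cases "i = ymin F")
    case True
    then have "ztop F < j" using ztop_le[of F j] ij by auto
    then show ?thesis using True by (simp add: divide_strict_right_mono)
  next
    case False
    then have "ymin F + 1 \<le> i" using ymin_le[OF ij(1)] by simp
    then have "real (ymin F) + 1 \<le> real i" by linarith
    moreover have "real (ztop F) / (real (ztop F) + 1) < 1" by simp
    moreover have "0 \<le> real j / (real (ztop F) + 1)" by simp
    ultimately show ?thesis unfolding times_divide_eq_left mult_1 by linarith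
  qed
qed (use mcoeff_top[OF assms] in auto)

lemma vertices_bounds:
  assumes "F \<noteq> 0" "(a, b) \<in> vertices F"
  shows "ymin F \<le> a" "a \<le> ycorner F" "zmin F \<le> b" "b \<le> ztop F"
proof -
  note supp = vertices_supp[OF assms(2)]
  show "ymin F \<le> a" "zmin F \<le> b" using supp by (simp_all add: ymin_le zmin_le)
  show "a \<le> ycorner F"
    using vertices_dominated[OF assms(2) mcoeff_corner[OF assms(1)]] \<open>zmin F \<le> b\<close> by (cases "a \<le> ycorner F") auto
  show "b \<le> ztop F"
    using vertices_dominated[OF assms(2) mcoeff_top[OF assms(1)]] \<open>ymin F \<le> a\<close> by (cases "b \<le> ztop F") auto
qed

lemma finite_vertices:
  assumes "F \<noteq> 0"
  shows "finite (vertices F)"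
proof (rule finite_subset)
  show "vertices F \<subseteq> {..ycorner F} \<times> {..ztop F}" using vertices_bounds[OF assms] by auto
qed auto

lemma measures_eq:
  assumes "F \<noteq> 0"
  shows "ord_y F = ymin F" "deg_y F = ycorner F" "ord_z F = zmin F" "deg_z F = ztop F"
proof -
  note fin = finite_vertices[OF assms] and c = corner_vertex[OF assms] and t = top_vertex[OF assms]
  show "ord_y F = ymin F" unfolding ord_y_def
    using fin t vertices_bounds[OF assms] by (intro Min_eqI) (auto intro: image_eqI[OF _ t])
  show "deg_y F = ycorner F" unfolding deg_y_def
    using fin c vertices_bounds[OF assms] by (intro Max_eqI) (auto intro: image_eqI[OF _ c])
  show "ord_z F = zmin F" unfolding ord_z_def
    using fin c vertices_bounds[OF assms] by (intro Min_eqI) (auto intro: image_eqI[OF _ c])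
  show "deg_z F = ztop F" unfolding deg_z_def
    using fin t vertices_bounds[OF assms] by (intro Max_eqI) (auto intro: image_eqI[OF _ t])
qed

lemma height_eq: "F \<noteq> 0 \<Longrightarrow> height F = ycorner F - ymin F"
  by (simp add: height_def measures_eq)

lemma is_quadrant_iff:
  assumes F: "F \<noteq> 0"
  shows "is_quadrant (newton_polygon F) \<longleftrightarrow> ymin F = ycorner F"
proof
  assume "is_quadrant (newton_polygon F)"
  then obtain x0 y0 where N: "newton_polygon F = {x0..} \<times> {y0..}" by (auto simp: is_quadrant_def)
  have *: "(real a, real b) = (x0, y0)" if ab: "(a, b) \<in> vertices F" for a b
  proof -
    have e: "(real a, real b) extreme_point_of newton_polygon F" using ab by (simp add: vertices_def)
    then have "(real a, real b) \<in> {x0..} \<times> {y0..}" unfolding N[symmetric] by (simp add: extreme_point_of_def)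
    then show ?thesis using extreme_dominated[OF e, of "(x0, y0)"] unfolding N by auto
  qed
  show "ymin F = ycorner F" using *[OF corner_vertex[OF F]] *[OF top_vertex[OF F]] by simp
next
  assume eq: "ymin F = ycorner F"
  have "newton_polygon F = {real (ycorner F)..} \<times> {real (zmin F)..}"
  proof (intro equalityI subsetI)
    fix x assume x: "x \<in> newton_polygon F"
    have "real (ycorner F) \<le> 1 * fst x + 0 * snd x"
      by (rule newton_polygon_halfplane[OF _ _ _ x]) (auto simp: eq[symmetric] ymin_le)
    moreover have "real (zmin F) \<le> 0 * fst x + 1 * snd x"
      by (rule newton_polygon_halfplane[OF _ _ _ x]) (auto simp: zmin_le)
    ultimately show "x \<in> {real (ycorner F)..} \<times> {real (zmin F)..}" by (cases x) auto
  next
    fix x assume "x \<in> {real (ycorner F)..} \<times> {real (zmin F)..}"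
    then show "x \<in> newton_polygon F"
      using newton_polygon_upward[OF newton_polygon_supp[OF mcoeff_corner[OF F]],
          of "fst x - real (ycorner F)" "snd x - real (zmin F)"] by (cases x) auto
  qed
  then show "is_quadrant (newton_polygon F)" by (auto simp: is_quadrant_def)
qed

text \<open>
  The edge that leaves the lowest vertex consists of the terms minimizing this ratio, and the
  slope is the \<open>y\<close>-exponent of this vertex times the minimum.
\<close>

definition edge_ratio :: "'k::field fps fps \<Rightarrow> nat \<Rightarrow> nat \<Rightarrow> real" where
  "edge_ratio F a b = (real b - real (zmin F)) / (real (ycorner F) - real a)"

text \<open>
  Among the terms of minimal ratio the one with the smallest \<open>y\<close>-exponent is the other end of
  the edge at the lowest vertex. To see that it is a vertex, tilt the linear functional that is
  constant on the edge slightly in its favour. No vertex has a \<open>y\<close>-exponent strictly between the two,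
  because every point of the polygon above the edge is dominated by a point of the edge.
\<close>

lemma slope_eqI:
  assumes ab: "mcoeff F a b \<noteq> 0" "a < ycorner F"
    and min: "\<And>i j. mcoeff F i j \<noteq> 0 \<Longrightarrow> i < ycorner F \<Longrightarrow> edge_ratio F a b \<le> edge_ratio F i j"
  shows "slope F = ereal (real (ycorner F) * edge_ratio F a b)"
proof -
  define D d \<rho> where "D = ycorner F" and "d = zmin F" and "\<rho> = edge_ratio F a b"
  define P where "P i \<longleftrightarrow> (\<exists>j. mcoeff F i j \<noteq> 0 \<and> i < D \<and> edge_ratio F i j = \<rho>)" for i
  define \<alpha> where "\<alpha> = (LEAST i. P i)"
  have F: "F \<noteq> 0" using ab by auto
  have "P a" using ab by (auto simp: P_def D_def \<rho>_def)
  then have "P \<alpha>" unfolding \<alpha>_def by (rule LeastI)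
  then obtain \<beta> where \<beta>: "mcoeff F \<alpha> \<beta> \<noteq> 0" "\<alpha> < D" "edge_ratio F \<alpha> \<beta> = \<rho>" by (auto simp: P_def)
  have \<alpha>_least: "\<alpha> \<le> i" if "P i" for i unfolding \<alpha>_def using that by (rule Least_le)
  have q: "real D - real \<alpha> > 0" using \<beta> by simp
  have \<beta>_line: "real \<beta> - real d = \<rho> * (real D - real \<alpha>)"
    using \<beta>(3) q by (auto simp: edge_ratio_def D_def d_def field_simps)
  have line: "\<rho> * (real D - real i) \<le> real j - real d" if "mcoeff F i j \<noteq> 0" for i j
  proof (cases "i < D")
    case True
    then have "\<rho> \<le> (real j - real d) / (real D - real i)"
      using min[OF that] by (simp add: \<rho>_def edge_ratio_def D_def d_def)
    then show ?thesis using True by (simp add: field_simps)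
  next
    case False
    have "0 \<le> \<rho>" using ab zmin_le[OF ab(1)] by (simp add: \<rho>_def edge_ratio_def)
    then have "\<rho> * (real D - real i) \<le> 0" using False by (simp add: mult_nonneg_nonpos)
    then show ?thesis using zmin_le[OF that] by (simp add: d_def)
  qed
  define q\<^sub>0 where "q\<^sub>0 = real D - real \<alpha>"
  have q\<^sub>0: "q\<^sub>0 > 0" using q by (simp add: q\<^sub>0_def)
  \<comment> \<open>The functional takes values in the multiples of \<open>1 / q\<^sub>0\<close>, up to a constant, so terms
  off the edge lie above it by at least this amount. The tilt costs less.\<close>
  define \<eta> where "\<eta> = 1 / ((real \<alpha> + 1) * q\<^sub>0)"
  have \<rho>0: "0 \<le> \<rho>" using ab zmin_le[OF ab(1)] by (simp add: \<rho>_def edge_ratio_def)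
  have \<eta>: "\<eta> > 0" using q\<^sub>0 by (simp add: \<eta>_def)
  have "(\<alpha>, \<beta>) \<in> vertices F"
  proof (rule verticesI[of "\<rho> + \<eta>" 1])
    fix i j assume ij: "mcoeff F i j \<noteq> 0" "(i, j) \<noteq> (\<alpha>, \<beta>)"
    have ge: "\<rho> * real \<alpha> + real \<beta> \<le> \<rho> * real i + real j"
      using line[OF ij(1)] \<beta>_line by (simp add: algebra_simps)
    consider "\<alpha> < i" | "i = \<alpha>" | "i < \<alpha>" by linarith
    then show "(\<rho> + \<eta>) * real \<alpha> + 1 * real \<beta> < (\<rho> + \<eta>) * real i + 1 * real j"
    proof cases
      case 1
      then have "\<eta> * real \<alpha> < \<eta> * real i" using \<eta> by simp
      then show ?thesis using ge by (simp add: algebra_simps)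
    next
      case 2
      then show ?thesis using ge ij(2) by (simp add: algebra_simps)
    next
      case 3
      then have "\<not> P i" using \<alpha>_least[of i] by auto
      then have "edge_ratio F i j \<noteq> \<rho>" using ij(1) 3 \<beta>(2) by (auto simp: P_def)
      then have ne: "real j - real d \<noteq> \<rho> * (real D - real i)"
        using 3 \<beta>(2) by (auto simp: edge_ratio_def D_def d_def field_simps)
      have \<rho>_eq: "\<rho> * q\<^sub>0 = real \<beta> - real d" using \<beta>_line by (simp add: q\<^sub>0_def)
      have "q\<^sub>0 * ((real j - real d) - \<rho> * (real D - real i)) =
          q\<^sub>0 * (real j - real d) - (\<rho> * q\<^sub>0) * (real D - real i)"
        by (simp add: algebra_simps)
      also have "\<dots> = of_int ((int D - int \<alpha>) * (int j - int d) - (int \<beta> - int d) * (int D - int i))"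
        unfolding \<rho>_eq by (simp add: q\<^sub>0_def)
      finally have "q\<^sub>0 * ((real j - real d) - \<rho> * (real D - real i)) =
          of_int ((int D - int \<alpha>) * (int j - int d) - (int \<beta> - int d) * (int D - int i))" .
      moreover have "q\<^sub>0 * ((real j - real d) - \<rho> * (real D - real i)) > 0"
        using ne line[OF ij(1)] q\<^sub>0 by simp
      ultimately have "1 \<le> q\<^sub>0 * ((real j - real d) - \<rho> * (real D - real i))"
        by (metis of_int_0_less_iff int_one_le_iff_zero_less of_int_1_le_iff)
      then have "1 / q\<^sub>0 \<le> (real j - real d) - \<rho> * (real D - real i)" using q\<^sub>0 by (simp add: field_simps)
      then have gap: "\<rho> * real \<alpha> + real \<beta> + 1 / q\<^sub>0 \<le> \<rho> * real i + real j"
        using \<beta>_line by (simp add: algebra_simps)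
      have "\<eta> * real \<alpha> = (real \<alpha> / (real \<alpha> + 1)) * (1 / q\<^sub>0)" by (simp add: \<eta>_def)
      also have "\<dots> < 1 * (1 / q\<^sub>0)" using q\<^sub>0 by (intro mult_strict_right_mono) auto
      finally have "\<eta> * real \<alpha> < 1 / q\<^sub>0" by simp
      moreover have "0 \<le> \<eta> * real i" using \<eta> by simp
      ultimately show ?thesis using gap by (simp add: algebra_simps)
    qed
  qed (use \<beta> \<rho>0 \<eta> in auto)
  have no_between: "i \<le> \<alpha>" if v: "(i, j) \<in> vertices F" "i \<noteq> D" for i j
  proof (rule ccontr)
    assume "\<not> i \<le> \<alpha>"
    then have i: "\<alpha> < i" "i < D" using vertices_bounds(2)[OF F v(1)] v(2) by (auto simp: D_def)
    define u where "u = (real D - real i) / q\<^sub>0"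
    have u: "0 < u" "u < 1" using i by (auto simp: u_def q\<^sub>0_def)
    have uq: "u * (real D - real \<alpha>) = real D - real i" using q\<^sub>0 by (simp add: u_def q\<^sub>0_def)
    define w where "w = (1 - u) *\<^sub>R (real D, real d) + u *\<^sub>R (real \<alpha>, real \<beta>)"
    have DN: "(real D, real d) \<in> newton_polygon F" "(real \<alpha>, real \<beta>) \<in> newton_polygon F"
      using newton_polygon_supp mcoeff_corner[OF F] \<beta>(1) by (auto simp: D_def d_def)
    have "w \<in> newton_polygon F"
      unfolding w_def using u by (intro convexD_alt[OF convex_newton_polygon DN]) auto
    moreover have fstw: "fst w = real i" using uq by (simp add: w_def algebra_simps)
    moreover have "snd w = real d + \<rho> * (real D - real i)"
    proof -
      have "snd w = real d + u * (real \<beta> - real d)" by (simp add: w_def algebra_simps)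
      also have "u * (real \<beta> - real d) = \<rho> * (u * (real D - real \<alpha>))" by (simp add: \<beta>_line)
      finally show ?thesis by (simp add: uq)
    qed
    moreover have "real d + \<rho> * (real D - real i) \<le> real j"
      using line[OF vertices_supp[OF v(1)]] by simp
    moreover have ext: "(real i, real j) extreme_point_of newton_polygon F"
      using v(1) by (simp add: vertices_def)
    ultimately have "(real i, real j) = w" using extreme_dominated[OF ext, of w] by simp
    moreover have "w \<in> open_segment (real D, real d) (real \<alpha>, real \<beta>)"
      unfolding in_segment w_def using u \<beta>(2) by auto
    ultimately show False using ext DN by (auto simp: extreme_point_of_def)
  qed
  note fin = finite_vertices[OF F] and c = corner_vertex[OF F]
  have uniq: "(THE \<beta>'. (\<alpha>', \<beta>') \<in> vertices F) = \<beta>'" if "(\<alpha>', \<beta>') \<in> vertices F" for \<alpha>' \<beta>'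
  proof (rule the_equality)
    show "(\<alpha>', \<beta>') \<in> vertices F" by (rule that)
    fix b assume b: "(\<alpha>', b) \<in> vertices F"
    show "b = \<beta>'"
      using vertices_dominated[OF b vertices_supp[OF that]] vertices_dominated[OF that vertices_supp[OF b]]
      by (cases "b \<le> \<beta>'") auto
  qed
  have "Max (fst ` vertices F) = D" using measures_eq(2)[OF F] by (simp add: deg_y_def D_def)
  moreover have "Max (fst ` vertices F - {D}) = \<alpha>"
    using fin no_between \<open>(\<alpha>, \<beta>) \<in> vertices F\<close> \<beta>(2)
    by (intro Max_eqI) (auto intro: image_eqI[of \<alpha> fst "(\<alpha>, \<beta>)"])
  moreover have "\<not> is_quadrant (newton_polygon F)"
    using is_quadrant_iff[OF F] ymin_le[OF ab(1)] ab(2) by simp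
  ultimately have "slope F = ereal (real D / (real D - real \<alpha>) * (real \<beta> - real d))"
    unfolding slope_def Let_def using uniq[OF \<open>(\<alpha>, \<beta>) \<in> vertices F\<close>] uniq[OF c]
    by (simp add: D_def d_def)
  also have "real D / (real D - real \<alpha>) * (real \<beta> - real d) = real D * \<rho>"
    using q by (simp add: \<beta>_line)
  finally show ?thesis by (simp add: D_def \<rho>_def)
qed

lemma edge_exists:
  assumes F: "F \<noteq> 0" and "ymin F < ycorner F"
  obtains a b where "mcoeff F a b \<noteq> 0" "a < ycorner F"
    "\<And>i j. mcoeff F i j \<noteq> 0 \<Longrightarrow> i < ycorner F \<Longrightarrow> edge_ratio F a b \<le> edge_ratio F i j"
proof -
  define A where "A = {a. a < ycorner F \<and> (\<exists>b. mcoeff F a b \<noteq> 0)}"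
  define m where "m a = (LEAST b. mcoeff F a b \<noteq> 0)" for a
  have "ymin F \<in> A" using mcoeff_top[OF F] assms by (auto simp: A_def)
  moreover have "finite A" by (rule finite_subset[of _ "{..<ycorner F}"]) (auto simp: A_def)
  ultimately obtain a where a: "a \<in> A" "\<And>i. i \<in> A \<Longrightarrow> edge_ratio F a (m a) \<le> edge_ratio F i (m i)"
    using ex_min_if_finite[of "(\<lambda>i. edge_ratio F i (m i)) ` A"] by (fastforce simp: not_less)
  have m: "mcoeff F i (m i) \<noteq> 0" if "i \<in> A" for i
    unfolding m_def by (rule LeastI_ex) (use that in \<open>auto simp: A_def\<close>)
  show ?thesis
  proof
    show "mcoeff F a (m a) \<noteq> 0" "a < ycorner F" using a m by (auto simp: A_def)
    fix i j assume ij: "mcoeff F i j \<noteq> 0" "i < ycorner F"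
    then have "i \<in> A" by (auto simp: A_def)
    then have "edge_ratio F a (m a) \<le> edge_ratio F i (m i)" by (rule a)
    also have "m i \<le> j" unfolding m_def using ij(1) by (rule Least_le)
    then have "edge_ratio F i (m i) \<le> edge_ratio F i j"
      unfolding edge_ratio_def using ij(2) by (intro divide_right_mono) auto
    finally show "edge_ratio F a (m a) \<le> edge_ratio F i j" .
  qed
qed

lemma monomial_series_iff:
  assumes F: "F \<noteq> 0"
  shows "monomial_series F \<longleftrightarrow> ymin F = ycorner F"
proof
  assume "monomial_series F"
  then obtain a b u where u: "u dvd 1" and Fu: "F = y_var ^ a * z_var ^ b * u"
    by (auto simp: monomial_series_def)
  have coeff: "mcoeff F i j = (if a \<le> i \<and> b \<le> j then mcoeff u (i - a) (j - b) else 0)" for i j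
    unfolding Fu mult.assoc mcoeff_y_power_mult mcoeff_z_power_mult by simp
  have "mcoeff F a b \<noteq> 0" using u by (simp add: coeff unit_iff)
  then have "ymin F = a" "ycorner F = a"
    by (rule ymin_eqI, simp add: coeff split: if_splits)
      (rule ycorner_eqI[OF \<open>mcoeff F a b \<noteq> 0\<close>], auto simp: coeff split: if_splits)
  then show "ymin F = ycorner F" by simp
next
  assume eq: "ymin F = ycorner F"
  define u where "u = Abs_fps (\<lambda>j. Abs_fps (\<lambda>i. mcoeff F (i + ycorner F) (j + zmin F)))"
  have u: "mcoeff u i j = mcoeff F (i + ycorner F) (j + zmin F)" for i j
    by (simp add: u_def mcoeff_def)
  have "F = y_var ^ ycorner F * z_var ^ zmin F * u"
  proof (rule mcoeff_eqI)
    fix i j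
    show "mcoeff F i j = mcoeff (y_var ^ ycorner F * z_var ^ zmin F * u) i j"
      unfolding mult.assoc mcoeff_y_power_mult mcoeff_z_power_mult u
      using ymin_le[of F i j] zmin_le[of F i j] by (auto simp: eq)
  qed
  moreover have "u dvd 1" using mcoeff_corner[OF F] by (simp add: unit_iff u)
  ultimately show "monomial_series F" unfolding monomial_series_def by blast
qed

section \<open>Translations of y\<close>

lemma mcoeff_shift_monomial:
  fixes g :: "'k::field fps"
  shows "mcoeff ((y_var + emb g) ^ i * z_var ^ j) a b =
    (if a \<le> i \<and> j \<le> b then of_nat (i choose a) * fps_nth (g ^ (i - a)) (b - j) else 0)"
proof -
  have emb_power: "emb g ^ n = emb (g ^ n)" for n
  proof (induction n)
    case 0
    show ?case by (rule mcoeff_eqI) (simp add: mcoeff_emb mcoeff_1)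
  next
    case (Suc n)
    have "emb g * emb (g ^ n) = emb (g * g ^ n)"
    proof (rule mcoeff_eqI)
      fix a b
      have "mcoeff (emb g * emb (g ^ n)) a b =
          (\<Sum>j\<le>b. \<Sum>i\<le>a. if i = 0 then (if a = 0 then fps_nth g j * fps_nth (g ^ n) (b - j) else 0) else 0)"
        unfolding mcoeff_mult by (intro sum.cong) (auto simp: mcoeff_emb)
      also have "\<dots> = mcoeff (emb (g * g ^ n)) a b"
        by (simp add: mcoeff_emb fps_mult_nth atLeast0AtMost)
      finally show "mcoeff (emb g * emb (g ^ n)) a b = mcoeff (emb (g * g ^ n)) a b" .
    qed
    then show ?case by (simp add: Suc)
  qed
  have coeff: "mcoeff (of_nat c * y_var ^ k * emb f) a b = (if a = k then of_nat c * fps_nth f b else 0)"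
    for c k a b and f :: "'k fps"
  proof -
    have "of_nat c * y_var ^ k * emb f = scalar (of_nat c) * (y_var ^ k * emb f)"
      by (simp add: fps_of_nat mult.assoc)
    then show ?thesis by (simp only: mcoeff_scalar_mult mcoeff_y_power_mult) (auto simp: mcoeff_emb)
  qed
  have "mcoeff ((y_var + emb g) ^ i) a b = (if a \<le> i then of_nat (i choose a) * fps_nth (g ^ (i - a)) b else 0)" for a b
    unfolding binomial_ring mcoeff_sum emb_power coeff by (simp add: sum.delta)
  then show ?thesis
    by (auto simp: mult.commute[of _ "z_var ^ j"] mcoeff_z_power_mult)
qed

lemma mcoeff_shift:
  "mcoeff (shift g G) a b = (\<Sum>(i, j)\<in>{(i, j). i + j \<le> a + b}. mcoeff G i j *
     (if a \<le> i \<and> j \<le> b then of_nat (i choose a) * fps_nth (g ^ (i - a)) (b - j) else 0))"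
  unfolding shift_def mcoeff_subst2 mcoeff_shift_monomial ..

lemma fps_power_nth_eq_0:
  fixes g :: "'k::field fps"
  assumes "\<And>k. k < m \<Longrightarrow> fps_nth g k = 0" "n < m * l"
  shows "fps_nth (g ^ l) n = 0"
proof -
  have "g = fps_X ^ m * fps_shift m g"
    by (rule fps_ext) (simp add: fps_X_power_mult_nth assms(1))
  then have "g ^ l = (fps_X ^ m * fps_shift m g) ^ l" by simp
  also have "\<dots> = fps_X ^ (m * l) * fps_shift m g ^ l" by (simp add: power_mult_distrib power_mult)
  finally have "g ^ l = fps_X ^ (m * l) * fps_shift m g ^ l" .
  then show ?thesis using assms(2) by (simp add: fps_X_power_mult_nth)
qed

text \<open>
  A translation by a series of order at least \<open>m\<close> turns \<open>y\<^sup>i z\<^sup>j\<close> into terms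
  \<open>y\<^sup>a z\<^sup>b\<close> with \<open>b \<ge> j + m (i - a)\<close>. Here no term of \<open>G\<close> contributes to the given exponent; in
  \<open>mcoeff_shift_single\<close> exactly one does.
\<close>

lemma mcoeff_shift_eq_0:
  assumes g: "\<And>k. k < m \<Longrightarrow> fps_nth g k = 0"
    and z: "\<And>i j. mcoeff G i j \<noteq> 0 \<Longrightarrow> a \<le> i \<Longrightarrow> j \<le> b \<Longrightarrow> b < j + m * (i - a)"
  shows "mcoeff (shift g G) a b = 0"
  unfolding mcoeff_shift
proof (intro sum.neutral ballI, clarify)
  fix i j
  show "mcoeff G i j * (if a \<le> i \<and> j \<le> b then of_nat (i choose a) * fps_nth (g ^ (i - a)) (b - j) else 0) = 0"
  proof (cases "mcoeff G i j \<noteq> 0 \<and> a \<le> i \<and> j \<le> b")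
    case True
    then have "b - j < m * (i - a)" using z[of i j] by auto
    then show ?thesis using fps_power_nth_eq_0[of m g, OF g] by simp
  qed auto
qed

lemma mcoeff_shift_single:
  assumes g: "\<And>k. k < m \<Longrightarrow> fps_nth g k = 0"
    and z: "\<And>i j. mcoeff G i j \<noteq> 0 \<Longrightarrow> (i, j) \<noteq> (i\<^sub>0, j\<^sub>0) \<Longrightarrow> a \<le> i \<Longrightarrow> j \<le> b \<Longrightarrow> b < j + m * (i - a)"
    and ij: "a \<le> i\<^sub>0" "j\<^sub>0 \<le> b" "i\<^sub>0 + j\<^sub>0 \<le> a + b"
  shows "mcoeff (shift g G) a b =
    mcoeff G i\<^sub>0 j\<^sub>0 * (of_nat (i\<^sub>0 choose a) * fps_nth (g ^ (i\<^sub>0 - a)) (b - j\<^sub>0))"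
proof -
  have "mcoeff (shift g G) a b = (\<Sum>x\<in>{(i, j). i + j \<le> a + b}. if x = (i\<^sub>0, j\<^sub>0) then
      mcoeff G i\<^sub>0 j\<^sub>0 * (of_nat (i\<^sub>0 choose a) * fps_nth (g ^ (i\<^sub>0 - a)) (b - j\<^sub>0)) else 0)"
    unfolding mcoeff_shift
  proof (rule sum.cong, simp, clarify)
    fix i j
    show "mcoeff G i j * (if a \<le> i \<and> j \<le> b then of_nat (i choose a) * fps_nth (g ^ (i - a)) (b - j) else 0) =
      (if (i, j) = (i\<^sub>0, j\<^sub>0) then mcoeff G i\<^sub>0 j\<^sub>0 * (of_nat (i\<^sub>0 choose a) * fps_nth (g ^ (i\<^sub>0 - a)) (b - j\<^sub>0)) else 0)"
    proof (cases "(i, j) = (i\<^sub>0, j\<^sub>0)")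
      case ne: False
      show ?thesis
      proof (cases "mcoeff G i j \<noteq> 0 \<and> a \<le> i \<and> j \<le> b")
        case True
        then have "b - j < m * (i - a)" using z[OF _ ne] by auto
        then have "fps_nth (g ^ (i - a)) (b - j) = 0" using fps_power_nth_eq_0[of m g, OF g] by simp
        then show ?thesis unfolding if_not_P[OF ne] by simp
      qed (use ne in auto)
    qed (use ij in auto)
  qed
  then show ?thesis using ij by (simp add: finite_triangle)
qed

context char_p begin

lemma red_shift: "fps_nth g 0 = 0 \<Longrightarrow> red (shift g G) = red (shift g (red G))"
  unfolding shift_def by (intro red_subst2 ord_ge_shift_var) auto

lemma red_shift_eq_0_iff:
  assumes "fps_nth g 0 = 0"
  shows "red (shift g G) = 0 \<longleftrightarrow> red G = 0"
proof -
  have *: "red (shift g G) = 0" if "red G = 0" "fps_nth g 0 = 0" for g G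
  proof -
    from that obtain H where "G = H ^ p" using red_eq_0_imp_power_p by metis
    then show ?thesis using ord_ge_shift_var[OF that(2)] by (simp add: shift_def subst2_power)
  qed
  have "shift (- g) (shift g G) = G" using assms by (simp add: shift_shift)
  then show ?thesis using *[of G g] *[of "shift g G" "- g"] assms by auto
qed

lemma shift_row:
  assumes g: "fps_nth g 0 = 0" and b: "b \<le> zmin (red G)"
  shows "mcoeff (red (shift g G)) a b = mcoeff (red G) a b"
proof -
  have "mcoeff (shift g (red G)) a b =
      mcoeff (red G) a b * (of_nat (a choose a) * fps_nth (g ^ (a - a)) (b - b))"
  proof (rule mcoeff_shift_single[of 1])
    fix i j assume *: "mcoeff (red G) i j \<noteq> 0" "(i, j) \<noteq> (a, b)" "a \<le> i" "j \<le> b"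
    then have "b \<le> j" using zmin_le[OF *(1)] b by simp
    then show "b < j + 1 * (i - a)" using * by auto
  qed (use g in auto)
  then show ?thesis by (subst red_shift[OF g]) (simp add: mcoeff_red)
qed

text \<open>
  Exponents move upwards, so the lowest row of the support stays as it is.
\<close>

lemma shift_corner:
  assumes g: "fps_nth g 0 = 0" and G: "red G \<noteq> 0"
  shows "zmin (red (shift g G)) = zmin (red G)" "ycorner (red (shift g G)) = ycorner (red G)"
proof -
  have nz: "mcoeff (red (shift g G)) (ycorner (red G)) (zmin (red G)) \<noteq> 0"
    using mcoeff_corner[OF G] by (simp add: shift_row[OF g])
  have ge: "zmin (red G) \<le> j" if "mcoeff (red (shift g G)) i j \<noteq> 0" for i j
  proof (rule ccontr)
    assume *: "\<not> zmin (red G) \<le> j"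
    then have "mcoeff (red G) i j \<noteq> 0" using that shift_row[OF g, of j G i] by simp
    then show False using zmin_le * by blast
  qed
  then show "zmin (red (shift g G)) = zmin (red G)" using nz by (intro zmin_eqI)
  show "ycorner (red (shift g G)) = ycorner (red G)"
    using nz ge by (rule ycorner_eqI) (auto simp: shift_row[OF g] intro: ycorner_le)
qed

section \<open>The invariants in terms of translations\<close>

text \<open>
  \<open>G\<close> represents \<open>F\<close> in coordinates subordinate to \<open>h\<close>. The factor \<open>u\<^sup>p\<close> arises in a blowup,
  from the choice of an equation of the exceptional divisor.
\<close>

definition frame :: "'k fps fps \<Rightarrow> 'k fps fps \<Rightarrow> 'k fps fps \<Rightarrow> bool" where
  "frame F h G \<longleftrightarrow> (\<exists>Y Z u. (Y, Z) \<in> subordinate_coords h \<and> u dvd 1 \<and> F = u ^ p * subst2 G Y Z)"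

end

lemma subordinate_coordsD:
  assumes "(Y, Z) \<in> subordinate_coords h"
  shows "local_coords Y Z" "Z dvd h" "h dvd Z"
  using assms by (auto simp: subordinate_coords_def)

lemma subordinate_shift:
  assumes YZ: "(Y, Z) \<in> subordinate_coords h" and g: "fps_nth g 0 = 0"
  obtains Y' where "(Y', Z) \<in> subordinate_coords h" "\<And>G. subst2 G Y Z = subst2 (shift g G) Y' Z"
proof -
  define Y' where "Y' = subst2 (y_var - emb g) Y Z"
  note lc = subordinate_coordsD(1)[OF YZ]
  note YZ1 = local_coordsD[OF lc]
  have "local_coords (y_var - emb g) z_var"
    using g by (auto simp: local_coords_iff jac_def mcoeff_y_var mcoeff_z_var mcoeff_emb intro!: ord_ge_diff ord_ge_emb)
  then have "local_coords Y' Z"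
    using local_coords_subst2[OF _ lc, of "y_var - emb g" z_var] subst2_z_var[OF YZ1(1,2)] by (simp add: Y'_def)
  then have 1: "(Y', Z) \<in> subordinate_coords h" using YZ by (auto simp: subordinate_coords_def)
  have "subst2 (shift g G) Y' Z = subst2 G Y Z" for G
  proof -
    have Y'1: "ord_ge 1 Y'" using \<open>local_coords Y' Z\<close> by (rule local_coordsD)
    have "subst2 (y_var + emb g) Y' Z = Y' + subst2 (emb g) Y Z"
      using subst2_emb_cong[of g Y' Z Y] by (simp only: subst2_add subst2_y_var[OF Y'1 YZ1(2)])
    moreover have "Y' = Y - subst2 (emb g) Y Z" using YZ1 by (simp add: Y'_def subst2_diff subst2_y_var)
    ultimately have "subst2 (y_var + emb g) Y' Z = Y" by simp
    then show ?thesis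
      unfolding shift_def subst2_trans[OF ord_ge_shift_var[OF g] ord_ge_vars(2) Y'1 YZ1(2)]
        subst2_z_var[OF Y'1 YZ1(2)] by simp
  qed
  then show ?thesis using that[OF 1] by metis
qed

lemma dvd_each_other_unit:
  fixes Z :: "'k::field fps fps"
  assumes "Z dvd h" "h dvd Z" "Z' dvd h" "h dvd Z'" "Z \<noteq> 0"
  obtains v where "v dvd 1" "Z' = Z * v"
proof -
  have "Z dvd Z'" "Z' dvd Z" using assms dvd_trans by blast+
  obtain v where v: "Z' = Z * v" using \<open>Z dvd Z'\<close> by (rule dvdE)
  obtain w where w: "Z = Z' * w" using \<open>Z' dvd Z\<close> by (rule dvdE)
  have "Z * 1 = Z * (v * w)" using w by (simp add: v mult.assoc)
  then have "1 = v * w" using assms(5) by (simp only: mult_cancel_left) simp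
  then have "v dvd 1" by (metis dvd_triv_left)
  then show ?thesis using that v by blast
qed

context char_p begin

lemma frame_shift:
  assumes "frame F h G" "fps_nth g 0 = 0"
  shows "frame F h (shift g G)"
  using assms subordinate_shift unfolding frame_def by metis

lemma upset_expansion_power_p_mult:
  assumes c: "c \<in> subordinate_coords h" and u: "u dvd 1"
  shows "upset (expansion p (u ^ p * subst2 G (fst c) (snd c)) c) = upset (red G)"
proof -
  obtain Y Z where cYZ: "c = (Y, Z)" by (cases c)
  then have lc: "local_coords Y Z" using c subordinate_coordsD by blast
  note YZ = local_coordsD[OF lc]
  define w where "w = in_coords u Y Z"
  have "mcoeff w 0 0 \<noteq> 0" using u by (simp add: w_def mcoeff_in_coords_00[OF lc] unit_iff)
  then have w: "w ^ p dvd 1" by (simp add: unit_iff)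
  have "in_coords (u ^ p * subst2 G Y Z) Y Z = w ^ p * G"
    unfolding in_coords_eq_iff[OF lc] w_def
    by (simp add: subst2_mult[OF YZ(1,2)] subst2_power[OF YZ(1,2)] subst2_in_coords[OF lc])
  then show ?thesis
    unfolding expansion_def cYZ using upset_unit_mult[OF w, of "red G"] by (simp add: red_power_p_mult)
qed

text \<open>
  Two subordinate coordinate systems differ by a translation and units, so that the Newton polygons
  of all expansions of \<open>F\<close> are those of the translates of one of them.
\<close>

lemma frame_expansion:
  assumes fr: "frame F h G" and c: "c \<in> subordinate_coords h"
  obtains g where "fps_nth g 0 = 0" "upset (expansion p F c) = upset (red (shift g G))"
proof -
  obtain Y0 Z0 u where c0: "(Y0, Z0) \<in> subordinate_coords h" and u: "u dvd 1" and F: "F = u ^ p * subst2 G Y0 Z0"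
    using fr by (auto simp: frame_def)
  obtain Y Z where cYZ: "c = (Y, Z)" by (cases c)
  note d0 = subordinate_coordsD[OF c0] and d = subordinate_coordsD[OF c[unfolded cYZ]]
  note YZ = local_coordsD[OF d(1)]
  have "Z \<noteq> 0" using YZ by (auto simp: jac_def)
  then obtain v where v: "v dvd 1" "Z0 = Z * v"
    using dvd_each_other_unit[OF d(2,3) d0(2,3)] by blast
  define v' where "v' = in_coords v Y Z"
  have v': "v' dvd 1" using v by (simp add: v'_def mcoeff_in_coords_00[OF d(1)] unit_iff)
  have Z0: "in_coords Z0 Y Z = z_var * v'"
    unfolding in_coords_eq_iff[OF d(1)] v(2) v'_def
    by (simp add: subst2_variable_mult[OF YZ(1,2)] subst2_in_coords[OF d(1)])
  define Y' where "Y' = in_coords Y0 Y Z"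
  have lc: "local_coords Y' (z_var * v')"
    using local_coords_in_coords[OF d0(1) d(1)] by (simp add: Y'_def Z0)
  obtain g w where g: "fps_nth g 0 = 0" and w: "w dvd 1"
    and factor: "\<And>G. subst2 G Y' (z_var * v') = subst2 (shift g G) (y_var * w) (z_var * v')"
    using subordinate_change_factors[OF lc v'] by metis
  have "subst2 G Y0 Z0 = subst2 (subst2 G Y' (z_var * v')) Y Z"
    using in_coords_subst2_change[OF d0(1) d(1), of G, folded Y'_def, unfolded Z0]
    by (metis subst2_in_coords[OF d(1)])
  then have "upset (expansion p F c) = upset (red (subst2 G Y' (z_var * v')))"
    using upset_expansion_power_p_mult[OF c u] by (simp add: F cYZ)
  also have "\<dots> = upset (red (shift g G))"
    unfolding factor by (rule upset_red_scaling[OF w v'])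
  finally show ?thesis using that g by blast
qed

lemma frame_realize:
  assumes "frame F h G"
  obtains c where "c \<in> subordinate_coords h" "upset (expansion p F c) = upset (red G)"
proof -
  obtain Y Z u where "(Y, Z) \<in> subordinate_coords h" "u dvd 1" "F = u ^ p * subst2 G Y Z"
    using assms by (auto simp: frame_def)
  then show ?thesis using that[of "(Y, Z)"] upset_expansion_power_p_mult[of "(Y, Z)" h u G] by auto
qed

definition maximal_ymin :: "'k fps fps \<Rightarrow> bool" where
  "maximal_ymin G \<longleftrightarrow> (\<forall>g. fps_nth g 0 = 0 \<longrightarrow> ymin (red (shift g G)) \<le> ymin (red G))"

definition maximal_slope :: "'k fps fps \<Rightarrow> bool" where
  "maximal_slope G \<longleftrightarrow> (\<forall>g. fps_nth g 0 = 0 \<longrightarrow> ymin (red (shift g G)) = ymin (red G)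
     \<longrightarrow> slope (red (shift g G)) \<le> slope (red G))"

lemma slope_upset_cong: 
  assumes "upset F = upset G"
  shows "slope F = slope G"
  unfolding slope_def vertices_def newton_polygon_cong[OF assms] ..

lemma expansion_measures:
  assumes fr: "frame F h G" and G: "red G \<noteq> 0" and c: "c \<in> subordinate_coords h"
  obtains g where "fps_nth g 0 = 0" "expansion p F c \<noteq> 0"
    "ymin (expansion p F c) = ymin (red (shift g G))"
    "height (expansion p F c) = ycorner (red G) - ymin (red (shift g G))"
    "slope (expansion p F c) = slope (red (shift g G))"
    "ymin (red (shift g G)) \<le> ycorner (red G)"
    "upset (expansion p F c) = upset (red (shift g G))"
proof -
  obtain g where g: "fps_nth g 0 = 0" and up: "upset (expansion p F c) = upset (red (shift g G))"
    by (rule frame_expansion[OF fr c])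
  have nz: "red (shift g G) \<noteq> 0" using G g by (simp add: red_shift_eq_0_iff)
  then have nz': "expansion p F c \<noteq> 0" using up upset_eq_empty_iff by metis
  show ?thesis
    using that[OF g nz'] upset_measures_cong[OF up] slope_upset_cong[OF up] shift_corner[OF g G] ymin_le_ycorner[OF nz] up
    by (simp add: height_eq[OF nz'])
qed

text \<open>
  All expansions have the same corner, so the height is realized exactly where \<open>ymin\<close> is
  maximal.
\<close>

lemma frame_invariants:
  assumes fr: "frame F h G" and G: "red G \<noteq> 0" and max: "maximal_ymin G"
  shows "height_at p h F = ycorner (red G) - ymin (red G)"
    and "realizing_coords p h F = {c \<in> subordinate_coords h. ymin (expansion p F c) = ymin (red G)}"
    and "bonus_at \<epsilon> \<delta> p h F = (if ymin (red G) = 0 then 1 + \<delta> else if ymin (red G) = 1 then \<epsilon> else 0)"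
    and "subordinate_monomial_at p h F \<longleftrightarrow> ymin (red G) = ycorner (red G)"
    and "maximal_slope G \<Longrightarrow> slope_at p h F = slope (red G)"
proof -
  obtain c0 where c0: "c0 \<in> subordinate_coords h" "upset (expansion p F c0) = upset (red G)"
    by (rule frame_realize[OF fr])
  have c0nz: "expansion p F c0 \<noteq> 0" using c0(2) G upset_eq_empty_iff by metis
  note c0m = upset_measures_cong[OF c0(2)]
  have le: "ymin (expansion p F c) \<le> ymin (red G)" if "c \<in> subordinate_coords h" for c
    using expansion_measures[OF fr G that] max unfolding maximal_ymin_def by metis
  have ht: "height (expansion p F c) = ycorner (red G) - ymin (expansion p F c)"
      "expansion p F c \<noteq> 0" "ymin (expansion p F c) \<le> ycorner (red G)" if "c \<in> subordinate_coords h" for c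
    using expansion_measures[OF fr G that] by metis+
  show height: "height_at p h F = ycorner (red G) - ymin (red G)"
    unfolding height_at_def
  proof (rule Least_equality)
    show "\<exists>c\<in>subordinate_coords h. ycorner (red G) - ymin (red G) = height (expansion p F c)"
      using c0(1) ht(1)[OF c0(1)] c0m(3) by metis
  qed (use ht le diff_le_mono2 in auto)
  show real: "realizing_coords p h F = {c \<in> subordinate_coords h. ymin (expansion p F c) = ymin (red G)}"
    unfolding realizing_coords_def height using ht(1,3) ymin_le_ycorner[OF G] by fastforce
  have c0r: "c0 \<in> realizing_coords p h F" using c0 c0m by (simp add: real)
  show "bonus_at \<epsilon> \<delta> p h F = (if ymin (red G) = 0 then 1 + \<delta> else if ymin (red G) = 1 then \<epsilon> else 0)"
    unfolding bonus_at_def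
  proof (rule the_equality)
    show *: "\<forall>c\<in>realizing_coords p h F. bonus \<epsilon> \<delta> (expansion p F c) =
        (if ymin (red G) = 0 then 1 + \<delta> else if ymin (red G) = 1 then \<epsilon> else 0)"
      using ht(2) by (auto simp: real bonus_def measures_eq)
    show "b = (if ymin (red G) = 0 then 1 + \<delta> else if ymin (red G) = 1 then \<epsilon> else 0)"
      if "\<forall>c\<in>realizing_coords p h F. bonus \<epsilon> \<delta> (expansion p F c) = b" for b
      using that * c0r by metis
  qed
  show "subordinate_monomial_at p h F \<longleftrightarrow> ymin (red G) = ycorner (red G)"
  proof
    assume "subordinate_monomial_at p h F"
    then obtain c where c: "c \<in> subordinate_coords h" "monomial_series (expansion p F c)"
      by (auto simp: subordinate_monomial_at_def)
    obtain g where g: "fps_nth g 0 = 0" and up: "upset (expansion p F c) = upset (red (shift g G))"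
      by (rule frame_expansion[OF fr c(1)])
    have "ymin (expansion p F c) = ycorner (expansion p F c)"
      using c(2) ht(2)[OF c(1)] by (simp add: monomial_series_iff)
    then have "ymin (red (shift g G)) = ycorner (red G)"
      using upset_measures_cong[OF up] shift_corner[OF g G] by simp
    then show "ymin (red G) = ycorner (red G)"
      using max g ymin_le_ycorner[OF G] by (force simp: maximal_ymin_def)
  next
    assume "ymin (red G) = ycorner (red G)"
    then have "monomial_series (expansion p F c0)" using c0m by (simp add: monomial_series_iff[OF c0nz])
    then show "subordinate_monomial_at p h F" using c0 by (auto simp: subordinate_monomial_at_def)
  qed
  assume ms: "maximal_slope G"
  show "slope_at p h F = slope (red G)"
    unfolding slope_at_def
  proof (rule Greatest_equality)
    show "\<exists>c\<in>realizing_coords p h F. slope (red G) = slope (expansion p F c)"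
      using slope_upset_cong[OF c0(2)] by (intro bexI[OF _ c0r]) simp
    fix s assume "\<exists>c\<in>realizing_coords p h F. s = slope (expansion p F c)"
    then obtain c where c: "c \<in> subordinate_coords h" "ymin (expansion p F c) = ymin (red G)" "s = slope (expansion p F c)"
      by (auto simp: real)
    then show "s \<le> slope (red G)"
      using expansion_measures[OF fr G c(1)] ms unfolding maximal_slope_def by metis
  qed
qed

lemma maximal_ymin_exists:
  assumes "red G \<noteq> 0"
  obtains g where "fps_nth g 0 = 0" "maximal_ymin (shift g G)"
proof -
  define P where "P n \<longleftrightarrow> (\<exists>g. fps_nth g 0 = 0 \<and> n = ymin (red (shift g G)))" for n
  have "P (ymin (red G))" unfolding P_def by (intro exI[of _ 0]) simp
  moreover have "n \<le> ycorner (red G)" if "P n" for n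
    using that shift_corner[OF _ assms] ymin_le_ycorner red_shift_eq_0_iff assms unfolding P_def by metis
  ultimately obtain n where n: "P n" "\<And>m. P m \<Longrightarrow> m \<le> n"
    using Greatest_le_nat[of P] GreatestI_nat[of P] by metis
  then obtain g where g: "fps_nth g 0 = 0" "n = ymin (red (shift g G))" by (auto simp: P_def)
  have "maximal_ymin (shift g G)"
    unfolding maximal_ymin_def
  proof (intro allI impI)
    fix f :: "'k fps" assume f: "fps_nth f 0 = 0"
    then have "P (ymin (red (shift (f + g) G)))" using g by (auto simp: P_def intro!: exI[of _ "f + g"])
    then show "ymin (red (shift f (shift g G))) \<le> ymin (red (shift g G))"
      using n(2) g f by (simp add: shift_shift)
  qed
  then show ?thesis using that g by blast
qed

section \<open>Maximal slope\<close>

lemma frame_monomial_at: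
  assumes fr: "frame F h G" and G: "red G \<noteq> 0" and eq: "ymin (red G) = ycorner (red G)"
  shows "monomial_at p F"
proof -
  obtain Y Z where c: "(Y, Z) \<in> subordinate_coords h" "upset (expansion p F (Y, Z)) = upset (red G)"
    using frame_realize[OF fr] by (metis surj_pair)
  then have "expansion p F (Y, Z) \<noteq> 0" using G upset_eq_empty_iff by metis
  then have "monomial_series (expansion p F (Y, Z))"
    using upset_measures_cong[OF c(2)] eq by (simp add: monomial_series_iff)
  then show ?thesis using subordinate_coordsD(1)[OF c(1)] unfolding monomial_at_def by blast
qed

text \<open>
  If the corner is \<open>y z\<^sup>d\<close>, then the class is \<open>z\<^sup>d\<close> times a series \<open>Y\<close> whose linear term
  involves \<open>y\<close>, and \<open>(Y, z)\<close> are coordinates in which it is a monomial.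
\<close>

lemma ycorner_le_1_imp_monomial:
  assumes G: "red G \<noteq> 0" and le: "ycorner (red G) \<le> 1"
  obtains g where "fps_nth g 0 = 0" "ymin (red (shift g G)) = ycorner (red G)"
proof (cases "ycorner (red G) = 0")
  case True
  then show ?thesis using that[of 0] ymin_le_ycorner[OF G] by simp
next
  case False
  define R where "R = red G"
  define d where "d = zmin R"
  have R: "R \<noteq> 0" "ycorner R = 1" using G le False by (simp_all add: R_def)
  have R1: "mcoeff R 1 d \<noteq> 0" using mcoeff_corner[OF R(1)] by (simp add: R d_def)
  have R0: "mcoeff R 0 d = 0" using ycorner_le[of R 0] R by (auto simp: d_def)
  have Rlow: "mcoeff R i j = 0" if "j < d" for i j using zmin_le[of R i j] that by (auto simp: d_def)
  define w where "w = Abs_fps (\<lambda>b. Abs_fps (\<lambda>a. mcoeff R (Suc a) (b + d)))"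
  define q where "q = Abs_fps (\<lambda>b. mcoeff R 0 (Suc b + d))"
  have w: "mcoeff w a b = mcoeff R (Suc a) (b + d)" for a b by (simp add: w_def mcoeff_def)
  define Y where "Y = y_var * w + z_var * emb q"
  have RY: "R = z_var ^ d * Y"
  proof (rule mcoeff_eqI)
    fix a b
    show "mcoeff R a b = mcoeff (z_var ^ d * Y) a b"
    proof (cases "d \<le> b")
      case True
      then obtain k where k: "b = k + d" by (metis add.commute le_add_diff_inverse)
      show ?thesis unfolding mcoeff_z_power_mult Y_def mcoeff_add mcoeff_y_mult mcoeff_z_mult w mcoeff_emb q_def k
        using R0 by (cases a; cases k) auto
    qed (use Rlow in \<open>simp add: mcoeff_z_power_mult\<close>)
  qed
  have Y: "mcoeff Y 0 0 = 0" "mcoeff Y 1 0 \<noteq> 0"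
    using R1 by (simp_all add: Y_def mcoeff_y_mult mcoeff_z_mult w mcoeff_emb mcoeff_y_var mcoeff_z_var)
  have z1: "z_var * 1 = (z_var :: 'k fps fps)" by simp
  have lc: "local_coords Y z_var"
    using Y by (simp add: local_coords_iff ord_ge_1_iff jac_def mcoeff_z_var)
  define M where "M = (y_var * z_var ^ d :: 'k fps fps)"
  have "subst2 M Y z_var = R"
    using local_coordsD[OF lc]
    by (simp add: M_def RY subst2_mult subst2_power subst2_y_var subst2_z_var mult.commute)
  then have "M = in_coords (subst2 R y_var z_var) Y z_var" using in_coords_subst2[OF lc, of M] by simp
  also have "\<dots> = subst2 R (in_coords y_var Y z_var) (in_coords z_var Y z_var)"
    by (rule in_coords_subst2_change[OF local_coords_variables lc])
  also have zz: "in_coords z_var Y z_var = z_var * 1"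
    using local_coordsD[OF lc] by (simp add: in_coords_eq_iff[OF lc] subst2_z_var)
  finally have M: "M = subst2 R (in_coords y_var Y z_var) (z_var * 1)" .
  have lc': "local_coords (in_coords y_var Y z_var) (z_var * 1)"
    using local_coords_in_coords[OF local_coords_variables lc] unfolding zz .
  obtain g v where g: "fps_nth g 0 = 0" and v: "v dvd 1"
    and fac: "\<And>G. subst2 G (in_coords y_var Y z_var) (z_var * 1) = subst2 (shift g G) (y_var * v) (z_var * 1)"
    using subordinate_change_factors[OF lc' dvd_refl] by metis
  have "upset (red M) = upset (red (shift g R))"
    unfolding M fac by (rule upset_red_scaling[OF v dvd_refl])
  then have up: "upset (red M) = upset (red (shift g G))" using red_shift[OF g, of G] by (simp add: R_def)
  have Mc: "mcoeff M a b = (if a = 1 \<and> b = d then 1 else 0)" for a b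
    using mcoeff_monomial[of 1 d a b] by (simp add: M_def)
  have "\<not> p dvd 1" using prime_p by auto
  then have "ymin (red M) = 1" by (intro ymin_eqI[of _ _ d]) (auto simp: mcoeff_red Mc split: if_splits)
  then show ?thesis using that[OF g] upset_measures_cong(3)[OF up] R by (simp add: R_def)
qed

text \<open>
  The terms to the left of the corner lie above the line of ratio \<open>m\<close> through the corner, that is,
  the slope exceeds \<open>m\<close> times the \<open>y\<close>-exponent of the corner, or is infinite.
\<close>

definition steep :: "nat \<Rightarrow> 'k fps fps \<Rightarrow> bool" where
  "steep m G \<longleftrightarrow> (\<forall>i j. mcoeff (red G) i j \<noteq> 0 \<longrightarrow> i < ycorner (red G) \<longrightarrow>
     zmin (red G) + m * (ycorner (red G) - i) < j)"

text \<open>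
  Give \<open>y\<close> the weight \<open>m\<close> and \<open>z\<close> the weight one. Then all terms of \<open>g\<close> have weight more than \<open>m\<close>,
  so every new term has a larger weight than the term it comes from, hence more than the corner.
\<close>

lemma steep_shift:
  assumes G: "red G \<noteq> 0" and st: "steep m G" and g: "\<And>k. k \<le> m \<Longrightarrow> fps_nth g k = 0"
  shows "steep m (shift g G)"
proof -
  have g0: "fps_nth g 0 = 0" using g by simp
  define D d where "D = ycorner (red G)" and "d = zmin (red G)"
  have "d + m * (D - a) < b" if ab: "mcoeff (red (shift g G)) a b \<noteq> 0" "a < D" for a b
  proof (rule ccontr)
    assume le: "\<not> d + m * (D - a) < b"
    have "mcoeff (shift g (red G)) a b = 0"
    proof (rule mcoeff_shift_eq_0[of "Suc m"])
      fix i j assume ij: "mcoeff (red G) i j \<noteq> 0" "a \<le> i" "j \<le> b"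
      show "b < j + Suc m * (i - a)"
      proof (cases "i < D")
        case True
        then have "d + m * (D - i) < j" using st ij(1) by (simp add: steep_def D_def d_def)
        moreover have "m * (D - i) + m * (i - a) = m * (D - a)"
          using True ij(2) by (simp add: distrib_left[symmetric])
        ultimately show ?thesis using le by simp
      next
        case False
        then have "m * (D - a) \<le> m * (i - a)" "0 < i - a" using ab(2) by auto
        moreover have "d \<le> j" using zmin_le[OF ij(1)] by (simp add: d_def)
        ultimately show ?thesis using le unfolding mult_Suc by linarith
      qed
    qed (use g in auto)
    then show False using ab(1) by (subst (asm) (1) red_shift[OF g0]) (simp add: mcoeff_red split: if_splits)
  qed
  then show ?thesis using shift_corner[OF g0 G] by (simp add: steep_def D_def d_def)
qed

lemma fps_power_nth_leading:
  fixes g :: "'a::field fps"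
  assumes "\<And>k. k < j \<Longrightarrow> fps_nth g k = 0"
  shows "fps_nth (g ^ n) (j * n) = fps_nth g j ^ n"
proof -
  have "g = fps_X ^ j * fps_shift j g"
    by (rule fps_ext) (simp add: fps_X_power_mult_nth assms)
  then have "g ^ n = (fps_X ^ j * fps_shift j g) ^ n" by simp
  also have "\<dots> = fps_X ^ (j * n) * fps_shift j g ^ n" by (simp add: power_mult_distrib power_mult)
  finally show ?thesis by (simp add: fps_X_power_mult_nth fps_power_zeroth)
qed

text \<open>
  Suppose that \<open>g = c z\<^sup>j + \<dots>\<close> with \<open>c \<noteq> 0\<close> and \<open>j \<le> m\<close>. On the line of ratio \<open>j\<close> through
  the corner \<open>(D,d)\<close>, the translate has the terms of \<open>(y + c z\<^sup>j)\<^sup>D z\<^sup>d\<close>, up to a constant. One of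
  those to the left of the corner is not a \<open>p\<close>-th power: if \<open>p\<close> divides \<open>D\<close>, it does not divide
  \<open>d\<close>, and the term without \<open>y\<close> will do; otherwise the term linear in \<open>y\<close> has the coefficient
  \<open>D c\<^bsup>D-1\<^esup>\<close>, and it lies to the left of the corner because \<open>D \<ge> 2\<close>.
\<close>

lemma steep_unique:
  assumes G: "red G \<noteq> 0" and D2: "2 \<le> ycorner (red G)" and st: "steep m G"
    and g0: "fps_nth g 0 = 0" and st': "steep m (shift g G)"
  shows "k \<le> m \<Longrightarrow> fps_nth g k = 0"
proof (rule ccontr)
  assume "k \<le> m" "fps_nth g k \<noteq> 0"
  define j where "j = (LEAST k. fps_nth g k \<noteq> 0)"
  have j: "fps_nth g j \<noteq> 0" unfolding j_def using \<open>fps_nth g k \<noteq> 0\<close> by (rule LeastI)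
  have low: "fps_nth g i = 0" if "i < j" for i using not_less_Least[of i "\<lambda>k. fps_nth g k \<noteq> 0"] that by (auto simp: j_def)
  have "j \<le> k" unfolding j_def using \<open>fps_nth g k \<noteq> 0\<close> by (rule Least_le)
  then have jm: "j \<le> m" using \<open>k \<le> m\<close> by simp
  have j1: "1 \<le> j" using j g0 by (cases j) auto
  define D d where "D = ycorner (red G)" and "d = zmin (red G)"
  \<comment> \<open>The \<open>y\<close>-exponent of the term that prevents the translate from being steep.\<close>
  define \<alpha> where "\<alpha> = (if p dvd D then 0 else 1 :: nat)"
  have \<alpha>D: "\<alpha> < D" using D2 by (auto simp: \<alpha>_def D_def)
  define b where "b = d + j * (D - \<alpha>)"
  have corner: "mcoeff (red G) D d \<noteq> 0" using mcoeff_corner[OF G] by (simp add: D_def d_def)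
  have "mcoeff (shift g (red G)) \<alpha> b =
      mcoeff (red G) D d * (of_nat (D choose \<alpha>) * fps_nth (g ^ (D - \<alpha>)) (b - d))"
  proof (rule mcoeff_shift_single[of j])
    fix i l assume il: "mcoeff (red G) i l \<noteq> 0" "(i, l) \<noteq> (D, d)" "\<alpha> \<le> i" "l \<le> b"
    have dl: "d \<le> l" using zmin_le[OF il(1)] by (simp add: d_def)
    consider "i < D" | "i = D" "d < l" | "D < i" using il(2) dl by force
    then show "b < l + j * (i - \<alpha>)"
    proof cases
      case 1
      then have "d + m * (D - i) < l" using st il(1) by (simp add: steep_def D_def d_def)
      moreover have "j * (D - i) \<le> m * (D - i)" using jm by simp
      moreover have "j * (D - i) + j * (i - \<alpha>) = j * (D - \<alpha>)"
        using 1 il(3) by (simp add: distrib_left[symmetric])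
      ultimately show ?thesis unfolding b_def by linarith
    next
      case 3
      then have "j * (D - \<alpha>) < j * (i - \<alpha>)" using j1 \<alpha>D by simp
      then show ?thesis using dl unfolding b_def by linarith
    qed (simp add: b_def)
  next
    have "D - \<alpha> \<le> j * (D - \<alpha>)" using j1 by simp
    then show "D + d \<le> \<alpha> + b" using \<alpha>D unfolding b_def by linarith
  qed (use low \<alpha>D in \<open>auto simp: b_def\<close>)
  also have "fps_nth (g ^ (D - \<alpha>)) (b - d) = fps_nth g j ^ (D - \<alpha>)"
    using fps_power_nth_leading[of j g "D - \<alpha>"] low by (simp add: b_def)
  finally have "mcoeff (shift g (red G)) \<alpha> b \<noteq> 0 \<longleftrightarrow> of_nat (D choose \<alpha>) \<noteq> (0 :: 'k)"
    using corner j by simp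
  moreover have "of_nat (D choose \<alpha>) \<noteq> (0 :: 'k)"
    using of_nat_eq_0_iff_char_dvd[where ?'a = 'k, of D] by (auto simp: \<alpha>_def CHAR_eq)
  moreover have "\<not> (p dvd \<alpha> \<and> p dvd b)"
  proof (cases "p dvd D")
    case True
    have "\<not> p dvd d" using corner True by (auto simp: mcoeff_red)
    then show ?thesis using True by (simp add: b_def \<alpha>_def dvd_add_left_iff)
  next
    case False
    then show ?thesis using prime_p by (auto simp: \<alpha>_def)
  qed
  ultimately have "mcoeff (red (shift g G)) \<alpha> b \<noteq> 0"
    by (subst red_shift[OF g0]) (simp add: mcoeff_red)
  then have "d + m * (D - \<alpha>) < b"
    using st' \<alpha>D shift_corner[OF g0 G] by (simp add: steep_def D_def d_def)
  moreover have "j * (D - \<alpha>) \<le> m * (D - \<alpha>)" using jm by simp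
  ultimately show False by (simp add: b_def)
qed

text \<open>
  Translations that make the class \<open>m\<close>-steep are unique up to order \<open>m\<close>. If they existed for all
  \<open>m\<close>, they would converge to a translation after which no term is left of the corner, so that
  \<open>ymin\<close> and \<open>ycorner\<close> coincide.
\<close>

lemma steep_bounded:
  assumes G: "red G \<noteq> 0" and D2: "2 \<le> ycorner (red G)"
    and nm: "\<And>g. fps_nth g 0 = 0 \<Longrightarrow> ymin (red (shift g G)) < ycorner (red G)"
  obtains m where "\<And>g. fps_nth g 0 = 0 \<Longrightarrow> \<not> steep m (shift g G)"
proof (rule ccontr)
  assume "\<not> thesis"
  then have "\<forall>m. \<exists>g. fps_nth g 0 = 0 \<and> steep m (shift g G)" using that by blast
  then obtain g where g0: "\<And>m. fps_nth (g m) 0 = 0" and st: "\<And>m. steep m (shift (g m) G)" by metis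
  have mono: "steep k (shift f G)" if "steep m (shift f G)" "k \<le> m" for k m f
    unfolding steep_def
  proof (intro allI impI)
    fix i j assume "mcoeff (red (shift f G)) i j \<noteq> 0" "i < ycorner (red (shift f G))"
    then have "zmin (red (shift f G)) + m * (ycorner (red (shift f G)) - i) < j"
      using that(1) by (simp add: steep_def)
    moreover have "k * (ycorner (red (shift f G)) - i) \<le> m * (ycorner (red (shift f G)) - i)"
      using that(2) by simp
    ultimately show "zmin (red (shift f G)) + k * (ycorner (red (shift f G)) - i) < j" by linarith
  qed
  have agree: "fps_nth (g m) k = fps_nth (g n) k" if "k \<le> n" "n \<le> m" for k n m
  proof -
    have nz: "red (shift (g n) G) \<noteq> 0" using G g0 by (simp add: red_shift_eq_0_iff)
    have "shift (g m - g n) (shift (g n) G) = shift (g m) G" using g0 by (simp add: shift_shift)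
    then have "fps_nth (g m - g n) k = 0"
      using steep_unique[OF nz _ st[of n], of "g m - g n" k] mono[OF st[of m] that(2)] that g0
        shift_corner[OF g0 G] D2 by simp
    then show ?thesis by simp
  qed
  define f where "f = Abs_fps (\<lambda>k. fps_nth (g k) k)"
  have f0: "fps_nth f 0 = 0" using g0 by (simp add: f_def)
  have stf: "steep m (shift f G)" for m
  proof -
    have nz: "red (shift (g m) G) \<noteq> 0" using G g0 by (simp add: red_shift_eq_0_iff)
    have "fps_nth (f - g m) k = 0" if "k \<le> m" for k using agree[of k k m] that by (simp add: f_def)
    then have "steep m (shift (f - g m) (shift (g m) G))" by (intro steep_shift nz st)
    then show ?thesis using f0 g0 by (simp add: shift_shift)
  qed
  have nz: "red (shift f G) \<noteq> 0" using G f0 by (simp add: red_shift_eq_0_iff)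
  define H where "H = red (shift f G)"
  have lt: "ymin H < ycorner H" using nm[OF f0] shift_corner[OF f0 G] by (simp add: H_def)
  have "zmin H + ztop H * (ycorner H - ymin H) < ztop H"
    using stf[of "ztop H"] mcoeff_top[OF nz] lt unfolding steep_def H_def by blast
  moreover have "ztop H * 1 \<le> ztop H * (ycorner H - ymin H)" using lt by (intro mult_le_mono2) simp
  ultimately show False by simp
qed

text \<open>
  The slopes are bounded by \<open>steep_bounded\<close>, and their denominators are at most \<open>ycorner\<close>, so only
  finitely many values occur.
\<close>

lemma maximal_slope_exists:
  assumes G: "red G \<noteq> 0" and max: "maximal_ymin G" and lt: "ymin (red G) < ycorner (red G)"
  obtains g where "fps_nth g 0 = 0" "ymin (red (shift g G)) = ymin (red G)"
    "maximal_ymin (shift g G)" "maximal_slope (shift g G)"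
proof -
  define D where "D = ycorner (red G)"
  have nm: "ymin (red (shift g G)) < ycorner (red G)" if "fps_nth g 0 = 0" for g
    using max lt that le_less_trans by (auto simp: maximal_ymin_def)
  have D2: "2 \<le> D"
  proof (rule ccontr)
    assume "\<not> 2 \<le> D"
    then obtain g where "fps_nth g 0 = 0" "ymin (red (shift g G)) = ycorner (red G)"
      using ycorner_le_1_imp_monomial[OF G] by (auto simp: D_def)
    then show False using nm[of g] by simp
  qed
  obtain m where m: "\<And>g. fps_nth g 0 = 0 \<Longrightarrow> \<not> steep m (shift g G)"
    using steep_bounded[OF G _ nm] D2 D_def by metis
  define S where "S = {slope (red (shift g G)) | g. fps_nth g 0 = 0 \<and> ymin (red (shift g G)) = ymin (red G)}"
  have "S \<subseteq> (\<lambda>(x, y). ereal (real D * (real x / real y))) ` ({..m * D} \<times> {..D})"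
  proof
    fix s assume "s \<in> S"
    then obtain g where g: "fps_nth g 0 = 0" "s = slope (red (shift g G))" by (auto simp: S_def)
    define H where "H = red (shift g G)"
    have H: "H \<noteq> 0" "ycorner H = D" using G shift_corner[OF g(1) G] g(1)
      by (simp_all add: H_def red_shift_eq_0_iff D_def)
    have "ymin H < ycorner H" using nm[OF g(1)] H by (simp add: H_def D_def)
    then obtain a b where ab: "mcoeff H a b \<noteq> 0" "a < ycorner H"
      and min: "\<And>i j. mcoeff H i j \<noteq> 0 \<Longrightarrow> i < ycorner H \<Longrightarrow> edge_ratio H a b \<le> edge_ratio H i j"
      using edge_exists[OF H(1)] by metis
    obtain i j where ij: "mcoeff H i j \<noteq> 0" "i < ycorner H" "j \<le> zmin H + m * (ycorner H - i)"
      using m[OF g(1)] by (auto simp: steep_def H_def not_less)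
    have "edge_ratio H a b \<le> edge_ratio H i j" using min ij by blast
    also have "edge_ratio H i j \<le> real m"
    proof -
      have "real j \<le> real (zmin H) + real m * (real (ycorner H) - real i)"
        using ij by (metis less_imp_le of_nat_add of_nat_diff of_nat_le_iff of_nat_mult)
      then show ?thesis using ij(2) by (simp add: edge_ratio_def divide_le_eq)
    qed
    finally have "real b - real (zmin H) \<le> real m * (real (ycorner H) - real a)"
      using ab(2) by (simp add: edge_ratio_def divide_le_eq)
    then have "real (b - zmin H) \<le> real (m * (ycorner H - a))"
      using ab zmin_le[OF ab(1)] by (simp add: of_nat_diff)
    then have le: "b - zmin H \<le> m * (ycorner H - a)" by (simp only: of_nat_le_iff)
    also have "m * (ycorner H - a) \<le> m * D" by (simp add: H)
    finally have "b - zmin H \<le> m * D" .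
    moreover have "s = ereal (real D * (real (b - zmin H) / real (D - a)))"
      using slope_eqI[OF ab min] zmin_le[OF ab(1)] ab(2) H(2) g(2)
      by (simp add: H_def edge_ratio_def of_nat_diff)
    ultimately show "s \<in> (\<lambda>(x, y). ereal (real D * (real x / real y))) ` ({..m * D} \<times> {..D})"
      by (intro image_eqI[of _ _ "(b - zmin H, D - a)"]) auto
  qed
  then have fin: "finite S" by (rule finite_subset) auto
  have "slope (red (shift 0 G)) \<in> S" unfolding S_def by (intro CollectI exI[of _ 0]) simp
  then have "Max S \<in> S" using fin by (intro Max_in) auto
  then obtain g where g: "fps_nth g 0 = 0" "ymin (red (shift g G)) = ymin (red G)" "Max S = slope (red (shift g G))"
    by (auto simp: S_def)
  have "maximal_slope (shift g G)"
    unfolding maximal_slope_def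
  proof (intro allI impI)
    fix f :: "'k fps" assume f: "fps_nth f 0 = 0" "ymin (red (shift f (shift g G))) = ymin (red (shift g G))"
    then have "slope (red (shift (f + g) G)) \<in> S" using g unfolding S_def
      by (intro CollectI exI[of _ "f + g"]) (simp add: shift_shift)
    then show "slope (red (shift f (shift g G))) \<le> slope (red (shift g G))"
      using fin g(3) f g(1) by (simp add: shift_shift flip: g(3))
  qed
  moreover have "maximal_ymin (shift g G)"
    unfolding maximal_ymin_def
  proof (intro allI impI)
    fix f :: "'k fps" assume "fps_nth f 0 = 0"
    then show "ymin (red (shift f (shift g G))) \<le> ymin (red (shift g G))"
      using max g by (simp add: shift_shift maximal_ymin_def)
  qed
  ultimately show ?thesis using that g by blast
qed

end

section \<open>Point blowups\<close>

lemma mcoeff_pullback_affine_0: "mcoeff (subst2 G (y_var * z_var) z_var) a b = (if a \<le> b then mcoeff G a (b - a) else 0)"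
proof -
  have mono: "mcoeff ((y_var * z_var) ^ i * z_var ^ j :: 'a fps fps) a b = (if a = i \<and> b = i + j then 1 else 0)" for i j
  proof -
    have "(y_var * z_var) ^ i * z_var ^ j = (y_var ^ i * z_var ^ (i + j) :: 'a fps fps)"
      by (simp add: power_mult_distrib power_add mult.assoc)
    then show ?thesis by (simp only: mcoeff_monomial)
  qed
  have "mcoeff (subst2 G (y_var * z_var) z_var) a b =
      (\<Sum>x\<in>{(i, j). i + j \<le> a + b}. if x = (a, b - a) then (if a \<le> b then mcoeff G a (b - a) else 0) else 0)"
    unfolding mcoeff_subst2 mono by (rule sum.cong) (auto split: if_splits)
  then show ?thesis by (auto simp: finite_triangle)
qed

lemma mcoeff_pullback_infinite: "mcoeff (subst2 G y_var (y_var * z_var)) a b = (if b \<le> a then mcoeff G (a - b) b else 0)"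
proof -
  have mono: "mcoeff (y_var ^ i * (y_var * z_var) ^ j :: 'a fps fps) a b = (if a = i + j \<and> b = j then 1 else 0)" for i j
  proof -
    have "y_var ^ i * (y_var * z_var) ^ j = (y_var ^ (i + j) * z_var ^ j :: 'a fps fps)"
      by (simp add: power_mult_distrib power_add mult.assoc)
    then show ?thesis by (simp only: mcoeff_monomial)
  qed
  have "mcoeff (subst2 G y_var (y_var * z_var)) a b =
      (\<Sum>x\<in>{(i, j). i + j \<le> a + b}. if x = (a - b, b) then (if b \<le> a then mcoeff G (a - b) b else 0) else 0)"
    unfolding mcoeff_subst2 mono by (rule sum.cong) (auto split: if_splits)
  then show ?thesis by (auto simp: finite_triangle)
qed

text \<open>
  The strict transforms at the points \<open>Affine 0\<close> and \<open>Infinite\<close>: an exponent \<open>(a,b)\<close> goes to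
  \<open>(a, a + b - m)\<close>, respectively to \<open>(a + b - m, b)\<close>.
\<close>

definition origin_transform :: "nat \<Rightarrow> 'k::field fps fps \<Rightarrow> 'k fps fps" where
  "origin_transform m G = Abs_fps (\<lambda>b. Abs_fps (\<lambda>a. if a \<le> b + m then mcoeff G a (b + m - a) else 0))"

definition infinity_transform :: "nat \<Rightarrow> 'k::field fps fps \<Rightarrow> 'k fps fps" where
  "infinity_transform m G = Abs_fps (\<lambda>b. Abs_fps (\<lambda>a. if b \<le> a + m then mcoeff G (a + m - b) b else 0))"

lemma mcoeff_origin_transform:
  "mcoeff (origin_transform m G) a b = (if a \<le> b + m then mcoeff G a (b + m - a) else 0)"
  by (simp add: origin_transform_def mcoeff_def)

lemma mcoeff_infinity_transform:
  "mcoeff (infinity_transform m G) a b = (if b \<le> a + m then mcoeff G (a + m - b) b else 0)"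
  by (simp add: infinity_transform_def mcoeff_def)

lemma z_power_origin_transform:
  assumes "ord_ge m G"
  shows "z_var ^ m * origin_transform m G = subst2 G (y_var * z_var) z_var"
proof (rule mcoeff_eqI)
  fix a b
  show "mcoeff (z_var ^ m * origin_transform m G) a b = mcoeff (subst2 G (y_var * z_var) z_var) a b"
    unfolding mcoeff_z_power_mult mcoeff_origin_transform mcoeff_pullback_affine_0
    using ord_geD[OF assms, of a "b - a"] by auto
qed

lemma y_power_infinity_transform:
  assumes "ord_ge m G"
  shows "y_var ^ m * infinity_transform m G = subst2 G y_var (y_var * z_var)"
proof (rule mcoeff_eqI)
  fix a b
  show "mcoeff (y_var ^ m * infinity_transform m G) a b = mcoeff (subst2 G y_var (y_var * z_var)) a b"
    unfolding mcoeff_y_power_mult mcoeff_infinity_transform mcoeff_pullback_infinite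
    using ord_geD[OF assms, of "a - b" b] by auto
qed

text \<open>
  The translation \<open>y \<mapsto> y + t z\<close>, which moves the point \<open>Affine t\<close> to \<open>Affine 0\<close>.
\<close>

definition tangent :: "'k::field \<Rightarrow> 'k fps" where
  "tangent t = fps_const t * fps_X"

lemma tangent_nth: "fps_nth (tangent t) n = (if n = 1 then t else 0)"
  by (simp add: tangent_def)

lemma emb_tangent: "emb (tangent t) = scalar t * z_var"
  by (rule mcoeff_eqI) (simp add: mcoeff_emb tangent_nth mcoeff_z_var)

lemma ord_ge_shift: "fps_nth g 0 = 0 \<Longrightarrow> ord_ge n G \<Longrightarrow> ord_ge n (shift g G)"
  unfolding shift_def by (intro ord_ge_subst2 ord_ge_shift_var) auto

lemma ord_ge_yz: "ord_ge 1 (y_var * z_var)"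
  by (intro ord_ge_mult_left ord_ge_vars)

lemma pullback_affine: "pullback (Affine t) G = subst2 (shift (tangent t) G) (y_var * z_var) z_var"
proof -
  have o: "ord_ge 1 (y_var + emb (tangent t))" by (rule ord_ge_shift_var) (simp add: tangent_nth)
  show ?thesis
    unfolding shift_def subst2_trans[OF o ord_ge_vars(2) ord_ge_yz ord_ge_vars(2)] subst2_add subst2_emb_z
      subst2_y_var[OF ord_ge_yz ord_ge_vars(2)] subst2_z_var[OF ord_ge_yz ord_ge_vars(2)]
    by (simp add: emb_tangent)
qed

lemma exc_eq_nonzero: "exc_eq a' \<noteq> 0"
proof -
  have "(y_var :: 'a fps fps) \<noteq> 0" using mcoeff_y_var[of 1 0] by (metis mcoeff_0 one_neq_zero)
  then show ?thesis by (cases a') simp_all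
qed

lemma strict_transform_eqI:
  assumes "exc_eq a' ^ m * G' = pullback a' G"
  shows "strict_transform m a' G = G'"
  unfolding strict_transform_def
proof (rule the_equality)
  show "exc_eq a' ^ m * G' = pullback a' G" by (rule assms)
  fix H assume "exc_eq a' ^ m * H = pullback a' G"
  then have "exc_eq a' ^ m * H = exc_eq a' ^ m * G'" using assms by simp
  then show "H = G'" using exc_eq_nonzero[of a'] by simp
qed

lemma strict_transform_affine:
  "ord_ge m G \<Longrightarrow> strict_transform m (Affine t) G = origin_transform m (shift (tangent t) G)"
  using z_power_origin_transform[OF ord_ge_shift[of "tangent t"]]
  by (intro strict_transform_eqI) (simp add: pullback_affine tangent_nth del: pullback.simps)

lemma strict_transform_infinite:
  "ord_ge m G \<Longrightarrow> strict_transform m Infinite G = infinity_transform m G"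
  by (intro strict_transform_eqI) (simp add: y_power_infinity_transform)

lemma strict_transform_spec:
  assumes "ord_ge m G"
  shows "exc_eq a' ^ m * strict_transform m a' G = pullback a' G"
proof (cases a')
  case (Affine t)
  then show ?thesis
    using z_power_origin_transform[OF ord_ge_shift[OF _ assms, of "tangent t"]]
    by (simp add: strict_transform_affine[OF assms] pullback_affine tangent_nth del: pullback.simps)
qed (simp add: strict_transform_infinite[OF assms] y_power_infinity_transform[OF assms])

lemma pullback_ring:
  obtains A B where "ord_ge 1 A" "ord_ge 1 B" "\<And>G. pullback a' G = subst2 G A B"
proof (cases a')
  case (Affine t)
  show ?thesis
  proof (rule that)
    show "ord_ge 1 (y_var * z_var + scalar t * z_var)"
      by (intro ord_ge_add ord_ge_mult_left ord_ge_vars)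
  qed (simp_all add: Affine)
next
  case Infinite
  show ?thesis
  proof (rule that[of y_var "y_var * z_var"])
    show "ord_ge 1 (y_var * z_var)" by (rule ord_ge_yz)
  qed (simp_all add: Infinite)
qed

text \<open>
  In the chart \<open>y \<mapsto> y z\<close> a translation of \<open>y\<close> by \<open>g\<close> comes from the translation by \<open>z g\<close>
  before the blowup. Hence the coordinates at a point of the exceptional divisor correspond to the
  coordinates before the blowup with this tangent direction.
\<close>

lemma shift_origin_transform:
  assumes G: "ord_ge m G" and g: "fps_nth g 0 = 0"
  shows "shift g (origin_transform m G) = origin_transform m (shift (fps_X * g) G)"
proof -
  have g': "fps_nth (fps_X * g) 0 = 0" by simp
  have emb: "emb (fps_X * g) = z_var * emb g"
    by (rule mcoeff_eqI) (auto simp: mcoeff_emb mcoeff_z_mult)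
  note o = ord_ge_shift_var[OF g] and o' = ord_ge_shift_var[OF g']
  have "z_var ^ m * shift g (origin_transform m G) = shift g (z_var ^ m * origin_transform m G)"
    unfolding shift_def by (simp only: subst2_mult[OF o ord_ge_vars(2)] subst2_power[OF o ord_ge_vars(2)] subst2_z_var[OF o ord_ge_vars(2)])
  also have "\<dots> = subst2 G ((y_var + emb g) * z_var) z_var"
    unfolding z_power_origin_transform[OF G] shift_def subst2_trans[OF ord_ge_yz ord_ge_vars(2) o ord_ge_vars(2)]
      subst2_mult[OF o ord_ge_vars(2)] subst2_y_var[OF o ord_ge_vars(2)] subst2_z_var[OF o ord_ge_vars(2)] ..
  also have "(y_var + emb g) * z_var = y_var * z_var + emb (fps_X * g)"
    by (simp add: emb algebra_simps)
  also have "subst2 G (y_var * z_var + emb (fps_X * g)) z_var = subst2 (shift (fps_X * g) G) (y_var * z_var) z_var"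
    unfolding shift_def subst2_trans[OF o' ord_ge_vars(2) ord_ge_yz ord_ge_vars(2)] subst2_add
      subst2_y_var[OF ord_ge_yz ord_ge_vars(2)] subst2_z_var[OF ord_ge_yz ord_ge_vars(2)] subst2_emb_z ..
  also have "\<dots> = z_var ^ m * origin_transform m (shift (fps_X * g) G)"
    by (rule z_power_origin_transform[OF ord_ge_shift[OF g' G], symmetric])
  finally show ?thesis by simp
qed

text \<open>
  Up to a linear change, the rows of the Jacobian matrix of \<open>(Y,Z)\<close> consist of the values of
  \<open>Y'\<close> and \<open>Z'\<close> at \<open>a'\<close> and their derivatives along the exceptional divisor.
\<close>

lemma strict_transform_linear_parts:
  fixes Y Z :: "'k::field fps fps" and a' :: "'k exc_point"
  assumes lc: "local_coords Y Z"
  defines "Y' \<equiv> strict_transform 1 a' Y" and "Z' \<equiv> strict_transform 1 a' Z"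
  obtains (affine) t where "a' = Affine t" "mcoeff Y' 1 0 * mcoeff Z' 0 0 \<noteq> mcoeff Y' 0 0 * mcoeff Z' 1 0"
  | (infinite) "a' = Infinite" "mcoeff Y' 0 0 * mcoeff Z' 0 1 \<noteq> mcoeff Y' 0 1 * mcoeff Z' 0 0"
proof (cases a')
  case (Affine t)
  note YZ = local_coordsD[OF lc]
  define s where "s X = subst2 X (y_var + emb (tangent t)) z_var" for X
  have "jac (s Y) (s Z) = jac Y Z * jac (y_var + emb (tangent t)) z_var" unfolding s_def by (rule jac_subst2)
  also have "jac (y_var + emb (tangent t)) z_var = 1"
    by (simp add: jac_def mcoeff_y_var mcoeff_z_var mcoeff_emb)
  finally have "jac (s Y) (s Z) \<noteq> 0" using YZ by simp
  moreover have "mcoeff Y' 1 0 = mcoeff (s Y) 1 0" "mcoeff Z' 1 0 = mcoeff (s Z) 1 0"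
      "mcoeff Y' 0 0 = mcoeff (s Y) 0 1" "mcoeff Z' 0 0 = mcoeff (s Z) 0 1"
    by (simp_all add: Y'_def Z'_def Affine strict_transform_affine[OF YZ(1)] strict_transform_affine[OF YZ(2)]
        mcoeff_origin_transform s_def shift_def[symmetric] del: One_nat_def)
  ultimately show ?thesis using affine[OF Affine] by (simp add: jac_def)
next
  case Infinite
  note YZ = local_coordsD[OF lc]
  have "mcoeff Y' 0 0 = mcoeff Y 1 0" "mcoeff Z' 0 0 = mcoeff Z 1 0"
      "mcoeff Y' 0 1 = mcoeff Y 0 1" "mcoeff Z' 0 1 = mcoeff Z 0 1"
    by (simp_all add: Y'_def Z'_def Infinite strict_transform_infinite[OF YZ(1)] strict_transform_infinite[OF YZ(2)]
        mcoeff_infinity_transform del: One_nat_def)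
  then show ?thesis using infinite[OF Infinite] YZ(3) by (simp add: jac_def)
qed

lemma ord_ge_in_coords:
  assumes "local_coords Y Z" "ord_ge n F"
  shows "ord_ge n (in_coords F Y Z)"
proof -
  have "in_coords F Y Z = subst2 F (in_coords y_var Y Z) (in_coords z_var Y Z)"
    using in_coords_subst2_change[OF local_coords_variables assms(1), of F] by simp
  then show ?thesis
    using local_coordsD[OF local_coords_in_coords[OF local_coords_variables assms(1)]] assms(2)
    by (simp add: ord_ge_subst2)
qed

context char_p begin

text \<open>
  Let \<open>E\<close> be the equation of the exceptional divisor at \<open>a'\<close>, and \<open>Y = E Y'\<close>, \<open>Z = E Z'\<close> after
  the blowup. If \<open>Z'\<close> does not vanish at \<open>a'\<close>, then \<open>a'\<close> is the point \<open>s = Y'/Z'\<close> in the chart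
  of \<open>(Y,Z)\<close>, with coordinates \<open>(Y'/Z' - s, E Z')\<close>, and the induced flag is \<open>E\<close>, up to units. Otherwise it is the
  point at infinity, with coordinates \<open>(E Y', Z'/Y')\<close>, and the induced flag is \<open>Z'\<close>. The two
  equations of the exceptional divisor differ by the unit \<open>Z'\<close>, respectively \<open>Y'\<close>.
\<close>

lemma blowup_frame:
  assumes c: "(Y, Z) \<in> subordinate_coords h" and F: "F = subst2 G Y Z" and G: "ord_ge p G"
  obtains a'' where "frame (strict_transform p a' F) (induced_flag a' h) (strict_transform p a'' G)"
proof -
  note lc = subordinate_coordsD(1)[OF c]
  note YZ = local_coordsD[OF lc]
  define E where "E = exc_eq a'"
  define Y' Z' where "Y' = strict_transform 1 a' Y" and "Z' = strict_transform 1 a' Z"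
  obtain A B where AB: "ord_ge 1 A" "ord_ge 1 B" and pb: "\<And>G. pullback a' G = subst2 G A B"
    using pullback_ring[of a'] by blast
  have pY: "subst2 Y A B = E * Y'" and pZ: "subst2 Z A B = E * Z'"
    using strict_transform_spec[OF YZ(1), of a'] strict_transform_spec[OF YZ(2), of a']
    by (simp_all add: pb E_def Y'_def Z'_def)
  have pF: "pullback a' F = subst2 G (E * Y') (E * Z')"
    unfolding pb F subst2_trans[OF YZ(1,2) AB] pY pZ ..
  have "Z \<noteq> 0" using YZ by (auto simp: jac_def)
  then obtain w where w: "w dvd 1" "h = Z * w"
    using dvd_each_other_unit[OF subordinate_coordsD(2,3)[OF c] dvd_refl dvd_refl] by blast
  define W where "W = subst2 w A B"
  have W: "W dvd 1" using w by (simp add: W_def unit_iff)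
  have "exc_eq a' ^ 1 * (Z' * W) = pullback a' h"
    unfolding pb w(2) subst2_mult[OF AB] pZ by (simp add: E_def W_def mult.assoc)
  then have hs: "strict_transform 1 a' h = Z' * W" by (rule strict_transform_eqI)
  have flag: "induced_flag a' h = (if mcoeff Z' 0 0 = 0 then Z' * W else E)"
    using W unfolding induced_flag_def Let_def hs max_ideal_iff E_def by (auto simp: ord_ge_1_iff unit_iff)
  have E1: "ord_ge 1 E" "mcoeff E 0 0 = 0" by (cases a'; simp add: E_def ord_ge_1_iff mcoeff_y_var mcoeff_z_var)+
  have E_lin: "mcoeff (E * X) 1 0 = mcoeff E 1 0 * mcoeff X 0 0" "mcoeff (E * X) 0 1 = mcoeff E 0 1 * mcoeff X 0 0" for X
    unfolding mcoeff_mult_10 mcoeff_mult_01 using E1 by simp_all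
  have lin: "(\<exists>t. a' = Affine t \<and> mcoeff Y' 1 0 * mcoeff Z' 0 0 \<noteq> mcoeff Y' 0 0 * mcoeff Z' 1 0)
      \<or> a' = Infinite \<and> mcoeff Y' 0 0 * mcoeff Z' 0 1 \<noteq> mcoeff Y' 0 1 * mcoeff Z' 0 0"
    unfolding Y'_def Z'_def by (rule strict_transform_linear_parts[OF lc, of a']) blast+
  show ?thesis
  proof (cases "mcoeff Z' 0 0 = 0")
    case False
    then obtain V where V: "1 = Z' * V" by (auto simp flip: unit_iff elim: dvdE)
    define s where "s = mcoeff Y' 0 0 * mcoeff V 0 0"
    define P Q where "P = Y' * V - scalar s" and "Q = E * Z'"
    have V00: "mcoeff Z' 0 0 * mcoeff V 0 0 = 1" using arg_cong[OF V, of "\<lambda>X. mcoeff X 0 0"] by (simp add: mcoeff_1)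
    have V10: "mcoeff Z' 0 0 * mcoeff V 1 0 + mcoeff Z' 1 0 * mcoeff V 0 0 = 0"
      using arg_cong[OF V, of "\<lambda>X. mcoeff X 1 0"] unfolding mcoeff_mult_10 by (simp add: mcoeff_1)
    have V01: "mcoeff Z' 0 0 * mcoeff V 0 1 + mcoeff Z' 0 1 * mcoeff V 0 0 = 0"
      using arg_cong[OF V, of "\<lambda>X. mcoeff X 0 1"] unfolding mcoeff_mult_01 by (simp add: mcoeff_1)
    have P00: "mcoeff P 0 0 = 0" by (simp add: P_def s_def mcoeff_scalar)
    have P10: "mcoeff P 1 0 = mcoeff Y' 0 0 * mcoeff V 1 0 + mcoeff Y' 1 0 * mcoeff V 0 0"
      and P01: "mcoeff P 0 1 = mcoeff Y' 0 0 * mcoeff V 0 1 + mcoeff Y' 0 1 * mcoeff V 0 0"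
      unfolding P_def mcoeff_diff mcoeff_mult_10 mcoeff_mult_01 by (simp_all add: mcoeff_scalar)
    have J: "jac P Q \<noteq> 0"
      using lin
    proof (elim disjE exE conjE, goal_cases affine infinite)
      case (affine t)
      have "mcoeff E 0 1 = 1" "mcoeff E 1 0 = 0" by (simp_all add: E_def affine mcoeff_z_var)
      then have "jac P Q = mcoeff P 1 0 * mcoeff Z' 0 0" unfolding jac_def Q_def E_lin by simp
      then have "jac P Q * mcoeff Z' 0 0 = mcoeff Y' 1 0 * mcoeff Z' 0 0 - mcoeff Y' 0 0 * mcoeff Z' 1 0"
        unfolding P10 using V00 V10 by algebra
      then show ?thesis using affine by auto
    next
      case infinite
      have "mcoeff E 0 1 = 0" "mcoeff E 1 0 = 1" by (simp_all add: E_def infinite mcoeff_y_var)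
      then have "jac P Q = - mcoeff P 0 1 * mcoeff Z' 0 0" unfolding jac_def Q_def E_lin by simp
      then have "jac P Q * mcoeff Z' 0 0 = mcoeff Y' 0 0 * mcoeff Z' 0 1 - mcoeff Y' 0 1 * mcoeff Z' 0 0"
        unfolding P01 using V00 V01 by algebra
      then show ?thesis using infinite by auto
    qed
    have PQ: "ord_ge 1 P" "ord_ge 1 Q"
      using P00 E1 by (simp_all add: ord_ge_1_iff Q_def)
    then have "local_coords P Q" using J by (simp add: local_coords_iff)
    moreover have "Q dvd E" using V by (metis Q_def dvd_triv_left mult.assoc mult.right_neutral)
    ultimately have "(P, Q) \<in> subordinate_coords (induced_flag a' h)"
      using False by (simp add: subordinate_coords_def flag) (simp add: Q_def)
    moreover have "strict_transform p a' F = Z' ^ p * subst2 (strict_transform p (Affine s) G) P Q"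
    proof (rule strict_transform_eqI)
      have "P * Q + scalar s * Q = (Y' * V) * Q" by (simp add: P_def algebra_simps)
      also have "\<dots> = E * Y' * (Z' * V)" by (simp add: Q_def ac_simps)
      finally have PQs: "P * Q + scalar s * Q = E * Y'" by (simp flip: V)
      have "exc_eq a' ^ p * (Z' ^ p * subst2 (strict_transform p (Affine s) G) P Q) =
          Q ^ p * subst2 (strict_transform p (Affine s) G) P Q"
        by (simp add: Q_def E_def power_mult_distrib mult.assoc)
      also have "\<dots> = subst2 (exc_eq (Affine s) ^ p * strict_transform p (Affine s) G) P Q"
        by (simp add: subst2_mult[OF PQ] subst2_power[OF PQ] subst2_z_var[OF PQ])
      also have "\<dots> = subst2 (pullback (Affine s) G) P Q" by (simp only: strict_transform_spec[OF G])
      also have "\<dots> = subst2 G (P * Q + scalar s * Q) Q"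
      proof -
        have o: "ord_ge 1 (y_var * z_var + scalar s * z_var)"
          by (intro ord_ge_add ord_ge_mult_left ord_ge_vars)
        show ?thesis
          unfolding pullback.simps subst2_trans[OF o ord_ge_vars(2) PQ] subst2_add subst2_mult[OF PQ]
            subst2_y_var[OF PQ] subst2_z_var[OF PQ] subst2_scalar ..
      qed
      finally show "exc_eq a' ^ p * (Z' ^ p * subst2 (strict_transform p (Affine s) G) P Q) = pullback a' F"
        unfolding PQs unfolding pF Q_def .
    qed
    ultimately have "frame (strict_transform p a' F) (induced_flag a' h) (strict_transform p (Affine s) G)"
      unfolding frame_def using V by (metis dvd_triv_left)
    then show ?thesis by (rule that)
  next
    case True
    have Y00: "mcoeff Y' 0 0 \<noteq> 0"
      using lin by (auto simp: True)
    then obtain V where V: "1 = Y' * V" by (auto simp flip: unit_iff elim: dvdE)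
    have V00: "mcoeff Y' 0 0 * mcoeff V 0 0 = 1" using arg_cong[OF V, of "\<lambda>X. mcoeff X 0 0"] by (simp add: mcoeff_1)
    define P Q where "P = E * Y'" and "Q = Z' * V"
    have Q_lin: "mcoeff Q 1 0 = mcoeff Z' 1 0 * mcoeff V 0 0" "mcoeff Q 0 1 = mcoeff Z' 0 1 * mcoeff V 0 0"
      unfolding Q_def mcoeff_mult_10 mcoeff_mult_01 by (simp_all add: True)
    have J: "jac P Q \<noteq> 0"
      using lin
    proof (elim disjE exE conjE, goal_cases affine infinite)
      case (affine t)
      have "mcoeff E 0 1 = 1" "mcoeff E 1 0 = 0" by (simp_all add: E_def affine mcoeff_z_var)
      then show ?thesis using affine V00 True unfolding jac_def P_def E_lin Q_lin by auto
    next
      case infinite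
      have "mcoeff E 0 1 = 0" "mcoeff E 1 0 = 1" by (simp_all add: E_def infinite mcoeff_y_var)
      then show ?thesis using infinite V00 True unfolding jac_def P_def E_lin Q_lin by auto
    qed
    have PQ: "ord_ge 1 P" "ord_ge 1 Q"
      using True E1 by (simp_all add: ord_ge_1_iff P_def Q_def)
    then have "local_coords P Q" using J by (simp add: local_coords_iff)
    moreover have "V dvd 1" using V by (metis dvd_triv_right)
    then have "Q dvd Z' * W" "Z' * W dvd Q" using W by (auto simp: Q_def intro!: mult_dvd_mono intro: dvd_trans[OF _ one_dvd])
    ultimately have "(P, Q) \<in> subordinate_coords (induced_flag a' h)"
      using True by (simp add: subordinate_coords_def flag)
    moreover have "strict_transform p a' F = Y' ^ p * subst2 (strict_transform p Infinite G) P Q"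
    proof (rule strict_transform_eqI)
      have "P * Q = E * Z' * (Y' * V)" by (simp add: P_def Q_def ac_simps)
      then have PQs: "P * Q = E * Z'" by (simp flip: V)
      have "exc_eq a' ^ p * (Y' ^ p * subst2 (strict_transform p Infinite G) P Q) =
          P ^ p * subst2 (strict_transform p Infinite G) P Q"
        by (simp add: P_def E_def power_mult_distrib mult.assoc)
      also have "\<dots> = subst2 (exc_eq Infinite ^ p * strict_transform p Infinite G) P Q"
        by (simp only: exc_eq.simps subst2_mult[OF PQ] subst2_power[OF PQ] subst2_y_var[OF PQ])
      also have "\<dots> = subst2 (pullback Infinite G) P Q" by (simp only: strict_transform_spec[OF G])
      also have "\<dots> = subst2 G P (P * Q)"
        unfolding pullback.simps subst2_trans[OF ord_ge_vars(1) ord_ge_yz PQ] subst2_mult[OF PQ]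
          subst2_y_var[OF PQ] subst2_z_var[OF PQ] ..
      finally show "exc_eq a' ^ p * (Y' ^ p * subst2 (strict_transform p Infinite G) P Q) = pullback a' F"
        unfolding PQs unfolding pF P_def .
    qed
    ultimately have "frame (strict_transform p a' F) (induced_flag a' h) (strict_transform p Infinite G)"
      unfolding frame_def using V by (metis dvd_triv_left)
    then show ?thesis by (rule that)
  qed
qed

end

section \<open>Translating the initial form\<close>

lemma coeff_translate:
  fixes c :: "nat \<Rightarrow> 'a::field"
  shows "coeff (pcompose (\<Sum>i\<le>n. monom (c i) i) [:t, 1:]) k = (\<Sum>i\<le>n. c i * (of_nat (i choose k) * t ^ (i - k)))"
proof -
  have mono: "pcompose (monom a i) q = smult a (q ^ i)" for a :: 'a and i q
    by (induction i) (simp_all add: monom_0 monom_Suc pcompose_pCons)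
  have "coeff ([:t, 1:] ^ i) k = of_nat (i choose k) * t ^ (i - k)" for i
    by (cases "k \<le> i") (simp_all add: coeff_linear_poly_power coeff_eq_0 degree_linear_power binomial_eq_0)
  then show ?thesis unfolding pcompose_sum coeff_sum mono by simp
qed

text \<open>
  The order of \<open>Q\<close> at \<open>t \<noteq> 0\<close> is at most \<open>hi - lo\<close>, since the factor \<open>y\<^bsup>lo\<^esup>\<close> does not vanish
  there.
\<close>

lemma translate_low_coeff:
  fixes Q :: "'a::field poly"
  assumes Q: "Q \<noteq> 0" and t: "t \<noteq> 0" and range: "\<And>i. coeff Q i \<noteq> 0 \<Longrightarrow> lo \<le> i \<and> i \<le> hi"
  obtains k where "k \<le> hi - lo" "coeff (pcompose Q [:t, 1:]) k \<noteq> 0"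
proof (rule ccontr)
  assume "\<not> thesis"
  then have "\<forall>k \<le> hi - lo. coeff (pcompose Q [:t, 1:]) k = 0"
    using that by blast
  then have "monom 1 (Suc (hi - lo)) dvd pcompose Q [:t, 1:]" by (simp add: monom_1_dvd_iff')
  then obtain S where S: "pcompose Q [:t, 1:] = monom 1 (Suc (hi - lo)) * S" by (rule dvdE)
  have pow: "pcompose (monom 1 n) q = q ^ n" for n and q :: "'a poly"
    by (induction n) (simp_all add: monom_0 monom_Suc pcompose_pCons one_pCons)
  have "Q = pcompose (pcompose Q [:t, 1:]) [:-t, 1:]"
    by (simp add: pcompose_pCons flip: pcompose_assoc)
  also have "\<dots> = [:-t, 1:] ^ Suc (hi - lo) * pcompose S [:-t, 1:]"
    unfolding S pcompose_mult pow ..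
  finally have dvd: "[:-t, 1:] ^ Suc (hi - lo) dvd Q" by (metis dvd_triv_left)
  have "monom 1 lo dvd Q" using range by (force simp: monom_1_dvd_iff' not_le[symmetric])
  then obtain S' where S': "Q = monom 1 lo * S'" by (rule dvdE)
  have S'0: "S' \<noteq> 0" using Q S' by auto
  have "order t (monom 1 lo) = 0" using t by (intro order_0I) (simp add: poly_monom)
  then have "order t Q = order t S'" using Q by (simp add: S' order_mult)
  also have "\<dots> \<le> degree S'" by (rule order_degree[OF S'0])
  also have "\<dots> = degree Q - lo" using S'0 by (simp add: S' degree_mult_eq degree_monom_eq)
  also have "\<dots> \<le> hi - lo" using range[of "degree Q"] Q by (simp add: diff_le_mono)
  finally have "order t Q \<le> hi - lo" .
  moreover have "Suc (hi - lo) \<le> order t Q" using dvd Q unfolding order_divides by simp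
  ultimately show False by simp
qed

definition initial_order :: "'k::field fps fps \<Rightarrow> nat" where
  "initial_order F = (LEAST n. \<exists>i j. mcoeff F i j \<noteq> 0 \<and> i + j = n)"

lemma initial_order_le: "mcoeff F i j \<noteq> 0 \<Longrightarrow> initial_order F \<le> i + j"
  unfolding initial_order_def by (rule Least_le) blast

lemma ord_ge_initial_order: "ord_ge (initial_order F) F"
  using initial_order_le by (fastforce simp: ord_ge_def not_less)

lemma initial_order_attained:
  assumes "F \<noteq> 0"
  obtains i where "i \<le> initial_order F" "mcoeff F i (initial_order F - i) \<noteq> 0"
proof -
  have "\<exists>n. \<exists>i j. mcoeff F i j \<noteq> 0 \<and> i + j = n" using mcoeff_corner[OF assms] by blast
  then have "\<exists>i j. mcoeff F i j \<noteq> 0 \<and> i + j = initial_order F" unfolding initial_order_def by (rule LeastI_ex)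
  then show ?thesis using that by (metis add_diff_cancel_left' le_add1)
qed

lemma initial_order_ge: "F \<noteq> 0 \<Longrightarrow> ord_ge n F \<Longrightarrow> n \<le> initial_order F"
  by (metis initial_order_attained le_add_diff_inverse not_le ord_geD)

lemma mcoeff_shift_tangent_initial:
  assumes "ord_ge n F" "k \<le> n"
  shows "mcoeff (shift (tangent t) F) k (n - k) =
    coeff (pcompose (\<Sum>i\<le>n. monom (mcoeff F i (n - i)) i) [:t, 1:]) k"
proof -
  have tan: "fps_nth (tangent t ^ l) m = (if m = l then t ^ l else 0)" for l m
    by (simp add: tangent_def power_mult_distrib fps_const_power fps_X_power_nth)
  have "mcoeff (shift (tangent t) F) k (n - k) =
      (\<Sum>(i, j)\<in>(\<lambda>i. (i, n - i)) ` {..n}. mcoeff F i j *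
        (if k \<le> i \<and> j \<le> n - k then of_nat (i choose k) * fps_nth (tangent t ^ (i - k)) (n - k - j) else 0))"
    unfolding mcoeff_shift
  proof (rule sum.mono_neutral_right, rule finite_triangle)
    show "(\<lambda>i. (i, n - i)) ` {..n} \<subseteq> {(i, j). i + j \<le> k + (n - k)}" using assms(2) by auto
    show "\<forall>x\<in>{(i, j). i + j \<le> k + (n - k)} - (\<lambda>i. (i, n - i)) ` {..n}. (case x of (i, j) \<Rightarrow> mcoeff F i j *
        (if k \<le> i \<and> j \<le> n - k then of_nat (i choose k) * fps_nth (tangent t ^ (i - k)) (n - k - j) else 0)) = 0"
    proof safe
      fix i j assume ij: "i + j \<le> k + (n - k)" "(i, j) \<notin> (\<lambda>i. (i, n - i)) ` {..n}"
      have "i + j \<noteq> n"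
      proof
        assume "i + j = n"
        then have "(i, j) = (\<lambda>i. (i, n - i)) i" "i \<in> {..n}" by auto
        then show False using ij(2) by blast
      qed
      then have "mcoeff F i j = 0" using ij(1) assms by (intro ord_geD[OF assms(1)]) simp
      then show "mcoeff F i j * (if k \<le> i \<and> j \<le> n - k
          then of_nat (i choose k) * fps_nth (tangent t ^ (i - k)) (n - k - j) else 0) = 0" by simp
    qed
  qed
  also have "\<dots> = (\<Sum>i\<le>n. mcoeff F i (n - i) * (of_nat (i choose k) * t ^ (i - k)))"
    by (subst sum.reindex) (auto simp: inj_on_def tan binomial_eq_0 not_le intro!: sum.cong)
  finally show ?thesis unfolding coeff_translate .
qed

text \<open>
  The initial form with \<open>z = 1\<close>.
\<close>

definition initial_poly :: "'k::field fps fps \<Rightarrow> 'k poly" where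
  "initial_poly F = (\<Sum>i\<le>initial_order F. monom (mcoeff F i (initial_order F - i)) i)"

lemma coeff_initial_poly:
  "coeff (initial_poly F) i = (if i \<le> initial_order F then mcoeff F i (initial_order F - i) else 0)"
  unfolding initial_poly_def coeff_sum by (simp add: coeff_monom)

lemma initial_poly_nonzero: "F \<noteq> 0 \<Longrightarrow> initial_poly F \<noteq> 0"
  by (metis initial_order_attained coeff_initial_poly coeff_0)

lemma dvd_add_self_diff_iff:
  fixes a b q :: nat
  assumes "q dvd a" "a \<le> b + q"
  shows "q dvd b + q - a \<longleftrightarrow> q dvd b"
proof -
  obtain c where c: "b + q = a + c" using assms(2) le_Suc_ex by blast
  have "q dvd b \<longleftrightarrow> q dvd a + c" by (simp flip: c)
  then show ?thesis using assms(1) c by (simp add: dvd_add_right_iff)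
qed

context char_p begin

lemma initial_poly_translate:
  assumes F: "F \<noteq> 0" and k: "coeff (pcompose (initial_poly F) [:t, 1:]) k \<noteq> 0"
    and kp: "\<not> (p dvd k \<and> p dvd initial_order F)"
  shows "k \<le> initial_order F" "mcoeff (red (shift (tangent t) F)) k (initial_order F - k) \<noteq> 0"
proof -
  have "degree (pcompose (initial_poly F) [:t, 1:]) \<le> initial_order F"
    using initial_poly_nonzero[OF F] coeff_initial_poly[of F "degree (initial_poly F)"]
    by (simp add: degree_pcompose) (metis leading_coeff_0_iff)
  then show kn: "k \<le> initial_order F" using le_degree[OF k] by simp
  then have "\<not> (p dvd k \<and> p dvd initial_order F - k)"
    using kp dvd_add[of p k "initial_order F - k"] by auto
  then show "mcoeff (red (shift (tangent t) F)) k (initial_order F - k) \<noteq> 0"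
    using k mcoeff_shift_tangent_initial[OF ord_ge_initial_order kn, of t]
    by (simp add: initial_poly_def mcoeff_red)
qed

text \<open>
  If \<open>p\<close> divides the order, it does not divide the \<open>y\<close>-exponents in the initial form, because
  these terms would have been deleted.
\<close>

lemma pderiv_initial_poly_nonzero:
  assumes F: "F \<noteq> 0" "red F = F" and dvd: "p dvd initial_order F"
  shows "pderiv (initial_poly F) \<noteq> 0"
proof -
  obtain i where i: "i \<le> initial_order F" "mcoeff F i (initial_order F - i) \<noteq> 0"
    by (rule initial_order_attained[OF F(1)])
  have "\<not> p dvd i"
  proof
    assume "p dvd i"
    then have "p dvd initial_order F - i" using dvd by (simp add: dvd_diff_nat)
    then have "mcoeff (red F) i (initial_order F - i) = 0" using \<open>p dvd i\<close> by (simp add: mcoeff_red)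
    then show False using i(2) F(2) by simp
  qed
  then have i0: "of_nat i \<noteq> (0 :: 'k)"
    using of_nat_eq_0_iff_char_dvd[where ?'a = 'k, of i] CHAR_eq by simp
  then obtain l where l: "i = Suc l" by (cases i) auto
  have "coeff (pderiv (initial_poly F)) l = of_nat i * mcoeff F i (initial_order F - i)"
    using i(1) unfolding coeff_pderiv coeff_initial_poly l by simp
  then show ?thesis using i(2) i0 by (metis coeff_0 mult_eq_0_iff)
qed

lemma pderiv_translate: "pderiv (pcompose Q [:t, 1:]) = pcompose (pderiv Q) [:t, 1 :: 'k:]"
  by (simp add: pderiv_pcompose pderiv_pCons)

lemma coeff_translate_Suc:
  assumes "coeff (pcompose (pderiv Q) [:t, 1 :: 'k:]) k \<noteq> 0"
  shows "coeff (pcompose Q [:t, 1:]) (Suc k) \<noteq> 0" "\<not> p dvd Suc k"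
proof -
  have "of_nat (Suc k) * coeff (pcompose Q [:t, 1:]) (Suc k) \<noteq> 0"
    using assms unfolding pderiv_translate[symmetric] coeff_pderiv .
  then show "coeff (pcompose Q [:t, 1:]) (Suc k) \<noteq> 0" "\<not> p dvd Suc k"
    using of_nat_eq_0_iff_char_dvd[where ?'a = 'k, of "Suc k"] CHAR_eq by auto
qed

text \<open>
  Let \<open>n\<close> be the order. If \<open>p\<close> does not divide \<open>n\<close>, no monomial of degree \<open>n\<close> is a \<open>p\<close>-th
  power, and \<open>k\<close> can be the order of the initial polynomial at \<open>t\<close>. Otherwise only the exponents \<open>k\<close>
  that are not divisible by \<open>p\<close> remain. The derivative has nonzero coefficients precisely at the
  predecessors of such exponents; so \<open>k - 1\<close> can be its order at \<open>t\<close>, which causes the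
  increase by one.
\<close>

lemma translated_initial_form:
  assumes F: "F \<noteq> 0" "red F = F" and t: "t \<noteq> 0"
    and range: "\<And>i j. mcoeff F i j \<noteq> 0 \<Longrightarrow> i + j = initial_order F \<Longrightarrow> lo \<le> i \<and> i \<le> hi"
  obtains k where "k \<le> initial_order F" "k \<le> Suc (hi - lo)" "p dvd initial_order F \<or> k \<le> hi - lo"
    "mcoeff (red (shift (tangent t) F)) k (initial_order F - k) \<noteq> 0"
proof -
  have rangeQ: "lo \<le> i \<and> i \<le> hi" if "coeff (initial_poly F) i \<noteq> 0" for i
    using that range[of i "initial_order F - i"] by (auto simp: coeff_initial_poly split: if_splits)
  show ?thesis
  proof (cases "p dvd initial_order F")
    case False
    obtain k where k: "k \<le> hi - lo" "coeff (pcompose (initial_poly F) [:t, 1:]) k \<noteq> 0"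
      using translate_low_coeff[OF initial_poly_nonzero[OF F(1)] t rangeQ] by metis
    then show ?thesis using that[of k] initial_poly_translate[OF F(1) k(2)] False by simp
  next
    case True
    have "lo - 1 \<le> i \<and> i \<le> hi - 1" if "coeff (pderiv (initial_poly F)) i \<noteq> 0" for i
      using that rangeQ[of "Suc i"] by (auto simp: coeff_pderiv)
    then obtain k where k: "k \<le> (hi - 1) - (lo - 1)" "coeff (pcompose (pderiv (initial_poly F)) [:t, 1:]) k \<noteq> 0"
      using translate_low_coeff[OF pderiv_initial_poly_nonzero[OF F True] t] by metis
    note nz = coeff_translate_Suc[OF k(2)]
    have "Suc k \<le> Suc (hi - lo)" using k(1) by simp
    then show ?thesis using that[of "Suc k"] True initial_poly_translate[OF F(1) nz(1)] nz(2) by simp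
  qed
qed

text \<open>
  At a point \<open>t\<close> that is not a zero of the initial polynomial the constant term remains, unless
  \<open>p\<close> divides the order. In this case the linear term remains if the derivative does not vanish at
  \<open>t\<close>.
\<close>

lemma generic_translated_initial_form:
  assumes F: "F \<noteq> 0" "red F = F"
  obtains T where "finite T"
    "\<And>t. t \<notin> T \<Longrightarrow> \<exists>k. k \<le> initial_order F \<and> k \<le> 1 \<and> mcoeff (red (shift (tangent t) F)) k (initial_order F - k) \<noteq> 0"
proof (cases "p dvd initial_order F")
  case False
  show ?thesis
  proof (rule that)
    show "finite {t. poly (initial_poly F) t = 0}" by (rule poly_roots_finite[OF initial_poly_nonzero[OF F(1)]])
    fix t assume "t \<notin> {t. poly (initial_poly F) t = 0}"
    then have "coeff (pcompose (initial_poly F) [:t, 1:]) 0 \<noteq> 0" by simp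
    from initial_poly_translate[OF F(1) this] False
    show "\<exists>k. k \<le> initial_order F \<and> k \<le> 1 \<and> mcoeff (red (shift (tangent t) F)) k (initial_order F - k) \<noteq> 0"
      by auto
  qed
next
  case True
  show ?thesis
  proof (rule that)
    show "finite {t. poly (pderiv (initial_poly F)) t = 0}"
      by (rule poly_roots_finite[OF pderiv_initial_poly_nonzero[OF F True]])
    fix t assume "t \<notin> {t. poly (pderiv (initial_poly F)) t = 0}"
    then have "coeff (pcompose (pderiv (initial_poly F)) [:t, 1:]) 0 \<noteq> 0" by simp
    note nz = coeff_translate_Suc[OF this]
    show "\<exists>k. k \<le> initial_order F \<and> k \<le> 1 \<and> mcoeff (red (shift (tangent t) F)) k (initial_order F - k) \<noteq> 0"
      using initial_poly_translate[OF F(1) nz(1)] nz(2) by (intro exI[of _ "Suc 0"]) simp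
  qed
qed

section \<open>The effect of a blowup on the measures\<close>

text \<open>
  Modulo \<open>p\<close>, the exponents \<open>(a, a + b - p)\<close> and \<open>(a, b)\<close> generate the same subgroup, so
  \<open>p\<close>-th powers correspond to each other.
\<close>

lemma red_origin_transform: "red (origin_transform p G) = origin_transform p (red G)"
proof (rule mcoeff_eqI)
  fix a b
  show "mcoeff (red (origin_transform p G)) a b = mcoeff (origin_transform p (red G)) a b"
    using dvd_add_self_diff_iff[of p a b]
    by (cases "a \<le> b + p"; cases "p dvd a") (simp_all add: mcoeff_red mcoeff_origin_transform)
qed

lemma red_infinity_transform: "red (infinity_transform p G) = infinity_transform p (red G)"
proof (rule mcoeff_eqI)
  fix a b
  show "mcoeff (red (infinity_transform p G)) a b = mcoeff (infinity_transform p (red G)) a b"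
    using dvd_add_self_diff_iff[of p b a]
    by (cases "b \<le> a + p"; cases "p dvd b") (simp_all add: mcoeff_red mcoeff_infinity_transform)
qed

end

lemma origin_transform_supp:
  assumes "mcoeff (origin_transform m F) a b \<noteq> 0"
  shows "a \<le> b + m" "mcoeff F a (b + m - a) \<noteq> 0"
  using assms by (auto simp: mcoeff_origin_transform split: if_splits)

lemma origin_transform_coeff:
  "m \<le> a + b \<Longrightarrow> mcoeff (origin_transform m F) a (a + b - m) = mcoeff F a b"
  by (simp add: mcoeff_origin_transform)

lemma infinity_transform_supp:
  assumes "mcoeff (infinity_transform m F) a b \<noteq> 0"
  shows "b \<le> a + m" "mcoeff F (a + m - b) b \<noteq> 0"
  using assms by (auto simp: mcoeff_infinity_transform split: if_splits)

lemma infinity_transform_coeff: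
  "m \<le> a + b \<Longrightarrow> mcoeff (infinity_transform m F) (a + b - m) b = mcoeff F a b"
  by (simp add: mcoeff_infinity_transform)

lemma ord_ge_supp: "ord_ge n F \<Longrightarrow> mcoeff F a b \<noteq> 0 \<Longrightarrow> n \<le> a + b"
  using ord_geD not_less by blast

lemma origin_transform_nonzero:
  assumes "F \<noteq> 0" "ord_ge m F"
  shows "origin_transform m F \<noteq> 0"
  using origin_transform_coeff[OF ord_ge_supp[OF assms(2) mcoeff_corner[OF assms(1)]], of F] mcoeff_corner[OF assms(1)]
  by (metis mcoeff_0)

lemma infinity_transform_nonzero:
  assumes "F \<noteq> 0" "ord_ge m F"
  shows "infinity_transform m F \<noteq> 0"
  using infinity_transform_coeff[OF ord_ge_supp[OF assms(2) mcoeff_corner[OF assms(1)]], of F] mcoeff_corner[OF assms(1)]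
  by (metis mcoeff_0)

lemma ymin_origin_transform:
  assumes "F \<noteq> 0" "ord_ge m F"
  shows "ymin (origin_transform m F) = ymin F"
proof (rule ymin_eqI)
  show "mcoeff (origin_transform m F) (ymin F) (ymin F + ztop F - m) \<noteq> 0"
    using origin_transform_coeff[OF ord_ge_supp[OF assms(2) mcoeff_top[OF assms(1)]], of F] mcoeff_top[OF assms(1)]
    by simp
qed (auto dest: origin_transform_supp intro: ymin_le)

lemma origin_transform_corner:
  assumes n: "ord_ge n F" and m: "m \<le> n" and k: "k \<le> n" "mcoeff F k (n - k) \<noteq> 0"
  shows "zmin (origin_transform m F) = n - m" "ycorner (origin_transform m F) \<le> k"
proof -
  have nz: "mcoeff (origin_transform m F) k (n - m) \<noteq> 0"
    using origin_transform_coeff[of m k "n - k" F] m k by simp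
  show z: "zmin (origin_transform m F) = n - m"
  proof (rule zmin_eqI[OF nz])
    fix i j assume ij: "mcoeff (origin_transform m F) i j \<noteq> 0"
    show "n - m \<le> j" using ord_ge_supp[OF n origin_transform_supp(2)[OF ij]] origin_transform_supp(1)[OF ij] by simp
  qed
  show "ycorner (origin_transform m F) \<le> k" using nz by (intro ycorner_le) (simp add: z)
qed

lemma infinity_transform_measures:
  assumes F: "F \<noteq> 0" and m: "ord_ge m F"
  shows "zmin (infinity_transform m F) = zmin F"
    "ycorner (infinity_transform m F) = ycorner F + zmin F - m"
    "initial_order F - m \<le> ymin (infinity_transform m F)"
proof -
  have nz: "mcoeff (infinity_transform m F) (ycorner F + zmin F - m) (zmin F) \<noteq> 0"
    using infinity_transform_coeff[OF ord_ge_supp[OF m mcoeff_corner[OF F]], of F] mcoeff_corner[OF F] by simp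
  have ge: "zmin F \<le> j" if "mcoeff (infinity_transform m F) i j \<noteq> 0" for i j
    using infinity_transform_supp(2)[OF that] by (rule zmin_le)
  show "zmin (infinity_transform m F) = zmin F" using nz ge by (rule zmin_eqI)
  show "ycorner (infinity_transform m F) = ycorner F + zmin F - m"
    using nz ge
  proof (rule ycorner_eqI)
    fix i assume i: "mcoeff (infinity_transform m F) i (zmin F) \<noteq> 0"
    show "ycorner F + zmin F - m \<le> i"
      using ycorner_le[OF infinity_transform_supp(2)[OF i]] infinity_transform_supp(1)[OF i] by simp
  qed
  show "initial_order F - m \<le> ymin (infinity_transform m F)"
  proof -
    have *: "mcoeff (infinity_transform m F) (ymin (infinity_transform m F)) (ztop (infinity_transform m F)) \<noteq> 0"
      by (rule mcoeff_top[OF infinity_transform_nonzero[OF F m]])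
    show ?thesis using initial_order_le[OF infinity_transform_supp(2)[OF *]] infinity_transform_supp(1)[OF *] by simp
  qed
qed

lemma ycorner_origin_transform_le:
  assumes F: "F \<noteq> 0" and m: "ord_ge m F"
  shows "ycorner (origin_transform m F) \<le> ycorner F"
proof -
  obtain i where i: "i \<le> initial_order F" "mcoeff F i (initial_order F - i) \<noteq> 0"
    by (rule initial_order_attained[OF F])
  have "ycorner (origin_transform m F) \<le> i"
    by (rule origin_transform_corner(2)[OF ord_ge_initial_order initial_order_ge[OF F m] i])
  also have "i \<le> ycorner F"
    using initial_order_le[OF mcoeff_corner[OF F]] zmin_le[OF i(2)] i(1) by simp
  finally show ?thesis .
qed

text \<open>
  If the corner keeps its \<open>y\<close>-exponent, it is a term of the initial form. The map
  \<open>(a,b) \<mapsto> (a, a + b - m)\<close> then lowers every edge ratio by one.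
\<close>

lemma slope_origin_transform:
  assumes F: "F \<noteq> 0" and m: "ord_ge m F" and lt: "ymin F < ycorner F"
    and eq: "ycorner (origin_transform m F) = ycorner F"
  obtains s where "slope F = ereal s" "slope (origin_transform m F) = ereal (s - real (ycorner F))"
    "real (ycorner F) \<le> s"
proof -
  define F' where "F' = origin_transform m F"
  define D d where "D = ycorner F" and "d = zmin F"
  have F': "F' \<noteq> 0" unfolding F'_def by (rule origin_transform_nonzero[OF F m])
  have D': "ycorner F' = D" using eq by (simp add: F'_def D_def)
  obtain i where i: "i \<le> initial_order F" "mcoeff F i (initial_order F - i) \<noteq> 0"
    by (rule initial_order_attained[OF F])
  have z: "zmin F' = initial_order F - m" and yi: "D \<le> i"
    using origin_transform_corner[OF ord_ge_initial_order initial_order_ge[OF F m] i] eq by (simp_all add: F'_def D_def)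
  have mn: "m \<le> initial_order F" by (rule initial_order_ge[OF F m])
  have n: "initial_order F = D + d"
    using initial_order_le[OF mcoeff_corner[OF F]] zmin_le[OF i(2)] i(1) yi by (simp add: D_def d_def)
  have z': "zmin F' = D + d - m" using z n by simp
  have ratio: "edge_ratio F' a b' = edge_ratio F a b - 1"
    if "a < D" "m \<le> a + b" "b' = a + b - m" for a b b'
  proof -
    have "real b' - real (zmin F') = (real b - real d) - (real D - real a)"
      using that mn n by (simp add: z' of_nat_diff)
    then show ?thesis using that(1) unfolding edge_ratio_def D' by (simp add: D_def[symmetric] d_def[symmetric] diff_divide_distrib)
  qed
  obtain a b where ab: "mcoeff F a b \<noteq> 0" "a < D"
    and min: "\<And>i j. mcoeff F i j \<noteq> 0 \<Longrightarrow> i < ycorner F \<Longrightarrow> edge_ratio F a b \<le> edge_ratio F i j"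
    using edge_exists[OF F lt] unfolding D_def by metis
  have mab: "m \<le> a + b" by (rule ord_ge_supp[OF m ab(1)])
  have "slope F = ereal (real D * edge_ratio F a b)"
    using slope_eqI[OF ab(1) _ min] ab(2) by (simp add: D_def)
  moreover have "slope F' = ereal (real (ycorner F') * edge_ratio F' a (a + b - m))"
  proof (rule slope_eqI)
    show "mcoeff F' a (a + b - m) \<noteq> 0" using origin_transform_coeff[OF mab, of F] ab(1) by (simp add: F'_def)
    show "a < ycorner F'" using ab(2) by (simp add: D')
    fix i j assume ij: "mcoeff F' i j \<noteq> 0" "i < ycorner F'"
    note s = origin_transform_supp[OF ij(1)[unfolded F'_def]]
    have "edge_ratio F' i j = edge_ratio F i (j + m - i) - 1" using ij(2) s by (intro ratio) (auto simp: D')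
    moreover have "edge_ratio F' a (a + b - m) = edge_ratio F a b - 1" using ab mab by (intro ratio) auto
    ultimately show "edge_ratio F' a (a + b - m) \<le> edge_ratio F' i j"
      using min[OF s(2)] ij(2) by (simp add: D' D_def)
  qed
  moreover have r: "edge_ratio F' a (a + b - m) = edge_ratio F a b - 1" using ab mab by (intro ratio) auto
  moreover have "1 \<le> edge_ratio F a b"
  proof -
    have "D + d \<le> a + b" using initial_order_le[OF ab(1)] n by simp
    then have "real D - real a \<le> real b - real d" by linarith
    then show ?thesis using ab(2) by (simp add: edge_ratio_def D_def[symmetric] d_def[symmetric] le_divide_eq)
  qed
  then have "real D * 1 \<le> real D * edge_ratio F a b" by (intro mult_left_mono) auto
  ultimately show ?thesis using that[of "real D * edge_ratio F a b"]
    by (simp add: F'_def D'[unfolded F'_def] D_def[symmetric] right_diff_distrib)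
qed

section \<open>Descent of the adjusted height vector\<close>

text \<open>
  The intricacies of height \<open>m + 1\<close> in the adjacent case and of height \<open>m\<close> in the close and
  distant cases are \<open>m - \<delta> < m - \<epsilon> < m\<close>; they get the ranks \<open>3 m + 3\<close>, \<open>3 m + 4\<close>, \<open>3 m + 5\<close>.
\<close>

definition rank :: "nat \<Rightarrow> nat \<Rightarrow> nat" where
  "rank n e = (if e = 0 then 3 * n else if e = 1 then 3 * n + 4 else 3 * n + 5)"

lemma rank_less_imp_intricacy_less:
  fixes \<epsilon> \<delta> :: real
  assumes "0 < \<epsilon>" "\<epsilon> < \<delta>" "\<delta> < 1" and "rank n e < rank n' e'"
  shows "real n - (if e = 0 then 1 + \<delta> else if e = 1 then \<epsilon> else 0)
    < real n' - (if e' = 0 then 1 + \<delta> else if e' = 1 then \<epsilon> else 0)"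
proof -
  have step2: "n < n' \<or> n = n' \<or> n = Suc n' \<or> n > Suc n'" by linarith
  then show ?thesis
  proof (elim disjE)
    assume lt: "n < n'"
    then have r: "real n + 1 \<le> real n'" by linarith
    show ?thesis
    proof (cases "n' = Suc n")
      case True
      then show ?thesis using assms by (auto simp: rank_def split: if_splits)
    next
      case False
      then have "real n + 2 \<le> real n'" using lt by linarith
      then show ?thesis using assms(1-3) by auto
    qed
  qed (use assms in \<open>auto simp: rank_def split: if_splits\<close>)
qed

lemma rank_eq_imp:
  assumes "rank n e = rank n' e'"
  shows "n = n'" "e = 0 \<longleftrightarrow> e' = 0" "e = 1 \<longleftrightarrow> e' = 1"
  using assms by (auto simp: rank_def split: if_splits) presburger+

context char_p begin

definition height_rank :: "'k fps fps \<Rightarrow> nat" where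
  "height_rank G = rank (ycorner (red G) - ymin (red G)) (ymin (red G))"

definition optimal :: "'k fps fps \<Rightarrow> bool" where
  "optimal G \<longleftrightarrow> maximal_ymin G \<and> (ymin (red G) < ycorner (red G) \<longrightarrow> maximal_slope G)"

lemma optimal_exists:
  assumes G: "red G \<noteq> 0"
  obtains g where "fps_nth g 0 = 0" "optimal (shift g G)"
proof -
  obtain g where g: "fps_nth g 0 = 0" "maximal_ymin (shift g G)" by (rule maximal_ymin_exists[OF G])
  have nz: "red (shift g G) \<noteq> 0" using G g by (simp add: red_shift_eq_0_iff)
  show ?thesis
  proof (cases "ymin (red (shift g G)) < ycorner (red (shift g G))")
    case True
    obtain f where f: "fps_nth f 0 = 0" "maximal_ymin (shift f (shift g G))" "maximal_slope (shift f (shift g G))"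
      by (rule maximal_slope_exists[OF nz g(2) True])
    then show ?thesis using that[of "f + g"] g by (simp add: optimal_def shift_shift)
  next
    case False
    then show ?thesis using that[OF g(1)] g by (simp add: optimal_def)
  qed
qed

lemma optimal_ycorner_ge_2:
  assumes "red G \<noteq> 0" "optimal G" "ymin (red G) < ycorner (red G)"
  shows "2 \<le> ycorner (red G)"
proof (rule ccontr)
  assume "\<not> 2 \<le> ycorner (red G)"
  then have "ycorner (red G) \<le> 1" by simp
  then obtain g where "fps_nth g 0 = 0" "ymin (red (shift g G)) = ycorner (red G)"
    using ycorner_le_1_imp_monomial[OF assms(1)] by metis
  then show False using assms by (metis maximal_ymin_def not_le optimal_def)
qed

lemma red_strict_transform_nonzero:
  assumes "red G \<noteq> 0" "ord_ge p G"
  shows "red (strict_transform p a' G) \<noteq> 0"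
proof (cases a')
  case (Affine t)
  have "fps_nth (tangent t) 0 = 0" by (simp add: tangent_nth)
  then show ?thesis
    using assms by (simp add: Affine strict_transform_affine red_origin_transform origin_transform_nonzero
        red_shift_eq_0_iff ord_ge_red ord_ge_shift)
next
  case Infinite
  then show ?thesis
    using assms by (simp add: strict_transform_infinite red_infinity_transform infinity_transform_nonzero ord_ge_red)
qed

text \<open>
  The new corner has \<open>y\<close>-exponent \<open>D + d - p\<close>, and all terms have \<open>y\<close>-exponent at least
  \<open>n - p\<close>. So the new height is at most \<open>D + d - n\<close>, where \<open>n \<ge> d + e + 1\<close>, since otherwise
  \<open>(e,d)\<close> would be in the support and the height would be zero. If \<open>e = 0\<close>, the bonus may be lost,
  so a drop by two is needed. The only obstacle is \<open>n = d + 1\<close>; then \<open>(0, d + 1)\<close> is in the support,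
  and \<open>G\<close> is a quasi-monomial.
\<close>

lemma infinite_rank_decreases:
  assumes G: "red G \<noteq> 0" "ord_ge p G" "optimal G" and lt: "ymin (red G) < ycorner (red G)"
    and nq: "\<not> (ymin (red G) = 0 \<and> ztop (red G) = Suc (zmin (red G)))"
    and g: "fps_nth g 0 = 0" and max: "maximal_ymin (shift g (strict_transform p Infinite G))"
  shows "height_rank (shift g (strict_transform p Infinite G)) < height_rank G"
proof -
  define R where "R = red G"
  define G' where "G' = strict_transform p Infinite G"
  define D d e n where "D = ycorner R" and "d = zmin R" and "e = ymin R" and "n = initial_order R"
  have R: "R \<noteq> 0" "ord_ge p R" using G by (simp_all add: R_def ord_ge_red)
  have G': "red G' = infinity_transform p R" "red G' \<noteq> 0"
    using red_strict_transform_nonzero[OF G(1,2), of Infinite]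
    by (simp_all add: G'_def R_def strict_transform_infinite[OF G(2)] red_infinity_transform)
  have H: "red (shift g G') \<noteq> 0" "ycorner (red (shift g G')) = D + d - p"
    using shift_corner[OF g G'(2)] infinity_transform_measures(2)[OF R] G' g
    by (simp_all add: red_shift_eq_0_iff D_def d_def)
  have "fps_nth (- g) 0 = 0" using g by simp
  then have "ymin (red G') \<le> ymin (red (shift g G'))"
    using max[folded G'_def] shift_shift[of "- g" g G'] g unfolding maximal_ymin_def by fastforce
  then have e': "n - p \<le> ymin (red (shift g G'))"
    using infinity_transform_measures(3)[OF R] G' by (simp add: n_def)
  have pn: "p \<le> n" using initial_order_ge[OF R] by (simp add: n_def)
  obtain i where i: "i \<le> n" "mcoeff R i (n - i) \<noteq> 0"
    unfolding n_def by (rule initial_order_attained[OF R(1)])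
  have di: "d \<le> n - i" "e \<le> i" using zmin_le[OF i(2)] ymin_le[OF i(2)] by (simp_all add: d_def e_def)
  have eD: "e < D" using lt by (simp add: e_def D_def R_def)
  have D2: "2 \<le> D" using optimal_ycorner_ge_2[OF G(1,3) lt] by (simp add: D_def R_def)
  have row: "D \<le> i" if "n - i = d" using ycorner_le[of R i] i(2) that by (simp add: D_def d_def)
  have n1: "d + e + 1 \<le> n" using di row eD i(1) by (cases "n - i = d") auto
  have n2: "d + 2 \<le> n" if "e = 0"
  proof (rule ccontr)
    assume "\<not> d + 2 \<le> n"
    then have n: "n = d + 1" using n1 that by simp
    have "n - i \<noteq> d" using row D2 n i(1) by auto
    then have "i = 0" "n - i = Suc d" using di n by auto
    then have "mcoeff R 0 (Suc d) \<noteq> 0" using i by simp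
    then have "ztop R \<le> Suc d" using ztop_le[of R "Suc d"] that by (simp add: e_def)
    moreover have "ztop R \<noteq> d"
    proof
      assume "ztop R = d"
      then have "mcoeff R 0 d \<noteq> 0" using mcoeff_top[OF R(1)] that by (simp add: e_def)
      then show False using ycorner_le[of R 0] D2 by (simp add: D_def d_def)
    qed
    moreover have "d \<le> ztop R" using mcoeff_top[OF R(1)] zmin_le by (simp add: d_def)
    ultimately show False using nq that by (simp add: R_def[symmetric] e_def d_def)
  qed
  have ht: "ycorner (red (shift g G')) - ymin (red (shift g G')) \<le> D + d - n"
    using e' H pn by simp
  show ?thesis
  proof (cases "e = 0")
    case True
    then have "ycorner (red (shift g G')) - ymin (red (shift g G')) + 2 \<le> D" using ht n2 D2 by simp
    then show ?thesis using True
      unfolding height_rank_def G'_def[symmetric] R_def[symmetric] D_def[symmetric] e_def[symmetric]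
      by (auto simp: rank_def)
  next
    case False
    then have "ycorner (red (shift g G')) - ymin (red (shift g G')) + 1 \<le> D - e" using ht n1 eD by simp
    then show ?thesis using False
      unfolding height_rank_def G'_def[symmetric] R_def[symmetric] D_def[symmetric] e_def[symmetric]
      by (auto simp: rank_def)
  qed
qed

lemma shift_strict_transform_affine:
  assumes "ord_ge p G" "fps_nth g 0 = 0"
  shows "shift g (strict_transform p (Affine t) G) = origin_transform p (shift (fps_X * g + tangent t) G)"
  using assms by (simp add: strict_transform_affine shift_origin_transform ord_ge_shift shift_shift tangent_nth)

lemma affine_ycorner_bound:
  assumes G: "red G \<noteq> 0" "ord_ge p G" and t: "t \<noteq> 0"
    and range: "\<And>i j. mcoeff (red G) i j \<noteq> 0 \<Longrightarrow> i + j = initial_order (red G) \<Longrightarrow> lo \<le> i \<and> i \<le> hi"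
  shows "ycorner (red (strict_transform p (Affine t) G)) \<le> Suc (hi - lo)"
    and "\<not> p dvd initial_order (red G) \<Longrightarrow> ycorner (red (strict_transform p (Affine t) G)) \<le> hi - lo"
    and "zmin (red (strict_transform p (Affine t) G)) = initial_order (red G) - p"
proof -
  define n where "n = initial_order (red G)"
  have t0: "fps_nth (tangent t) 0 = 0" by (simp add: tangent_nth)
  obtain k where k: "k \<le> n" "k \<le> Suc (hi - lo)" "p dvd n \<or> k \<le> hi - lo"
    "mcoeff (red (shift (tangent t) (red G))) k (n - k) \<noteq> 0"
    unfolding n_def
    by (rule translated_initial_form[OF G(1) red_red t, of lo hi]) ((rule range; assumption) | blast)+
  have "red (shift (tangent t) (red G)) = red (shift (tangent t) G)" using red_shift[OF t0] by simp
  then have nz: "mcoeff (red (shift (tangent t) G)) k (n - k) \<noteq> 0" using k(4) by simp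
  have "ord_ge n (red (shift (tangent t) (red G)))"
    unfolding n_def by (intro ord_ge_red ord_ge_shift t0 ord_ge_initial_order)
  then have ord: "ord_ge n (red (shift (tangent t) G))" using red_shift[OF t0] by simp
  have pn: "p \<le> n" unfolding n_def using G by (intro initial_order_ge ord_ge_red)
  have *: "red (strict_transform p (Affine t) G) = origin_transform p (red (shift (tangent t) G))"
    using G by (simp add: strict_transform_affine red_origin_transform)
  note corner = origin_transform_corner[OF ord pn k(1) nz]
  show "ycorner (red (strict_transform p (Affine t) G)) \<le> Suc (hi - lo)"
    "\<not> p dvd initial_order (red G) \<Longrightarrow> ycorner (red (strict_transform p (Affine t) G)) \<le> hi - lo"
    "zmin (red (strict_transform p (Affine t) G)) = initial_order (red G) - p"
    unfolding * using corner k(2,3) by (simp_all add: n_def)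
qed

text \<open>
  At an affine point, let \<open>H\<close> be the translate of \<open>G\<close> whose origin transform is optimal. Its
  \<open>ymin\<close> does not change under the blowup. If \<open>H\<close> realizes the height before the blowup, then
  either the corner moves to the left, or the slope drops. If it does not, then \<open>e\<close> decreases, and
  \<open>affine_ycorner_bound\<close> limits the new corner; this suffices, as
  the rank with new \<open>e = 0\<close> and height \<open>D - e + 1\<close> is still smaller than the old one in the
  close and distant cases.
\<close>

lemma blowup_descent:
  assumes G: "red G \<noteq> 0" "ord_ge p G" "optimal G" and lt: "ymin (red G) < ycorner (red G)"
    and nq: "\<not> (ymin (red G) = 0 \<and> ztop (red G) = Suc (zmin (red G)))"
  obtains g where "fps_nth g 0 = 0" "optimal (shift g (strict_transform p a' G))"
    "height_rank (shift g (strict_transform p a' G)) < height_rank G"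
  | g s s' where "fps_nth g 0 = 0" "optimal (shift g (strict_transform p a' G))"
    "height_rank (shift g (strict_transform p a' G)) = height_rank G"
    "ymin (red (shift g (strict_transform p a' G))) < ycorner (red (shift g (strict_transform p a' G)))"
    "slope (red G) = ereal s" "slope (red (shift g (strict_transform p a' G))) = ereal s'" "0 \<le> s'" "s' + 1 \<le> s"
proof -
  obtain g where g: "fps_nth g 0 = 0" and opt: "optimal (shift g (strict_transform p a' G))"
    by (rule optimal_exists[OF red_strict_transform_nonzero[OF G(1,2)]])
  have max: "maximal_ymin (shift g (strict_transform p a' G))" using opt by (simp add: optimal_def)
  show ?thesis
  proof (cases a')
    case Infinite
    then show ?thesis using that(1)[OF g opt] infinite_rank_decreases[OF G lt nq g] max by simp
  next
    case (Affine t)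
    define D d e where "D = ycorner (red G)" and "d = zmin (red G)" and "e = ymin (red G)"
    define f where "f = fps_X * g + tangent t"
    have f0: "fps_nth f 0 = 0" by (simp add: f_def tangent_nth)
    define G' where "G' = shift g (strict_transform p a' G)"
    define H where "H = shift f G"
    have G'H: "G' = origin_transform p H"
      unfolding G'_def H_def Affine f_def by (rule shift_strict_transform_affine[OF G(2) g])
    have H: "red H \<noteq> 0" "ord_ge p H" "ord_ge p (red H)" "ycorner (red H) = D" "zmin (red H) = d"
      using G f0 shift_corner[OF f0 G(1)]
      by (simp_all add: H_def D_def d_def red_shift_eq_0_iff ord_ge_shift ord_ge_red)
    have redG': "red G' = origin_transform p (red H)" by (simp add: G'H red_origin_transform)
    have ymin: "ymin (red G') = ymin (red H)" unfolding redG' by (rule ymin_origin_transform[OF H(1,3)])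
    have G'0: "red G' \<noteq> 0" unfolding redG' by (rule origin_transform_nonzero[OF H(1,3)])
    have le: "ymin (red H) \<le> e" using G(3) f0 by (simp add: H_def e_def optimal_def maximal_ymin_def)
    have D': "ycorner (red G') \<le> D" unfolding redG' using ycorner_origin_transform_le[OF H(1,3)] H(4) by simp
    have eD: "e < D" using lt by (simp add: e_def D_def)
    note D'e = ymin_le_ycorner[OF G'0]
    show ?thesis
    proof (cases "ymin (red H) = e")
      case True
      show ?thesis
      proof (cases "ycorner (red G') = D")
        case False
        then have "height_rank G' < height_rank G"
          using D' True ymin D'e unfolding height_rank_def D_def[symmetric] e_def[symmetric] by (auto simp: rank_def)
        then show ?thesis using that(1)[OF g opt] by (simp add: G'_def)
      next
        case eq: True
        then have rank: "height_rank G' = height_rank G"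
          using True ymin unfolding height_rank_def D_def[symmetric] e_def[symmetric] by simp
        have lt': "ymin (red H) < ycorner (red H)" using True eD H by simp
        obtain s where s: "slope (red H) = ereal s" "slope (red G') = ereal (s - real D)" "real D \<le> s"
          using slope_origin_transform[OF H(1,3) lt'] eq unfolding redG' H(4) by metis
        obtain \<sigma> where \<sigma>: "slope (red G) = ereal \<sigma>"
          using edge_exists[OF G(1) lt] slope_eqI by metis
        have "slope (red H) \<le> slope (red G)"
          using G(3) lt True f0 unfolding optimal_def maximal_slope_def H_def e_def by blast
        then have "s \<le> \<sigma>" by (simp add: s \<sigma>)
        moreover have "1 \<le> real D" using eD by simp
        ultimately show ?thesis
          using that(2)[OF g opt, folded G'_def, OF rank _ \<sigma> s(2)] lt' s(3) ymin eq H(4) by simp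
      qed
    next
      case False
      then have e': "ymin (red G') < e" using le ymin by simp
      \<comment> \<open>For \<open>t = 0\<close> the origin transform of \<open>G\<close> itself would have \<open>ymin\<close> equal to \<open>e\<close>.\<close>
      have "t \<noteq> 0"
      proof
        assume t: "t = 0"
        then have "strict_transform p a' G = origin_transform p G"
          using strict_transform_affine[OF G(2), of 0] by (simp add: Affine tangent_def)
        then have "ymin (red (strict_transform p a' G)) = e"
          using ymin_origin_transform[OF G(1) ord_ge_red[OF G(2)]] by (simp add: red_origin_transform e_def)
        moreover have "shift (- g) G' = strict_transform p a' G" using g by (simp add: G'_def shift_shift)
        then have "ymin (red (strict_transform p a' G)) \<le> ymin (red G')"
          using max[folded G'_def] g unfolding maximal_ymin_def by (metis fps_neg_nth neg_equal_0_iff_equal)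
        ultimately show False using e' by simp
      qed
      have "ycorner (red (strict_transform p (Affine t) G)) \<le> Suc (D - e)"
      proof (rule affine_ycorner_bound(1)[OF G(1,2) \<open>t \<noteq> 0\<close>])
        fix i j assume ij: "mcoeff (red G) i j \<noteq> 0" "i + j = initial_order (red G)"
        have "i + j \<le> D + d" using ij(2) initial_order_le[OF mcoeff_corner[OF G(1)]] by (simp add: D_def d_def)
        then show "e \<le> i \<and> i \<le> D" using ymin_le[OF ij(1)] zmin_le[OF ij(1)] by (simp add: e_def d_def)
      qed
      then have "ycorner (red G') \<le> Suc (D - e)"
        using shift_corner(2)[OF g red_strict_transform_nonzero[OF G(1,2)]] by (simp add: G'_def Affine)
      then have "height_rank G' < height_rank G"
        using e' D'e unfolding height_rank_def D_def[symmetric] e_def[symmetric] by (auto simp: rank_def)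
      then show ?thesis using that(1)[OF g opt] by (simp add: G'_def)
    qed
  qed
qed

lemma frame_vector:
  assumes fr: "frame F h G" and G: "red G \<noteq> 0" "optimal G"
  shows "adjusted_height_vector \<epsilon> \<delta> p h F =
    (real (ycorner (red G) - ymin (red G)) - (if ymin (red G) = 0 then 1 + \<delta> else if ymin (red G) = 1 then \<epsilon> else 0),
     slope_at p h F)"
    and "ymin (red G) < ycorner (red G) \<Longrightarrow> slope_at p h F = slope (red G)"
  using frame_invariants[OF fr G(1)] G(2)
  by (simp_all add: adjusted_height_vector_def intricacy_at_def optimal_def)

text \<open>
  A frame with \<open>u = 1\<close>, as needed before a blowup.
\<close>

definition exact_frame :: "'k fps fps \<Rightarrow> 'k fps fps \<Rightarrow> 'k fps fps \<Rightarrow> bool" where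
  "exact_frame F h G \<longleftrightarrow> (\<exists>Y Z. (Y, Z) \<in> subordinate_coords h \<and> F = subst2 G Y Z)"

lemma exact_frame_imp_frame: "exact_frame F h G \<Longrightarrow> frame F h G"
  unfolding exact_frame_def frame_def by (metis dvd_refl mult_1 power_one)

lemma exact_frame_shift:
  assumes "exact_frame F h G" "fps_nth g 0 = 0"
  shows "exact_frame F h (shift g G)"
  using assms subordinate_shift unfolding exact_frame_def by metis

lemma exact_frame_coords:
  assumes "(Y, Z) \<in> subordinate_coords h"
  shows "exact_frame F h (in_coords F Y Z)"
  using assms subst2_in_coords[OF subordinate_coordsD(1)[OF assms]] unfolding exact_frame_def by metis

lemma red_in_coords_nonzero:
  assumes lc: "local_coords Y Z" and F: "red F \<noteq> 0"
  shows "red (in_coords F Y Z) \<noteq> 0"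
proof
  assume "red (in_coords F Y Z) = 0"
  then obtain H where "in_coords F Y Z = H ^ p" by (rule red_eq_0_imp_power_p)
  then have "F = subst2 H Y Z ^ p"
    using subst2_in_coords[OF lc, of F] local_coordsD[OF lc] by (simp add: subst2_power)
  then show False using F by simp
qed

text \<open>
  Optimal coordinates at a point that is to be blown up.
\<close>

definition presentation :: "'k fps fps \<Rightarrow> 'k fps fps \<Rightarrow> 'k fps fps \<Rightarrow> bool" where
  "presentation F h G \<longleftrightarrow> exact_frame F h G \<and> optimal G \<and> red G \<noteq> 0 \<and> ord_ge p G"

lemma presentation_exists:
  assumes c: "(Y, Z) \<in> subordinate_coords h" and F: "red F \<noteq> 0" "ord_ge p F"
  obtains g where "fps_nth g 0 = 0" "presentation F h (shift g (in_coords F Y Z))"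
proof -
  note lc = subordinate_coordsD(1)[OF c]
  note nz = red_in_coords_nonzero[OF lc F(1)]
  obtain g where g: "fps_nth g 0 = 0" "optimal (shift g (in_coords F Y Z))" by (rule optimal_exists[OF nz])
  then have "presentation F h (shift g (in_coords F Y Z))"
    unfolding presentation_def
    using exact_frame_shift[OF exact_frame_coords[OF c, of F] g(1)] nz ord_ge_shift[OF g(1) ord_ge_in_coords[OF lc F(2)]]
    by (simp add: red_shift_eq_0_iff)
  then show ?thesis using that g by blast
qed

lemma local_flag_coords: "local_flag h \<Longrightarrow> \<exists>Y Z. (Y, Z) \<in> subordinate_coords h"
  unfolding local_flag_def subordinate_coords_def by (auto intro: dvd_refl)

lemma quasi_monomial_atI:
  assumes pr: "presentation F h G" and q: "ymin (red G) = 0" "ztop (red G) = Suc (zmin (red G))"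
  shows "quasi_monomial_at p h F"
proof -
  have fr: "frame F h G" and G: "red G \<noteq> 0" "maximal_ymin G"
    using pr by (simp_all add: presentation_def exact_frame_imp_frame optimal_def)
  obtain c where c: "c \<in> subordinate_coords h" "upset (expansion p F c) = upset (red G)"
    by (rule frame_realize[OF fr])
  have nz: "expansion p F c \<noteq> 0" using c(2) G upset_eq_empty_iff by metis
  note m = upset_measures_cong[OF c(2)]
  have "c \<in> realizing_coords p h F" using c(1) m by (simp add: frame_invariants(2)[OF fr G])
  moreover have "quasi_monomial_series (expansion p F c)"
    using q m by (simp add: quasi_monomial_series_def width_def measures_eq[OF nz])
  ultimately show ?thesis by (auto simp: quasi_monomial_at_def)
qed

lemma adjusted_height_vector_decreases:
  fixes \<epsilon> \<delta> :: real
  assumes ed: "0 < \<epsilon>" "\<epsilon> < \<delta>" "\<delta> < 1"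
    and F: "red F \<noteq> 0" "ord_ge p F" and h: "local_flag h"
    and nq: "\<not> quasi_monomial_at p h F" and nm: "\<not> subordinate_monomial_at p h F"
  shows "lex_less (adjusted_height_vector \<epsilon> \<delta> p (induced_flag a' h) (strict_transform p a' F))
    (adjusted_height_vector \<epsilon> \<delta> p h F)"
proof -
  obtain Y Z where c: "(Y, Z) \<in> subordinate_coords h" using local_flag_coords[OF h] by blast
  obtain g0 where "presentation F h (shift g0 (in_coords F Y Z))" using presentation_exists[OF c F] by metis
  then obtain G where pr: "presentation F h G" by blast
  then have fr: "frame F h G" and ex: "exact_frame F h G" and G: "red G \<noteq> 0" "ord_ge p G" "optimal G"
    by (simp_all add: presentation_def exact_frame_imp_frame)
  have lt: "ymin (red G) < ycorner (red G)"
    using frame_invariants(4)[OF fr G(1)] nm G(3) ymin_le_ycorner[OF G(1)] by (simp add: optimal_def)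
  have nq': "\<not> (ymin (red G) = 0 \<and> ztop (red G) = Suc (zmin (red G)))"
    using quasi_monomial_atI[OF pr] nq by blast
  obtain Y Z where YZ: "(Y, Z) \<in> subordinate_coords h" "F = subst2 G Y Z"
    using ex by (auto simp: exact_frame_def)
  obtain a'' where fr': "frame (strict_transform p a' F) (induced_flag a' h) (strict_transform p a'' G)"
    by (rule blowup_frame[OF YZ G(2)])
  note vec = frame_vector(1)[OF fr G(1,3)]
  note G'0 = red_strict_transform_nonzero[OF G(1,2), of a'']
  show ?thesis
  proof (rule blowup_descent[OF G lt nq', of a''], goal_cases)
    case (1 g)
    have nz: "red (shift g (strict_transform p a'' G)) \<noteq> 0" using G'0 1(1) by (simp add: red_shift_eq_0_iff)
    note fr'' = frame_shift[OF fr' 1(1)]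
    show ?case
      unfolding lex_less_def vec frame_vector(1)[OF fr'' nz 1(2)] fst_conv
      using rank_less_imp_intricacy_less[OF ed 1(3)[unfolded height_rank_def]] by blast
  next
    case (2 g s s')
    have nz: "red (shift g (strict_transform p a'' G)) \<noteq> 0" using G'0 2(1) by (simp add: red_shift_eq_0_iff)
    note fr'' = frame_shift[OF fr' 2(1)]
    note eq = rank_eq_imp[OF 2(3)[unfolded height_rank_def]]
    show ?case
      unfolding lex_less_def vec frame_vector(1)[OF fr'' nz 2(2)] fst_conv snd_conv
        frame_vector(2)[OF fr G(1,3) lt] frame_vector(2)[OF fr'' nz 2(2,4)] 2(5,6) eq
      using 2(8) eq(2,3) by simp
  qed
qed

section \<open>The points left after a blowup\<close>

lemma red_scalar: "red (scalar k) = 0"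
  by (rule mcoeff_eqI) (auto simp: mcoeff_red mcoeff_scalar)

lemma expansion_minus_scalar:
  fixes F :: "'k fps fps"
  assumes "c \<in> subordinate_coords h"
  shows "expansion p (F - scalar k) c = expansion p F c"
proof -
  obtain Y Z where c: "c = (Y, Z)" by (cases c)
  note lc = subordinate_coordsD(1)[OF assms[unfolded c]]
  have "in_coords (F - scalar k) Y Z = in_coords F Y Z - scalar k"
    by (simp add: in_coords_eq_iff[OF lc] subst2_diff subst2_in_coords[OF lc])
  then show ?thesis by (simp add: expansion_def c red_diff red_scalar)
qed

lemma red_recenter: "red (recenter F) = red F"
  by (simp add: recenter_def red_diff red_scalar)

text \<open>
  The part of \<open>G(x + c)\<close> without \<open>x\<close> is \<open>F + c\<^sup>p\<close>. It has order at least \<open>p\<close> for some \<open>c\<close>,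
  so \<open>-c\<^sup>p\<close> is the constant term of \<open>F\<close>.
\<close>

lemma ord_ge_recenter:
  assumes "\<not> order_drops p F"
  shows "ord_ge p (recenter F)"
proof -
  obtain c where "\<not> order_at c (hypersurface_eq p F) < enat p"
    using assms by (auto simp: order_drops_def)
  then have "enat p \<le> order_at c (hypersurface_eq p F)" by simp
  also have "order_at c (hypersurface_eq p F) \<le>
      enat 0 + series_order (coeff (pcompose (hypersurface_eq p F) [:scalar c, 1:]) 0)"
    unfolding order_at_def by (rule INF_lower) simp
  also have "coeff (pcompose (hypersurface_eq p F) [:scalar c, 1:]) 0 = scalar (c ^ p) + F"
    by (simp add: hypersurface_eq_def poly_monom fps_const_power)
  finally have *: "ord_ge p (scalar (c ^ p) + F)"
    using ord_ge_iff_series_order[of p "scalar (c ^ p) + F"] by (simp add: zero_enat_def[symmetric])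
  then have "mcoeff (scalar (c ^ p) + F) 0 0 = 0" using p_pos by (intro ord_geD) auto
  then have "scalar (mcoeff F 0 0) = - scalar (c ^ p)"
    by (simp add: mcoeff_scalar eq_neg_iff_add_eq_0 add.commute)
  then have "recenter F = scalar (c ^ p) + F" by (simp add: recenter_def)
  then show ?thesis using * by simp
qed

lemma nonterminal_recenter:
  assumes "\<not> terminal p F"
  shows "\<not> monomial_at p F" "ord_ge p (recenter F)"
  using assms ord_ge_recenter by (auto simp: terminal_def)

lemma frame_self: "frame F z_var F"
proof -
  have "(y_var, z_var) \<in> subordinate_coords z_var"
    by (simp add: subordinate_coords_def local_coords_variables)
  then show ?thesis unfolding frame_def by (intro exI[of _ y_var] exI[of _ z_var] exI[of _ 1]) simp
qed

lemma frame_monomial_at_ycorner_le_1: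
  assumes fr: "frame F h G" and G: "red G \<noteq> 0" "ycorner (red G) \<le> 1"
  shows "monomial_at p F"
proof -
  obtain g where g: "fps_nth g 0 = 0" "ymin (red (shift g G)) = ycorner (red G)"
    by (rule ycorner_le_1_imp_monomial[OF G])
  show ?thesis
    using frame_monomial_at[OF frame_shift[OF fr g(1)]] g G shift_corner(2)[OF g(1) G(1)]
    by (simp add: red_shift_eq_0_iff)
qed

text \<open>
  Outside of the zeros of the initial polynomial or of its derivative, the \<open>y\<close>-exponent of the
  corner after the blowup is at most one, so that the class is a monomial there.
\<close>

lemma finite_nonterminal:
  assumes F: "red F \<noteq> 0" "ord_ge p F"
  shows "finite {a'. \<not> terminal p (strict_transform p a' F)}"
proof -
  define n where "n = initial_order (red F)"
  obtain T where T: "finite T"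
    "\<And>t. t \<notin> T \<Longrightarrow> \<exists>k. k \<le> n \<and> k \<le> 1 \<and> mcoeff (red (shift (tangent t) (red F))) k (n - k) \<noteq> 0"
    unfolding n_def using generic_translated_initial_form[OF F(1) red_red] by metis
  have "terminal p (strict_transform p (Affine t) F)" if "t \<notin> T" for t
  proof -
    have t0: "fps_nth (tangent t) 0 = 0" by (simp add: tangent_nth)
    obtain k where k: "k \<le> n" "k \<le> 1" "mcoeff (red (shift (tangent t) (red F))) k (n - k) \<noteq> 0"
      using T(2)[OF \<open>t \<notin> T\<close>] by blast
    have "ord_ge n (red (shift (tangent t) (red F)))"
      unfolding n_def by (intro ord_ge_red ord_ge_shift t0 ord_ge_initial_order)
    moreover have "p \<le> n" unfolding n_def using F by (intro initial_order_ge ord_ge_red)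
    ultimately have "ycorner (origin_transform p (red (shift (tangent t) (red F)))) \<le> k"
      using k by (intro origin_transform_corner(2))
    then have "ycorner (red (strict_transform p (Affine t) F)) \<le> 1"
      using k(2) F(2) red_shift[OF t0, of F] by (simp add: strict_transform_affine red_origin_transform)
    then show ?thesis
      unfolding terminal_def
      using frame_monomial_at_ycorner_le_1[OF frame_self red_strict_transform_nonzero[OF F]] by blast
  qed
  then have "{a'. \<not> terminal p (strict_transform p a' F)} \<subseteq> insert Infinite (Affine ` T)"
    by (auto intro: exc_point.exhaust) (metis exc_point.exhaust imageI)
  then show ?thesis using T(1) by (auto intro: finite_subset)
qed

lemma finitely_resolvedI:
  assumes "red F \<noteq> 0" "ord_ge p F"
    and "\<And>a'. \<not> terminal p (strict_transform p a' F) \<Longrightarrow> finitely_resolved p (recenter (strict_transform p a' F))"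
  shows "finitely_resolved p F"
  using finitely_resolved.blowup[OF finite_nonterminal[OF assms(1,2)]] assms(3) by blast

section \<open>Blowing up quasi-monomials\<close>

text \<open>
  The exponents of the monomials in the ideal generated by \<open>y\<^sup>a z\<^sup>d y\<^sup>k\<close> and
  \<open>y\<^sup>a z\<^sup>d z\<close>. A quasi-monomial has \<open>a = 0\<close>, and a monomial has \<open>k = 0\<close>.
\<close>

definition staircase :: "nat \<Rightarrow> nat \<Rightarrow> nat \<Rightarrow> (nat \<times> nat) set" where
  "staircase a k d = {(i, j). a + k \<le> i \<and> d \<le> j \<or> a \<le> i \<and> Suc d \<le> j}"

lemma upset_staircaseD:
  assumes up: "upset R = staircase a k d"
  shows "mcoeff R i j \<noteq> 0 \<Longrightarrow> (i, j) \<in> staircase a k d"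
    and "mcoeff R (a + k) d \<noteq> 0" and "k \<noteq> 0 \<Longrightarrow> mcoeff R a (Suc d) \<noteq> 0"
proof -
  show supp: "(i, j) \<in> staircase a k d" if "mcoeff R i j \<noteq> 0" for i j
    using mcoeff_in_upset[OF that] up by simp
  have "(a + k, d) \<in> upset R" unfolding up by (simp add: staircase_def)
  then obtain i j where ij: "mcoeff R i j \<noteq> 0" "i \<le> a + k" "j \<le> d" by (auto simp: upset_def)
  then show "mcoeff R (a + k) d \<noteq> 0" using supp[OF ij(1)] by (auto simp: staircase_def)
  assume "k \<noteq> 0"
  have "(a, Suc d) \<in> upset R" unfolding up by (simp add: staircase_def)
  then obtain i j where ij: "mcoeff R i j \<noteq> 0" "i \<le> a" "j \<le> Suc d" by (auto simp: upset_def)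
  then show "mcoeff R a (Suc d) \<noteq> 0" using supp[OF ij(1)] \<open>k \<noteq> 0\<close> by (auto simp: staircase_def le_Suc_eq)
qed

lemma upset_staircaseI:
  assumes supp: "\<And>i j. mcoeff R i j \<noteq> 0 \<Longrightarrow> (i, j) \<in> staircase a k d"
    and "mcoeff R (a + k) d \<noteq> 0" and "k \<noteq> 0 \<Longrightarrow> mcoeff R a (Suc d) \<noteq> 0"
  shows "upset R = staircase a k d"
proof (intro equalityI subrelI)
  fix i j assume "(i, j) \<in> upset R"
  then obtain i' j' where "mcoeff R i' j' \<noteq> 0" "i' \<le> i" "j' \<le> j" by (auto simp: upset_def)
  then show "(i, j) \<in> staircase a k d" using supp by (fastforce simp: staircase_def)
next
  fix i j assume ij: "(i, j) \<in> staircase a k d"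
  show "(i, j) \<in> upset R"
  proof (cases "a + k \<le> i \<and> d \<le> j")
    case True
    then show ?thesis using upset_mono[OF mcoeff_in_upset[OF assms(2)]] by blast
  next
    case False
    then have "k \<noteq> 0" "a \<le> i" "Suc d \<le> j" using ij by (auto simp: staircase_def)
    then show ?thesis using upset_mono[OF mcoeff_in_upset[OF assms(3)]] by blast
  qed
qed

text \<open>
  The point at infinity transforms \<open>y\<^sup>k + z\<close> into \<open>y (y\<^bsup>k-1\<^esup> + z)\<close>.
\<close>

lemma staircase_infinite:
  assumes G: "red G \<noteq> 0" "ord_ge p G" and up: "upset (red G) = staircase a (Suc k) d"
  shows "upset (red (strict_transform p Infinite G)) = staircase (a + Suc d - p) k d"
proof -
  note st = upset_staircaseD[OF up]
  have R: "ord_ge p (red G)" using G by (simp add: ord_ge_red)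
  have pa: "p \<le> a + Suc d" using ord_ge_supp[OF R st(3)] by simp
  have red: "red (strict_transform p Infinite G) = infinity_transform p (red G)"
    using G by (simp add: strict_transform_infinite red_infinity_transform)
  show ?thesis
    unfolding red
  proof (rule upset_staircaseI)
    fix i j assume ij: "mcoeff (infinity_transform p (red G)) i j \<noteq> 0"
    show "(i, j) \<in> staircase (a + Suc d - p) k d"
      using st(1)[OF infinity_transform_supp(2)[OF ij]] infinity_transform_supp(1)[OF ij] pa
      by (auto simp: staircase_def)
  next
    have "mcoeff (infinity_transform p (red G)) (a + Suc k + d - p) d \<noteq> 0"
      using infinity_transform_coeff[OF ord_ge_supp[OF R st(2)], of "red G"] st(2) by simp
    moreover have "a + Suc k + d - p = a + Suc d - p + k" using pa by simp
    ultimately show "mcoeff (infinity_transform p (red G)) (a + Suc d - p + k) d \<noteq> 0" by simp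
    show "mcoeff (infinity_transform p (red G)) (a + Suc d - p) (Suc d) \<noteq> 0"
      using infinity_transform_coeff[OF ord_ge_supp[OF R st(3)], of "red G"] st(3) by simp
  qed
qed

lemma staircase_measures:
  assumes "upset R = staircase a k d"
  shows "ymin R = a" "zmin R = d" "ycorner R = a + k"
proof -
  note st = upset_staircaseD[OF assms]
  have s: "a \<le> i \<and> d \<le> j \<and> (j = d \<longrightarrow> a + k \<le> i)" if "mcoeff R i j \<noteq> 0" for i j
    using st(1)[OF that] by (auto simp: staircase_def)
  show "zmin R = d" using s by (intro zmin_eqI[OF st(2)]) blast
  show "ycorner R = a + k" using s by (intro ycorner_eqI[OF st(2)]) blast+
  show "ymin R = a"
  proof (cases "k = 0")
    case True
    then have "mcoeff R a d \<noteq> 0" using st(2) by simp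
    then show ?thesis using s by (intro ymin_eqI) blast+
  next
    case False
    then show ?thesis using s by (intro ymin_eqI[OF st(3)]) blast+
  qed
qed

text \<open>
  A term of the initial form with the smallest \<open>y\<close>-exponent that occurs at all becomes the corner
  and divides all other terms.
\<close>

lemma affine_origin_monomial:
  assumes G: "red G \<noteq> 0" "ord_ge p G"
    and a: "ymin (red G) \<le> initial_order (red G)"
      "mcoeff (red G) (ymin (red G)) (initial_order (red G) - ymin (red G)) \<noteq> 0"
  shows "ymin (red (strict_transform p (Affine 0) G)) = ycorner (red (strict_transform p (Affine 0) G))"
proof -
  have R: "ord_ge p (red G)" using G by (simp add: ord_ge_red)
  have red: "red (strict_transform p (Affine 0) G) = origin_transform p (red G)"
    using G by (simp add: strict_transform_affine red_origin_transform tangent_def)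
  have "ycorner (origin_transform p (red G)) \<le> ymin (red G)"
    by (rule origin_transform_corner(2)[OF ord_ge_initial_order initial_order_ge[OF G(1) R] a])
  moreover have "ymin (origin_transform p (red G)) = ymin (red G)" by (rule ymin_origin_transform[OF G(1) R])
  ultimately show ?thesis
    unfolding red using ymin_le_ycorner[OF origin_transform_nonzero[OF G(1) R]] by simp
qed

text \<open>
  For \<open>k \<noteq> 1\<close> the initial form is a monomial. So at \<open>t = 0\<close> the transform is a monomial, and at
  \<open>t \<noteq> 0\<close> the \<open>y\<close>-exponent of its corner is at most one. For \<open>k = 1\<close> the initial form is, up to
  constants, \<open>y\<^sup>a z\<^sup>d (y + z)\<close>, and the \<open>y\<close>-exponent could be two if \<open>p\<close> divides the order
  \<open>n\<close>. In the special case considered here \<open>n + p = 2 (d + 1)\<close>, so that this forces \<open>p = 2\<close>; but then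
  the \<open>y\<close>-exponent is odd.
\<close>

lemma staircase_affine:
  assumes G: "red G \<noteq> 0" "ord_ge p G" and up: "upset (red G) = staircase a k d"
    and k: "k \<noteq> 1 \<or> a = Suc d - p \<and> p \<le> Suc d \<and> \<not> p dvd Suc d"
    and fr: "frame F h (strict_transform p (Affine t) G)"
  shows "monomial_at p F"
proof -
  note st = upset_staircaseD[OF up] and ms = staircase_measures[OF up]
  define n where "n = initial_order (red G)"
  have n_le: "n \<le> i + j" if "mcoeff (red G) i j \<noteq> 0" for i j
    unfolding n_def using that by (rule initial_order_le)
  obtain i0 where i0: "i0 \<le> n" "mcoeff (red G) i0 (n - i0) \<noteq> 0"
    unfolding n_def by (rule initial_order_attained[OF G(1)])
  have n: "n = (if k = 0 then a + d else a + Suc d)"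
    using n_le[OF st(2)] n_le[OF st(3)] st(1)[OF i0(2)] i0(1) by (auto simp: staircase_def)
  have a: "mcoeff (red G) a (n - a) \<noteq> 0" using st(2,3) n by auto
  note nz = red_strict_transform_nonzero[OF G]
  show ?thesis
  proof (cases "t = 0")
    case True
    have "ymin (red (strict_transform p (Affine 0) G)) = ycorner (red (strict_transform p (Affine 0) G))"
      using a n ms(1) by (intro affine_origin_monomial[OF G]) (auto simp: n_def)
    then show ?thesis using frame_monomial_at[OF fr nz] True by simp
  next
    case t: False
    define hi where "hi = (if k = 1 then Suc a else a)"
    have range: "a \<le> i \<and> i \<le> hi" if "mcoeff (red G) i j \<noteq> 0" "i + j = n" for i j
      using st(1)[OF that(1)] that(2) n by (auto simp: staircase_def hi_def split: if_splits)
    have bound: "ycorner (red (strict_transform p (Affine t) G)) \<le> Suc (hi - a)"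
      "\<not> p dvd n \<Longrightarrow> ycorner (red (strict_transform p (Affine t) G)) \<le> hi - a"
      "zmin (red (strict_transform p (Affine t) G)) = n - p"
      using affine_ycorner_bound[OF G t, of a hi, folded n_def] range by blast+
    have "ycorner (red (strict_transform p (Affine t) G)) \<le> 1"
    proof (cases "k = 1")
      case False
      then show ?thesis using bound(1) by (simp add: hi_def)
    next
      case True
      show ?thesis
      proof (cases "p dvd n")
        case False
        then show ?thesis using bound(2) True by (simp add: hi_def)
      next
        case dvd: True
        have "n + p = 2 * Suc d" using n k True by simp
        moreover have "p dvd n + p" using dvd by simp
        ultimately have "p dvd 2 * Suc d" by simp
        then have "p dvd 2" using k True prime_dvd_mult_iff[OF prime_p] by blast
        then have p2: "p = 2" using primes_dvd_imp_eq[OF prime_p two_is_prime_nat] by simp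
        define R' where "R' = red (strict_transform p (Affine t) G)"
        have "mcoeff R' (ycorner R') (zmin R') \<noteq> 0" unfolding R'_def by (rule mcoeff_corner[OF nz])
        moreover have "p dvd zmin R'" unfolding R'_def bound(3) using dvd by (simp add: dvd_diff_nat)
        ultimately have "\<not> p dvd ycorner R'" by (auto simp: R'_def mcoeff_red)
        moreover have "ycorner R' \<le> 2" using bound(1) True by (simp add: hi_def R'_def)
        ultimately have "ycorner R' \<noteq> 2" "ycorner R' \<le> 2" using p2 by auto
        then show ?thesis by (simp add: R'_def)
      qed
    qed
    then show ?thesis by (rule frame_monomial_at_ycorner_le_1[OF fr nz])
  qed
qed

definition staircase_point :: "nat \<Rightarrow> nat \<Rightarrow> nat \<Rightarrow> 'k fps fps \<Rightarrow> bool" where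
  "staircase_point a k d F \<longleftrightarrow> (\<exists>c. local_coords (fst c) (snd c) \<and> upset (expansion p F c) = staircase a k d)"

lemma staircase_point_blowup:
  assumes F: "red F \<noteq> 0" "ord_ge p F" and st: "staircase_point a k d F"
    and k: "k \<noteq> 1 \<or> a = Suc d - p \<and> p \<le> Suc d \<and> \<not> p dvd Suc d"
    and nt: "\<not> terminal p (strict_transform p a' F)"
  obtains k' where "k = Suc k'" "k' \<noteq> 0" "staircase_point (a + Suc d - p) k' d (recenter (strict_transform p a' F))"
proof -
  obtain Y Z where lc: "local_coords Y Z" and up: "upset (expansion p F (Y, Z)) = staircase a k d"
    using st by (auto simp: staircase_point_def)
  have c: "(Y, Z) \<in> subordinate_coords Z" using lc by (simp add: subordinate_coords_def)
  define G where "G = in_coords F Y Z"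
  have FG: "F = subst2 G Y Z" by (simp add: G_def subst2_in_coords[OF lc])
  have G: "red G \<noteq> 0" "ord_ge p G"
    using red_in_coords_nonzero[OF lc F(1)] ord_ge_in_coords[OF lc F(2)] by (simp_all add: G_def)
  have up': "upset (red G) = staircase a k d" using up by (simp add: expansion_def G_def)
  obtain a'' where fr: "frame (strict_transform p a' F) (induced_flag a' Z) (strict_transform p a'' G)"
    by (rule blowup_frame[OF c FG G(2)])
  note nm = nonterminal_recenter(1)[OF nt]
  have inf: "a'' = Infinite"
  proof (cases a'')
    case (Affine t)
    then show ?thesis using staircase_affine[OF G up' k] fr nm by blast
  qed
  note nz = red_strict_transform_nonzero[OF G, of Infinite]
  have not_monomial: "ymin (red (strict_transform p Infinite G)) \<noteq> ycorner (red (strict_transform p Infinite G))"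
    using frame_monomial_at[OF fr[unfolded inf] nz] nm by blast
  have "k \<noteq> 0"
  proof
    assume k0: "k = 0"
    have R: "ord_ge p (red G)" using G by (simp add: ord_ge_red)
    note st = upset_staircaseD[OF up'] and ms = staircase_measures[OF up']
    have n: "a + d \<le> initial_order (red G)"
      by (rule initial_order_attained[OF G(1)]) (use st(1) k0 in \<open>fastforce simp: staircase_def\<close>)
    have red: "red (strict_transform p Infinite G) = infinity_transform p (red G)"
      using G by (simp add: strict_transform_infinite red_infinity_transform)
    show False
      using not_monomial infinity_transform_measures[OF G(1) R] ms k0 n
        ymin_le_ycorner[OF infinity_transform_nonzero[OF G(1) R]] unfolding red by simp
  qed
  then obtain k' where k': "k = Suc k'" by (cases k) auto
  have up'': "upset (red (strict_transform p Infinite G)) = staircase (a + Suc d - p) k' d"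
    using staircase_infinite[OF G] up' k' by simp
  then have "k' \<noteq> 0" using staircase_measures[OF up''] not_monomial by auto
  obtain c' where c': "c' \<in> subordinate_coords (induced_flag a' Z)"
    "upset (expansion p (strict_transform p a' F) c') = upset (red (strict_transform p Infinite G))"
    by (rule frame_realize[OF fr[unfolded inf]])
  have "local_coords (fst c') (snd c')" using c'(1) by (cases c') (simp add: subordinate_coords_def)
  then have "staircase_point (a + Suc d - p) k' d (recenter (strict_transform p a' F))"
    unfolding staircase_point_def recenter_def
    using c'(2) up'' by (intro exI[of _ c']) (simp add: expansion_minus_scalar[OF c'(1)])
  then show ?thesis using that k' \<open>k' \<noteq> 0\<close> by blast
qed

lemma staircase_point_0_resolved:
  assumes "red F \<noteq> 0" "ord_ge p F" "staircase_point a 0 d F"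
  shows "finitely_resolved p F"
  by (rule finitely_resolvedI[OF assms(1,2)]) (rule staircase_point_blowup[OF assms], auto)

text \<open>
  After one blowup there is only the point at infinity left, with the special staircase from
  \<open>staircase_affine\<close> for \<open>k = 1\<close>. Here \<open>p\<close> does not divide \<open>d + 1\<close>, because \<open>z\<^bsup>d+1\<^esup>\<close> is a
  term of the class.
\<close>

lemma low_quasi_monomial_resolved:
  assumes F: "red F \<noteq> 0" "ord_ge p F" and st: "staircase_point 0 2 d F"
  shows "finitely_resolved p F"
proof (rule finitely_resolvedI[OF F])
  obtain Y Z where "local_coords Y Z" and up: "upset (red (in_coords F Y Z)) = staircase 0 2 d"
    using st by (auto simp: staircase_point_def expansion_def)
  then have nz: "mcoeff (red (in_coords F Y Z)) 0 (Suc d) \<noteq> 0" using upset_staircaseD(3)[OF up] by simp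
  have pd: "p \<le> Suc d" "\<not> p dvd Suc d"
    using ord_ge_supp[OF ord_ge_red[OF ord_ge_in_coords[OF \<open>local_coords Y Z\<close> F(2)]] nz] nz
    by (auto simp: mcoeff_red)
  fix a' assume nt: "\<not> terminal p (strict_transform p a' F)"
  define F' where "F' = recenter (strict_transform p a' F)"
  obtain k' where "(2::nat) = Suc k'" "staircase_point (0 + Suc d - p) k' d F'"
    unfolding F'_def by (rule staircase_point_blowup[OF F st _ nt]) auto
  then have st': "staircase_point (Suc d - p) 1 d F'" by simp
  have F': "red F' \<noteq> 0" "ord_ge p F'"
    using nonterminal_recenter(2)[OF nt] red_strict_transform_nonzero[OF F] by (simp_all add: F'_def red_recenter)
  show "finitely_resolved p F'"
  proof (rule finitely_resolvedI[OF F'])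
    fix b assume nt': "\<not> terminal p (strict_transform p b F')"
    show "finitely_resolved p (recenter (strict_transform p b F'))"
      by (rule staircase_point_blowup[OF F' st' _ nt']) (use pd in auto)
  qed
qed

lemma presentation_monomial:
  assumes pr: "presentation F h G" and eq: "ymin (red G) = ycorner (red G)"
  shows "\<exists>a d. staircase_point a 0 d F"
proof -
  have fr: "frame F h G" and G: "red G \<noteq> 0" using pr by (simp_all add: presentation_def exact_frame_imp_frame)
  obtain c where c: "c \<in> subordinate_coords h" "upset (expansion p F c) = upset (red G)"
    by (rule frame_realize[OF fr])
  have "upset (red G) = staircase (ymin (red G)) 0 (zmin (red G))"
  proof (rule upset_staircaseI)
    fix i j assume "mcoeff (red G) i j \<noteq> 0"
    then show "(i, j) \<in> staircase (ymin (red G)) 0 (zmin (red G))"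
      using ymin_le zmin_le by (fastforce simp: staircase_def)
  qed (use mcoeff_corner[OF G] eq in auto)
  moreover have "local_coords (fst c) (snd c)" using c(1) by (cases c) (simp add: subordinate_coords_def)
  ultimately show ?thesis using c(2) unfolding staircase_point_def by metis
qed

lemma presentation_quasi_monomial:
  assumes pr: "presentation F h G" and q: "ymin (red G) = 0" "ztop (red G) = Suc (zmin (red G))"
  shows "staircase_point 0 (ycorner (red G)) (zmin (red G)) F" "2 \<le> ycorner (red G)"
proof -
  have fr: "frame F h G" and G: "red G \<noteq> 0" "optimal G" using pr by (simp_all add: presentation_def exact_frame_imp_frame)
  obtain c where c: "c \<in> subordinate_coords h" "upset (expansion p F c) = upset (red G)"
    by (rule frame_realize[OF fr])
  have top: "mcoeff (red G) 0 (Suc (zmin (red G))) \<noteq> 0" using mcoeff_top[OF G(1)] q by simp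
  have "ycorner (red G) \<noteq> 0"
  proof
    assume "ycorner (red G) = 0"
    then have "mcoeff (red G) (ymin (red G)) (zmin (red G)) \<noteq> 0" using mcoeff_corner[OF G(1)] q by simp
    then show False using ztop_le q by fastforce
  qed
  then show "2 \<le> ycorner (red G)" using optimal_ycorner_ge_2[OF G] q by simp
  have "upset (red G) = staircase 0 (ycorner (red G)) (zmin (red G))"
  proof (rule upset_staircaseI)
    fix i j assume ij: "mcoeff (red G) i j \<noteq> 0"
    then show "(i, j) \<in> staircase 0 (ycorner (red G)) (zmin (red G))"
      using zmin_le[OF ij] ycorner_le[of "red G" i] by (cases "j = zmin (red G)") (auto simp: staircase_def)
  qed (use mcoeff_corner[OF G(1)] top in auto)
  moreover have "local_coords (fst c) (snd c)" using c(1) by (cases c) (simp add: subordinate_coords_def)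
  ultimately show "staircase_point 0 (ycorner (red G)) (zmin (red G)) F"
    using c(2) unfolding staircase_point_def by metis
qed

text \<open>
  Subtracting the constant term of a strict transform does not change its expansions modulo
  \<open>p\<close>-th powers. So optimal coordinates before and after this step have the same measures.
\<close>

lemma same_expansion_measures:
  assumes exp: "\<And>c. c \<in> subordinate_coords h \<Longrightarrow> expansion p F1 c = expansion p F2 c"
    and 1: "frame F1 h G1" "red G1 \<noteq> 0" "optimal G1" and 2: "frame F2 h G2" "red G2 \<noteq> 0" "optimal G2"
  shows "height_rank G1 = height_rank G2"
    "ymin (red G1) < ycorner (red G1) \<longleftrightarrow> ymin (red G2) < ycorner (red G2)"
    "ymin (red G1) < ycorner (red G1) \<Longrightarrow> slope (red G1) = slope (red G2)"
proof -
  have le: "ymin (red G) \<le> ymin (red G') \<and> ycorner (red G) = ycorner (red G')"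
    if exp: "\<And>c. c \<in> subordinate_coords h \<Longrightarrow> expansion p F c = expansion p F' c"
      and 1: "frame F h G" and 2: "frame F' h G'" "red G' \<noteq> 0" "optimal G'" for F F' G G'
  proof -
    obtain c where c: "c \<in> subordinate_coords h" "upset (expansion p F c) = upset (red G)"
      by (rule frame_realize[OF 1])
    obtain g where g: "fps_nth g 0 = 0" "upset (expansion p F' c) = upset (red (shift g G'))"
      by (rule frame_expansion[OF 2(1) c(1)])
    have "upset (red G) = upset (red (shift g G'))" using c g exp[OF c(1)] by simp
    note m = upset_measures_cong[OF this]
    show ?thesis using m shift_corner(2)[OF g(1) 2(2)] 2(3) g(1) by (simp add: optimal_def maximal_ymin_def)
  qed
  have y: "ymin (red G1) = ymin (red G2)" "ycorner (red G1) = ycorner (red G2)"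
    using le[OF exp 1(1) 2] le[OF exp[symmetric] 2(1) 1] by auto
  show "height_rank G1 = height_rank G2"
    "ymin (red G1) < ycorner (red G1) \<longleftrightarrow> ymin (red G2) < ycorner (red G2)"
    using y by (simp_all add: height_rank_def)
  assume lt: "ymin (red G1) < ycorner (red G1)"
  have "realizing_coords p h F1 = realizing_coords p h F2"
    using exp y frame_invariants(2)[OF 1(1,2)] frame_invariants(2)[OF 2(1,2)] 1(3) 2(3) by (auto simp: optimal_def)
  moreover have "expansion p F1 c = expansion p F2 c" if "c \<in> realizing_coords p h F2" for c
    using that exp by (simp add: realizing_coords_def)
  ultimately have "slope_at p h F1 = slope_at p h F2"
    unfolding slope_at_def by (metis (no_types, lifting))
  then show "slope (red G1) = slope (red G2)"
    using frame_vector(2)[OF 1 lt] frame_vector(2)[OF 2] lt y by simp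
qed

text \<open>
  If the rank does not change, the slope drops by at least one, so its integral part suffices for
  the induction.
\<close>

definition slope_level :: "'k fps fps \<Rightarrow> nat" where
  "slope_level G = nat \<lfloor>real_of_ereal (slope (red G))\<rfloor>"

lemma presentationD:
  assumes "presentation F h G"
  shows "red F \<noteq> 0" "ord_ge p F"
proof -
  obtain Y Z where YZ: "(Y, Z) \<in> subordinate_coords h" "F = subst2 G Y Z" and G: "red G \<noteq> 0" "ord_ge p G"
    using assms by (auto simp: presentation_def exact_frame_def)
  note lc = subordinate_coordsD(1)[OF YZ(1)]
  show "ord_ge p F" using G local_coordsD[OF lc] by (simp add: YZ(2) ord_ge_subst2)
  show "red F \<noteq> 0"
  proof
    assume "red F = 0"
    then obtain H where "F = H ^ p" by (rule red_eq_0_imp_power_p)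
    then have "in_coords F Y Z = in_coords H Y Z ^ p"
      using local_coordsD[OF lc] by (simp add: in_coords_eq_iff[OF lc] subst2_power subst2_in_coords[OF lc])
    then show False using G(1) in_coords_subst2[OF lc, of G] by (simp add: YZ(2))
  qed
qed

text \<open>
  The form of \<open>blowup_descent\<close> that serves for the induction: the next centre is presented by its
  own optimal coordinates, after removing the constant term.
\<close>

lemma presentation_blowup:
  assumes pr: "presentation F h G" and lt: "ymin (red G) < ycorner (red G)"
    and nq: "\<not> (ymin (red G) = 0 \<and> ztop (red G) = Suc (zmin (red G)))"
    and nt: "\<not> terminal p (strict_transform p a' F)"
  obtains G' where "presentation (recenter (strict_transform p a' F)) (induced_flag a' h) G'"
    "height_rank G' < height_rank G \<or> height_rank G' = height_rank G \<and> slope_level G' < slope_level G"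
proof -
  define F' where "F' = strict_transform p a' F"
  have ex: "exact_frame F h G" and G: "red G \<noteq> 0" "ord_ge p G" "optimal G"
    using pr by (simp_all add: presentation_def)
  obtain Y Z where YZ: "(Y, Z) \<in> subordinate_coords h" "F = subst2 G Y Z"
    using ex by (auto simp: exact_frame_def)
  note F = presentationD[OF pr]
  obtain a'' where fr: "frame F' (induced_flag a' h) (strict_transform p a'' G)"
    unfolding F'_def by (rule blowup_frame[OF YZ G(2)])
  obtain Y' Z' where c': "(Y', Z') \<in> subordinate_coords (induced_flag a' h)"
    using fr by (auto simp: frame_def)
  have F': "red (recenter F') \<noteq> 0" "ord_ge p (recenter F')"
    using nonterminal_recenter(2)[OF nt] red_strict_transform_nonzero[OF F] by (simp_all add: F'_def red_recenter)
  obtain g' where "presentation (recenter F') (induced_flag a' h) (shift g' (in_coords (recenter F') Y' Z'))"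
    using presentation_exists[OF c' F'] by metis
  then obtain G' where pr': "presentation (recenter F') (induced_flag a' h) G'" by blast
  then have fr': "frame (recenter F') (induced_flag a' h) G'" "red G' \<noteq> 0" "optimal G'"
    by (simp_all add: presentation_def exact_frame_imp_frame)
  have exp: "expansion p (recenter F') c = expansion p F' c" if "c \<in> subordinate_coords (induced_flag a' h)" for c
    unfolding recenter_def by (rule expansion_minus_scalar[OF that])
  have nz: "red (shift g (strict_transform p a'' G)) \<noteq> 0" if "fps_nth g 0 = 0" for g
    using red_strict_transform_nonzero[OF G(1,2)] that by (simp add: red_shift_eq_0_iff)
  have "height_rank G' < height_rank G \<or> height_rank G' = height_rank G \<and> slope_level G' < slope_level G"
  proof (rule blowup_descent[OF G lt nq, of a''], goal_cases)
    case (1 g)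
    show ?case
      using same_expansion_measures(1)[OF exp fr' frame_shift[OF fr 1(1)] nz[OF 1(1)] 1(2)] 1(3) by simp
  next
    case (2 g s s')
    note same = same_expansion_measures[OF exp fr' frame_shift[OF fr 2(1)] nz[OF 2(1)] 2(2)]
    have "slope (red G') = ereal s'" using same(2,3) 2(4,6) by simp
    moreover have "nat \<lfloor>s'\<rfloor> < nat \<lfloor>s\<rfloor>" using 2(7,8) by linarith
    ultimately show ?case using same(1) 2(3,5) by (simp add: slope_level_def)
  qed
  then show ?thesis using that pr' by (simp add: F'_def)
qed

text \<open>
  Well-founded induction along \<open>presentation_blowup\<close>. The quasi-monomials are left to the
  assumption, which is verified first for the rank \<open>8\<close> and then, using this, for all ranks.
\<close>

lemma descent_resolved:
  assumes quasi: "\<And>F h G. presentation F h G \<Longrightarrow> height_rank G \<le> B \<Longrightarrow> ymin (red G) = 0 \<Longrightarrow>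
      ztop (red G) = Suc (zmin (red G)) \<Longrightarrow> finitely_resolved p F"
    and pr: "presentation F h G" and B: "height_rank G \<le> B"
  shows "finitely_resolved p F"
  using pr B
proof (induction "(height_rank G, slope_level G)" arbitrary: F h G
    rule: wf_induct_rule[OF wf_lex_prod[OF wf_less_than wf_less_than]])
  case (1 G F h)
  note F = presentationD[OF 1(2)]
  have G: "red G \<noteq> 0" using 1(2) by (simp add: presentation_def)
  show ?case
  proof (cases "ymin (red G) < ycorner (red G)")
    case False
    then have "ymin (red G) = ycorner (red G)" using ymin_le_ycorner[OF G] by simp
    then show ?thesis using presentation_monomial[OF 1(2)] staircase_point_0_resolved[OF F] by blast
  next
    case lt: True
    show ?thesis
    proof (cases "ymin (red G) = 0 \<and> ztop (red G) = Suc (zmin (red G))")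
      case True
      then show ?thesis using quasi[OF 1(2,3)] by blast
    next
      case nq: False
      show ?thesis
      proof (rule finitely_resolvedI[OF F])
        fix a' assume nt: "\<not> terminal p (strict_transform p a' F)"
        obtain G' where G': "presentation (recenter (strict_transform p a' F)) (induced_flag a' h) G'"
          "height_rank G' < height_rank G \<or> height_rank G' = height_rank G \<and> slope_level G' < slope_level G"
          by (rule presentation_blowup[OF 1(2) lt nq nt])
        show "finitely_resolved p (recenter (strict_transform p a' F))"
          by (rule 1(1)[OF _ G'(1)]) (use G'(2) 1(3) in auto)
      qed
    qed
  qed
qed

text \<open>
  Rank \<open>8\<close> is the intricacy one. A quasi-monomial of at most this rank has height two.
\<close>

lemma low_rank_resolved:
  assumes "presentation F h G" "height_rank G \<le> 8"
  shows "finitely_resolved p F"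
proof (rule descent_resolved[OF _ assms])
  fix F h G assume pr: "presentation F h G" and r: "height_rank G \<le> 8"
    and q: "ymin (red G) = 0" "ztop (red G) = Suc (zmin (red G))"
  note qm = presentation_quasi_monomial[OF pr q]
  have "ycorner (red G) = 2" using r qm(2) q by (simp add: height_rank_def rank_def)
  then show "finitely_resolved p F" using low_quasi_monomial_resolved[OF presentationD[OF pr]] qm(1) by simp
qed

text \<open>
  Blowing up decreases \<open>k\<close>. For \<open>k = 1\<close> the height is at most one, so the rank is at most \<open>8\<close>.
\<close>

lemma staircase_point_resolved:
  assumes "red F \<noteq> 0" "ord_ge p F" "staircase_point a (Suc k) d F"
  shows "finitely_resolved p F"
  using assms
proof (induction k arbitrary: F a)
  case 0
  obtain Y Z where lc: "local_coords Y Z" and up: "upset (expansion p F (Y, Z)) = staircase a 1 d"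
    using 0(3) by (auto simp: staircase_point_def)
  have c: "(Y, Z) \<in> subordinate_coords Z" using lc by (simp add: subordinate_coords_def)
  define G where "G = in_coords F Y Z"
  have nz: "red G \<noteq> 0" unfolding G_def by (rule red_in_coords_nonzero[OF lc 0(1)])
  have up': "upset (red G) = staircase a 1 d" using up by (simp add: expansion_def G_def)
  obtain g where g: "fps_nth g 0 = 0" and pr: "presentation F Z (shift g G)"
    unfolding G_def using presentation_exists[OF c 0(1,2)] by metis
  have "fps_nth (- g) 0 = 0" using g by simp
  moreover have "shift (- g) (shift g G) = G" using g by (simp add: shift_shift)
  moreover have "maximal_ymin (shift g G)" using pr by (simp add: presentation_def optimal_def)
  ultimately have "ymin (red G) \<le> ymin (red (shift g G))" unfolding maximal_ymin_def by metis
  then have "ycorner (red (shift g G)) - ymin (red (shift g G)) \<le> 1"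
    using staircase_measures[OF up'] shift_corner(2)[OF g nz] by simp
  moreover have "rank n e \<le> 8" if "n \<le> 1" for n e using that by (auto simp: rank_def)
  ultimately have "height_rank (shift g G) \<le> 8" by (simp only: height_rank_def)
  then show ?case by (rule low_rank_resolved[OF pr])
next
  case (Suc k)
  show ?case
  proof (rule finitely_resolvedI[OF Suc.prems(1,2)])
    fix a' assume nt: "\<not> terminal p (strict_transform p a' F)"
    obtain k' where "Suc (Suc k) = Suc k'" "staircase_point (a + Suc d - p) k' d (recenter (strict_transform p a' F))"
      by (rule staircase_point_blowup[OF Suc.prems _ nt]) auto
    then show "finitely_resolved p (recenter (strict_transform p a' F))"
      using nonterminal_recenter(2)[OF nt] red_strict_transform_nonzero[OF Suc.prems(1,2)]
      by (intro Suc.IH) (auto simp: red_recenter)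
  qed
qed

lemma finitely_resolved_all:
  assumes F: "red F \<noteq> 0" "ord_ge p F"
  shows "finitely_resolved p F"
proof -
  have c: "(y_var, z_var) \<in> subordinate_coords z_var"
    by (simp add: subordinate_coords_def local_coords_variables)
  obtain g where pr: "presentation F z_var (shift g (in_coords F y_var z_var))"
    using presentation_exists[OF c F] by metis
  show ?thesis
  proof (rule descent_resolved[OF _ pr order_refl])
    fix F h G assume pr: "presentation F h G" and q: "ymin (red G) = 0" "ztop (red G) = Suc (zmin (red G))"
    note qm = presentation_quasi_monomial[OF pr q]
    then obtain k where "ycorner (red G) = Suc k" by (cases "ycorner (red G)") auto
    then show "finitely_resolved p F" using staircase_point_resolved[OF presentationD[OF pr]] qm(1) by simp
  qed
qed

end

section \<open>Polynomials that are not p-th powers\<close>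

lemma coeff_power_CHAR:
  fixes f :: "'a::comm_ring_1 poly"
  assumes "prime p" "CHAR('a) = p"
  shows "coeff (f ^ p) n = (if p dvd n then coeff f (n div p) ^ p else 0)"
  using fps_power_CHAR_nth[OF assms, of "fps_of_poly f" n] by (simp flip: fps_of_poly_power)

lemma mcoeff_series_of_poly: "mcoeff (series_of_poly F) a b = coeff (coeff F b) a"
  by (simp add: mcoeff_def series_of_poly_def coeff_map_poly)

context char_p begin

lemma red_series_of_poly_nonzero:
  fixes F :: "'k poly poly"
  assumes F: "\<nexists>H. F = H ^ p"
  shows "red (series_of_poly F) \<noteq> 0"
proof
  assume *: "red (series_of_poly F) = 0"
  have zero: "coeff (coeff F b) a = 0" if "\<not> (p dvd a \<and> p dvd b)" for a b
    using arg_cong[OF *, of "\<lambda>G. mcoeff G a b"] that by (auto simp: mcoeff_red mcoeff_series_of_poly)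
  have "\<exists>r. r ^ p = c" for c :: 'k using nth_root_exists[of p] p_pos by blast
  then obtain r :: "'k \<Rightarrow> 'k" where r: "\<And>c. r c ^ p = c" by metis
  have r0: "r 0 = 0" using r[of 0] p_pos by simp
  define q where "q b = (\<Sum>a\<le>degree (coeff F (b * p)). monom (r (coeff (coeff F (b * p)) (a * p))) a)" for b
  define H where "H = (\<Sum>b\<le>degree F. monom (q b) b)"
  have large: "m < n * p" if "m < n" for m n
  proof -
    have "n * 1 \<le> n * p" using p_pos by (intro mult_le_mono2) simp
    then show ?thesis using that by linarith
  qed
  have q: "coeff (q b) a = r (coeff (coeff F (b * p)) (a * p))" for a b
    unfolding q_def coeff_sum using r0 large[of "degree (coeff F (b * p))" a]
    by (auto simp: coeff_monom coeff_eq_0 not_le)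
  have H: "coeff (coeff H b) a = r (coeff (coeff F (b * p)) (a * p))" for a b
  proof -
    have "coeff H b = (if b \<le> degree F then q b else 0)"
      unfolding H_def coeff_sum by (simp add: coeff_monom)
    then show ?thesis using r0 large[of "degree F" b] by (auto simp: q coeff_eq_0 not_le)
  qed
  have "F = H ^ p"
  proof (rule poly_eqI, rule poly_eqI)
    fix b a
    show "coeff (coeff F b) a = coeff (coeff (H ^ p) b) a"
      using zero[of a b] prime_p CHAR_eq by (auto simp: coeff_power_CHAR H r)
  qed
  then show False using F by blast
qed

end

theorem theorem1:
  fixes F :: "'k::alg_closed_field poly poly"
    and h :: "'k fps fps"
    and p :: nat
    and \<epsilon> \<delta> :: real
  assumes "CHAR('k) = p" and "p > 0"
    and "0 < \<epsilon>" and "\<epsilon> < \<delta>" and "\<delta> < 1"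
    and "series_order (series_of_poly F) \<ge> enat p"
    and "\<nexists>H. F = H ^ p"
    and "local_flag h"
    and "\<not> quasi_monomial_at p h (series_of_poly F)"
  shows "(\<not> subordinate_monomial_at p h (series_of_poly F) \<longrightarrow>
      (\<forall>a'. lex_less
        (adjusted_height_vector \<epsilon> \<delta> p (induced_flag a' h)
          (strict_transform p a' (series_of_poly F)))
        (adjusted_height_vector \<epsilon> \<delta> p h (series_of_poly F)))) \<and>
    finitely_resolved p (series_of_poly F)"
proof -
  interpret char_p p "TYPE('k)" using assms(1,2) by unfold_locales
  have F: "red (series_of_poly F) \<noteq> 0" "ord_ge p (series_of_poly F)"
    using red_series_of_poly_nonzero assms(6,7) by (simp_all add: ord_ge_iff_series_order)
  show ?thesis
    using adjusted_height_vector_decreases[OF assms(3-5) F assms(8,9)] finitely_resolved_all[OF F] by blast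
qed

end
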